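(* For every $n\ge1$, the group $\pi(\mathbf A_n)$ has the presentation $\langle G_n\mid R_n\rangle$, where the formal generators correspond to elements of $\pi(\mathbf A_n)$ as described in the context, and $G_n,R_n$ are defined inductively as follows (all $i,j,k$ positive integers). $G_1=R_1=\emptyset$, and for $n\ge2$: Generators: $G_n$ is the union of 1. $\lambda^i\# G_{n-i}$ and $\rho^{n-i}\# G_i$ for $i=1,\dots,n-1$; 2. $\{\langle i,j,k\rangle: i+j+k=n\}$. Relations: $R_n$ is the union of 1. for each $\langle i,j,k\rangle$ with $i+j+k=n$: (a) $\langle i,j,k\rangle*\rho^k\rho^jx*\langle i,j,k\rangle^{-1}=\rho^{j+k}x$ for all $x\in G_i$; (b) $\langle i,j,k\rangle*\rho^k\lambda^iy*\langle i,j,k\rangle^{-1}=\lambda^i\rho^ky$ for all $y\in G_j$; (c) $\langle i,j,k\rangle*\lambda^{i+j}z*\langle i,j,k\rangle^{-1}=\lambda^i\lambda^jz$ for all $z\in G_k$; 2. $\langle i,1,k\rangle=e$ for all $i+1+k=n$; 3. $\lambda^i\# R_{n-i}$ and $\rho^{n-i}\# R_i$ for $i=1,\dots,n-1$; 4. $\rho^{n-i}x*\lambda^iy=\lambda^iy*\rho^{n-i}x$ for all $x\in G_i$, $y\in G_{n-i}$, $1\le i\le n-1$.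
   Context: Catalan groupoids: let $\mathbf I$ (resp. $\dot{\mathbf I}$) be the indiscrete (resp. discrete) category with two objects $0,1$, and $\iota:0\to1$ the nontrivial isomorphism. Groupoids $\mathbf A_n$ ($n\ge1$) and functors $U_{a,b}:\mathbf A_a\times\mathbf A_b\to\mathbf A_{a+b}$, $V_{i,j,k}:\mathbf A_i\times\mathbf A_j\times\mathbf A_k\times\mathbf I\to\mathbf A_{i+j+k}$ are defined inductively (indices positive). $\mathbf A_1=\mathbf 1$ with one object $*$. For $n\ge2$, $\mathbf A_n$ is the pushout of categories of $$\coprod_{i+j+k=n}\mathbf A_i\times\mathbf A_j\times\mathbf A_k\times\mathbf I\ \hookleftarrow\ \coprod_{i+j+k=n}\mathbf A_i\times\mathbf A_j\times\mathbf A_k\times\dot{\mathbf I}\ \xrightarrow{W_{i,j,k}}\ \coprod_{a+b=n}\mathbf A_a\times\mathbf A_b,$$ $W_{i,j,k}(f,g,h,0)=(f,U_{j,k}(g,h))$, $W_{i,j,k}(f,g,h,1)=(U_{i,j}(f,g),h)$ (similarly on morphisms); $V_{i,j,k},U_{a,b}$ are the structure maps. Maximal indiscrete subgroupoids: $\mathbf T_1=\mathbf 1$, and for $n\ge2$, $\mathbf T_n$ is defined by the same inductive pushout with $\mathbf T$ in place of $\mathbf A$ and with only the terms $j=1$ allowed in the two left-hand coproducts, i.e. the pushout of $\coprod_{i+1+k=n}\mathbf T_i\times\mathbf T_1\times\mathbf T_k\times\mathbf I\hookleftarrow\coprod_{i+1+k=n}\mathbf T_i\times\mathbf T_1\times\mathbf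 T_k\times\dot{\mathbf I}\to\coprod_{a+b=n}\mathbf T_a\times\mathbf T_b$. There is an evident inclusion $L_n:\mathbf T_n\to\mathbf A_n$ (induced inductively by the pushout), which is bijective on objects, and $\mathbf T_n$ is indiscrete. The group $\pi(\mathbf A_n)$ is the pushout (in categories) of $\mathbf 1\leftarrow\mathbf T_n\xrightarrow{L_n}\mathbf A_n$, a one-object groupoid viewed as a group. Notation for generators: generators are formal symbols $X\langle i,j,k\rangle$, with $X$ an element of the free monoid on $\lambda,\rho$ (written by concatenation) and $i,j,k\ge1$; in $G_n$ one has $\mathrm{length}(X)+i+j+k=n$. For a set $G$ of such symbols, $X\# G=\{Xy:y\in G\}$; for a set $R$ of relators, $X\# R=\{Xy_1*\cdots*Xy_m: y_1*\cdots*y_m\in R\}$ (prefix $X$ to every letter, inverses included). A relation $y_1=y_2$ means the relator $y_1*y_2^{-1}$. $*$ is the group operation, $e$ the identity; $x*y$ is written in path order (first $x$, then $y$). Correspondence: $\langle i,j,k\rangle$ with $i+j+k=n$ is the class in $\pi(\mathbf A_n)$ of $V_{i,j,k}(\mathrm{Id}_f,\mathrm{Id}_g,\mathrm{Id}_h,\iota)$ (any objects $f\in\mathbf A_i,g\in\mathbf A_j,h\in\mathbf A_k$); if $y$ is the class in $\pi(\mathbf A_{n-a})$ of a morphism $\phi$ of $\mathbf A_{n-a}$, then $\lambda^ay$ is the class in $\pi(\mathbf A_n)$ of $U_{a,n-a}(\mathrm{Id},\phi)$ and $\rho^ay$ is the class of $U_{n-a,a}(\phi,\mathrm{Id})$.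 *)

theory Defs
  imports "HOL-Algebra.Coset"
begin

section \<open>Small categories and functors\<close>

text \<open>
  Composition is written in diagrammatic (path) order: \<open>Comp C f g\<close> is first \<open>f\<close>, then \<open>g\<close>,
  and is meaningful when \<open>Cod C f = Dom C g\<close>.
\<close>

record ('o, 'm) cat =
  Obj :: "'o set"
  Arr :: "'m set"
  Dom :: "'m \<Rightarrow> 'o"
  Cod :: "'m \<Rightarrow> 'o"
  Ident :: "'o \<Rightarrow> 'm"
  Comp :: "'m \<Rightarrow> 'm \<Rightarrow> 'm"

locale category =
  fixes C :: "('o, 'm) cat"
  assumes Dom_Obj: "f \<in> Arr C \<Longrightarrow> Dom C f \<in> Obj C"
    and Cod_Obj: "f \<in> Arr C \<Longrightarrow> Cod C f \<in> Obj C"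
    and Ident_Arr: "x \<in> Obj C \<Longrightarrow> Ident C x \<in> Arr C"
    and Dom_Ident: "x \<in> Obj C \<Longrightarrow> Dom C (Ident C x) = x"
    and Cod_Ident: "x \<in> Obj C \<Longrightarrow> Cod C (Ident C x) = x"
    and Comp_Arr: "\<lbrakk>f \<in> Arr C; g \<in> Arr C; Cod C f = Dom C g\<rbrakk> \<Longrightarrow> Comp C f g \<in> Arr C"
    and Dom_Comp: "\<lbrakk>f \<in> Arr C; g \<in> Arr C; Cod C f = Dom C g\<rbrakk> \<Longrightarrow> Dom C (Comp C f g) = Dom C f"
    and Cod_Comp: "\<lbrakk>f \<in> Arr C; g \<in> Arr C; Cod C f = Dom C g\<rbrakk> \<Longrightarrow> Cod C (Comp C f g) = Cod C g"
    and Ident_left: "f \<in> Arr C \<Longrightarrow> Comp C (Ident C (Dom C f)) f = f"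
    and Ident_right: "f \<in> Arr C \<Longrightarrow> Comp C f (Ident C (Cod C f)) = f"
    and Comp_assoc: "\<lbrakk>f \<in> Arr C; g \<in> Arr C; h \<in> Arr C; Cod C f = Dom C g; Cod C g = Dom C h\<rbrakk>
      \<Longrightarrow> Comp C (Comp C f g) h = Comp C f (Comp C g h)"

locale groupoid = category +
  assumes invertible: "f \<in> Arr C \<Longrightarrow> \<exists>g\<in>Arr C. Dom C g = Cod C f \<and> Cod C g = Dom C f \<and>
    Comp C f g = Ident C (Dom C f) \<and> Comp C g f = Ident C (Cod C f)"

record ('o, 'm, 'p, 'n) func =
  ob :: "'o \<Rightarrow> 'p"
  ar :: "'m \<Rightarrow> 'n"

definition is_functor :: "('o, 'm) cat \<Rightarrow> ('p, 'n) cat \<Rightarrow> ('o, 'm, 'p, 'n) func \<Rightarrow> bool" where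
  "is_functor C D F \<longleftrightarrow>
    (\<forall>x\<in>Obj C. ob F x \<in> Obj D) \<and>
    (\<forall>f\<in>Arr C. ar F f \<in> Arr D \<and> Dom D (ar F f) = ob F (Dom C f) \<and> Cod D (ar F f) = ob F (Cod C f)) \<and>
    (\<forall>x\<in>Obj C. ar F (Ident C x) = Ident D (ob F x)) \<and>
    (\<forall>f\<in>Arr C. \<forall>g\<in>Arr C. Cod C f = Dom C g \<longrightarrow> ar F (Comp C f g) = Comp D (ar F f) (ar F g))"

text \<open>HOL functions are total, so functors out of \<open>C\<close> are compared on the objects and arrows of \<open>C\<close> only.\<close>

definition func_eq :: "('o, 'm) cat \<Rightarrow> ('o, 'm, 'p, 'n) func \<Rightarrow> ('o, 'm, 'p, 'n) func \<Rightarrow> bool" where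
  "func_eq C F G \<longleftrightarrow> (\<forall>x\<in>Obj C. ob F x = ob G x) \<and> (\<forall>f\<in>Arr C. ar F f = ar G f)"

definition func_id :: "('o, 'm, 'o, 'm) func" where
  "func_id = \<lparr>ob = id, ar = id\<rparr>"

definition func_comp :: "('p, 'n, 'q, 'l) func \<Rightarrow> ('o, 'm, 'p, 'n) func \<Rightarrow> ('o, 'm, 'q, 'l) func"
    (infixl "\<circ>\<^sub>F" 55) where
  "G \<circ>\<^sub>F F = \<lparr>ob = ob G \<circ> ob F, ar = ar G \<circ> ar F\<rparr>"

definition prod_cat :: "('o, 'm) cat \<Rightarrow> ('p, 'n) cat \<Rightarrow> ('o \<times> 'p, 'm \<times> 'n) cat"
    (infixr "\<times>\<^sub>C" 70) where
  "C \<times>\<^sub>C D = \<lparr>Obj = Obj C \<times> Obj D, Arr = Arr C \<times> Arr D,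
    Dom = map_prod (Dom C) (Dom D), Cod = map_prod (Cod C) (Cod D),
    Ident = map_prod (Ident C) (Ident D),
    Comp = (\<lambda>(f, g) (f', g'). (Comp C f f', Comp D g g'))\<rparr>"

definition prod_func :: "('o, 'm, 'p, 'n) func \<Rightarrow> ('o', 'm', 'p', 'n') func
    \<Rightarrow> ('o \<times> 'o', 'm \<times> 'm', 'p \<times> 'p', 'n \<times> 'n') func" (infixr "\<times>\<^sub>F" 70) where
  "F \<times>\<^sub>F G = \<lparr>ob = map_prod (ob F) (ob G), ar = map_prod (ar F) (ar G)\<rparr>"

definition coprod_cat :: "'i set \<Rightarrow> ('i \<Rightarrow> ('o, 'm) cat) \<Rightarrow> ('i \<times> 'o, 'i \<times> 'm) cat" where
  "coprod_cat I C = \<lparr>Obj = (SIGMA i:I. Obj (C i)), Arr = (SIGMA i:I. Arr (C i)),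
    Dom = (\<lambda>(i, f). (i, Dom (C i) f)), Cod = (\<lambda>(i, f). (i, Cod (C i) f)),
    Ident = (\<lambda>(i, x). (i, Ident (C i) x)),
    Comp = (\<lambda>(i, f) (_, g). (i, Comp (C i) f g))\<rparr>"

definition copair :: "('i \<Rightarrow> ('o, 'm, 'p, 'n) func) \<Rightarrow> ('i \<times> 'o, 'i \<times> 'm, 'p, 'n) func" where
  "copair F = \<lparr>ob = (\<lambda>(i, x). ob (F i) x), ar = (\<lambda>(i, f). ar (F i) f)\<rparr>"

text \<open>
  The arrow from \<open>a\<close> to \<open>b\<close> is the pair \<open>(a, b)\<close>, so \<open>discrete S\<close> is a subcategory of
  \<open>indiscrete S\<close> and the inclusion functor is \<open>func_id\<close>.
\<close>

definition indiscrete :: "'o set \<Rightarrow> ('o, 'o \<times> 'o) cat" where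
  "indiscrete S = \<lparr>Obj = S, Arr = S \<times> S, Dom = fst, Cod = snd, Ident = (\<lambda>a. (a, a)),
    Comp = (\<lambda>f g. (fst f, snd g))\<rparr>"

definition discrete :: "'o set \<Rightarrow> ('o, 'o \<times> 'o) cat" where
  "discrete S = (indiscrete S)\<lparr>Arr := {(a, a) | a. a \<in> S}\<rparr>"

definition terminal_cat :: "('o, 'm) cat \<Rightarrow> bool" where
  "terminal_cat C \<longleftrightarrow> category C \<and> (\<exists>x. Obj C = {x}) \<and> (\<exists>f. Arr C = {f})"

definition one_object_groupoid :: "('o, 'm) cat \<Rightarrow> bool" where
  "one_object_groupoid C \<longleftrightarrow> groupoid C \<and> (\<exists>x. Obj C = {x})"

definition arrow_monoid :: "('o, 'm) cat \<Rightarrow> 'm monoid" where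
  "arrow_monoid C = \<lparr>carrier = Arr C, mult = Comp C, one = Ident C (the_elem (Obj C))\<rparr>"

text \<open>
  The functors \<open>P\<close> and \<open>Q\<close> exhibit \<open>X\<close> as the pushout of \<open>B \<leftarrow>F\<midarrow> C \<midarrow>G\<rightarrow> D\<close>. The test categories \<open>Y\<close> are
  the categories whose objects and arrows lie in the same types as those of \<open>X\<close>; these two
  types play the role of a universe of small sets. If \<open>B\<close>, \<open>C\<close>, \<open>D\<close> are countable and the types
  are infinite, a pushout \<open>X'\<close> in the category of all small categories is countable, so it has
  a copy among the \<open>Y\<close>; comparing \<open>X\<close> with that copy shows that the condition below says
  exactly that \<open>X\<close> is a pushout of small categories.
\<close>

definition is_pushout ::
  "('oc, 'mc) cat \<Rightarrow> ('ob, 'mb) cat \<Rightarrow> ('od, 'md) cat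
    \<Rightarrow> ('oc, 'mc, 'ob, 'mb) func \<Rightarrow> ('oc, 'mc, 'od, 'md) func
    \<Rightarrow> ('o, 'm) cat \<Rightarrow> ('ob, 'mb, 'o, 'm) func \<Rightarrow> ('od, 'md, 'o, 'm) func \<Rightarrow> bool" where
  "is_pushout C B D F G X P Q \<longleftrightarrow>
    category C \<and> category B \<and> category D \<and> is_functor C B F \<and> is_functor C D G \<and>
    category X \<and> is_functor B X P \<and> is_functor D X Q \<and> func_eq C (P \<circ>\<^sub>F F) (Q \<circ>\<^sub>F G) \<and>
    (\<forall>(Y :: ('o, 'm) cat) S T.
      category Y \<and> is_functor B Y S \<and> is_functor D Y T \<and> func_eq C (S \<circ>\<^sub>F F) (T \<circ>\<^sub>F G) \<longrightarrow>
      (\<exists>H. is_functor X Y H \<and> func_eq B (H \<circ>\<^sub>F P) S \<and> func_eq D (H \<circ>\<^sub>F Q) T \<and>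
        (\<forall>H'. is_functor X Y H' \<and> func_eq B (H' \<circ>\<^sub>F P) S \<and> func_eq D (H' \<circ>\<^sub>F Q) T \<longrightarrow>
          func_eq X H' H)))"


section \<open>Catalan groupoids\<close>

definition pairs :: "nat \<Rightarrow> (nat \<times> nat) set" where
  "pairs n = {(a, b). 1 \<le> a \<and> 1 \<le> b \<and> a + b = n}"

definition triples :: "nat \<Rightarrow> (nat \<times> nat \<times> nat) set" where
  "triples n = {(i, j, k). 1 \<le> i \<and> 1 \<le> j \<and> 1 \<le> k \<and> i + j + k = n}"

definition triples1 :: "nat \<Rightarrow> (nat \<times> nat \<times> nat) set" where
  "triples1 n = {(i, j, k). (i, j, k) \<in> triples n \<and> j = 1}"

abbreviation Icat :: "(nat, nat \<times> nat) cat" where "Icat \<equiv> indiscrete {0, 1}"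
abbreviation Idot :: "(nat, nat \<times> nat) cat" where "Idot \<equiv> discrete {0, 1}"
abbreviation \<iota> :: "nat \<times> nat" where "\<iota> \<equiv> (0, 1)"

type_synonym 'u U_family = "nat \<Rightarrow> nat \<Rightarrow> ('u \<times> 'u, 'u \<times> 'u, 'u, 'u) func"
type_synonym 'u V_family = "nat \<Rightarrow> nat \<Rightarrow> nat
  \<Rightarrow> ('u \<times> 'u \<times> 'u \<times> nat, 'u \<times> 'u \<times> 'u \<times> nat \<times> nat, 'u, 'u) func"

text \<open>The arrows of \<open>Idot\<close> are \<open>(0, 0)\<close> and \<open>(1, 1)\<close>, so the first component tells them apart.\<close>

definition W :: "'u U_family \<Rightarrow> ((nat \<times> nat \<times> nat) \<times> 'u \<times> 'u \<times> 'u \<times> nat,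
    (nat \<times> nat \<times> nat) \<times> 'u \<times> 'u \<times> 'u \<times> nat \<times> nat,
    (nat \<times> nat) \<times> 'u \<times> 'u, (nat \<times> nat) \<times> 'u \<times> 'u) func" where
  "W U = \<lparr>
    ob = (\<lambda>((i, j, k), f, g, h, t).
      if t = 0 then ((i, j + k), f, ob (U j k) (g, h)) else ((i + j, k), ob (U i j) (f, g), h)),
    ar = (\<lambda>((i, j, k), f, g, h, s, t).
      if s = 0 then ((i, j + k), f, ar (U j k) (g, h)) else ((i + j, k), ar (U i j) (f, g), h))\<rparr>"

definition iterated_pushout :: "(nat \<Rightarrow> (nat \<times> nat \<times> nat) set)
    \<Rightarrow> (nat \<Rightarrow> ('u, 'u) cat) \<Rightarrow> 'u U_family \<Rightarrow> 'u V_family \<Rightarrow> bool" where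
  "iterated_pushout J A U V \<longleftrightarrow> terminal_cat (A 1) \<and>
    (\<forall>n\<ge>2. is_pushout
      (coprod_cat (J n) (\<lambda>(i, j, k). A i \<times>\<^sub>C A j \<times>\<^sub>C A k \<times>\<^sub>C Idot))
      (coprod_cat (J n) (\<lambda>(i, j, k). A i \<times>\<^sub>C A j \<times>\<^sub>C A k \<times>\<^sub>C Icat))
      (coprod_cat (pairs n) (\<lambda>(a, b). A a \<times>\<^sub>C A b))
      func_id (W U)
      (A n) (copair (\<lambda>(i, j, k). V i j k)) (copair (\<lambda>(a, b). U a b)))"

definition catalan_groupoids ::
    "(nat \<Rightarrow> ('u, 'u) cat) \<Rightarrow> 'u U_family \<Rightarrow> 'u V_family \<Rightarrow> bool" where
  "catalan_groupoids A U V \<longleftrightarrow> iterated_pushout triples A U V"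

definition maximal_indiscrete_subgroupoids ::
    "(nat \<Rightarrow> ('u, 'u) cat) \<Rightarrow> 'u U_family \<Rightarrow> 'u V_family \<Rightarrow> bool" where
  "maximal_indiscrete_subgroupoids T UT VT \<longleftrightarrow> iterated_pushout triples1 T UT VT"

text \<open>
  For \<open>n \<ge> 2\<close> the two compatibility conditions determine \<open>L n\<close> by the universal property of \<open>T n\<close>;
  \<open>L 1\<close> is determined because \<open>A 1\<close> is terminal.
\<close>

definition induced_inclusion ::
    "(nat \<Rightarrow> ('u, 'u) cat) \<Rightarrow> 'u U_family \<Rightarrow> 'u V_family
    \<Rightarrow> (nat \<Rightarrow> ('u, 'u) cat) \<Rightarrow> 'u U_family \<Rightarrow> 'u V_family
    \<Rightarrow> (nat \<Rightarrow> ('u, 'u, 'u, 'u) func) \<Rightarrow> bool" where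
  "induced_inclusion T UT VT A U V L \<longleftrightarrow>
    (\<forall>n\<ge>1. is_functor (T n) (A n) (L n)) \<and>
    (\<forall>n\<ge>2. \<forall>(a, b)\<in>pairs n.
      func_eq (T a \<times>\<^sub>C T b) (L n \<circ>\<^sub>F UT a b) (U a b \<circ>\<^sub>F (L a \<times>\<^sub>F L b))) \<and>
    (\<forall>n\<ge>2. \<forall>(i, j, k)\<in>triples1 n.
      func_eq (T i \<times>\<^sub>C T j \<times>\<^sub>C T k \<times>\<^sub>C Icat)
        (L n \<circ>\<^sub>F VT i j k) (V i j k \<circ>\<^sub>F (L i \<times>\<^sub>F L j \<times>\<^sub>F L k \<times>\<^sub>F func_id)))"

text \<open>\<open>X\<close> is the pushout of \<open>1 \<leftarrow> T \<midarrow>L\<rightarrow> A\<close> with structure maps \<open>p : 1 \<rightarrow> X\<close> and \<open>q : A \<rightarrow> X\<close>.\<close>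

definition is_collapse :: "('o, 'm) cat \<Rightarrow> ('p, 'n) cat \<Rightarrow> ('o, 'm, 'p, 'n) func
    \<Rightarrow> ('x, 'y) cat \<Rightarrow> (unit, unit \<times> unit, 'x, 'y) func \<Rightarrow> ('p, 'n, 'x, 'y) func \<Rightarrow> bool" where
  "is_collapse T A L X p q \<longleftrightarrow>
    is_pushout T (indiscrete {()}) A \<lparr>ob = (\<lambda>_. ()), ar = (\<lambda>_. ((), ()))\<rparr> L X p q"


section \<open>Group presentations\<close>

text \<open>Words in letters \<open>(x, True)\<close>, standing for \<open>x\<close>, and \<open>(x, False)\<close>, standing for its inverse.\<close>

type_synonym 'g word = "('g \<times> bool) list"

definition words :: "'g set \<Rightarrow> 'g word set" where
  "words S = lists (S \<times> UNIV)"

definition word_inv :: "'g word \<Rightarrow> 'g word" where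
  "word_inv w = rev (map (\<lambda>(x, b). (x, \<not> b)) w)"

definition cancel :: "'g set \<Rightarrow> ('g word \<times> 'g word) set" where
  "cancel S = {(u @ (x, b) # (x, \<not> b) # v, u @ v) | u v x b. u \<in> words S \<and> v \<in> words S \<and> x \<in> S}"

definition word_eq :: "'g set \<Rightarrow> ('g word \<times> 'g word) set" where
  "word_eq S = (cancel S \<union> (cancel S)\<inverse>)\<^sup>* \<inter> words S \<times> words S"

definition word_class :: "'g set \<Rightarrow> 'g word \<Rightarrow> 'g word set" where
  "word_class S w = word_eq S `` {w}"

definition free_group :: "'g set \<Rightarrow> 'g word set monoid" where
  "free_group S = \<lparr>carrier = words S // word_eq S,
    mult = (\<lambda>X Y. \<Union>u\<in>X. \<Union>v\<in>Y. word_class S (u @ v)),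
    one = word_class S []\<rparr>"

definition normal_closure :: "('a, 'b) monoid_scheme \<Rightarrow> 'a set \<Rightarrow> 'a set" where
  "normal_closure F R = \<Inter>{N. N \<lhd> F \<and> R \<subseteq> N}"

definition relator_subgroup :: "'g set \<Rightarrow> 'g word set \<Rightarrow> 'g word set set" where
  "relator_subgroup S R = normal_closure (free_group S) (word_class S ` R)"

definition presented_group :: "'g set \<Rightarrow> 'g word set \<Rightarrow> 'g word set set monoid" where
  "presented_group S R = free_group S Mod relator_subgroup S R"

definition presented_gen :: "'g set \<Rightarrow> 'g word set \<Rightarrow> 'g \<Rightarrow> 'g word set set" where
  "presented_gen S R x = relator_subgroup S R #>\<^bsub>free_group S\<^esub> word_class S [(x, True)]"


section \<open>Generators and relators of the presentation\<close>

datatype side = Lam | Rho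

datatype gen = Gen "side list" nat nat nat

fun pre :: "side list \<Rightarrow> gen \<Rightarrow> gen" where
  "pre X (Gen Y i j k) = Gen (X @ Y) i j k"

definition pre_word :: "side list \<Rightarrow> gen word \<Rightarrow> gen word" where
  "pre_word X = map (map_prod (pre X) id)"

abbreviation lam :: "nat \<Rightarrow> side list" where "lam a \<equiv> replicate a Lam"
abbreviation rho :: "nat \<Rightarrow> side list" where "rho a \<equiv> replicate a Rho"

abbreviation letter :: "gen \<Rightarrow> gen word" where "letter x \<equiv> [(x, True)]"

definition relator :: "gen word \<Rightarrow> gen word \<Rightarrow> gen word" where
  "relator u v = u @ word_inv v"

definition conj_word :: "gen \<Rightarrow> gen \<Rightarrow> gen word" where
  "conj_word c x = letter c @ letter x @ word_inv (letter c)"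

function gens :: "nat \<Rightarrow> gen set" where
  "gens n = (if n < 2 then {} else
     (\<Union>i\<in>{1..n-1}. pre (lam i) ` gens (n - i) \<union> pre (rho (n - i)) ` gens i)
   \<union> {Gen [] i j k | i j k. (i, j, k) \<in> triples n})"
  by auto
termination by (relation "measure id") auto

function rels :: "nat \<Rightarrow> gen word set" where
  "rels n = (if n < 2 then {} else
     (\<Union>(i, j, k)\<in>triples n.
        {relator (conj_word (Gen [] i j k) (pre (rho k) (pre (rho j) x)))
                 (letter (pre (rho (j + k)) x)) | x. x \<in> gens i}
      \<union> {relator (conj_word (Gen [] i j k) (pre (rho k) (pre (lam i) y)))
                 (letter (pre (lam i) (pre (rho k) y))) | y. y \<in> gens j}
      \<union> {relator (conj_word (Gen [] i j k) (pre (lam (i + j)) z))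
                 (letter (pre (lam i) (pre (lam j) z))) | z. z \<in> gens k})
   \<union> {relator (letter (Gen [] i j k)) [] | i j k. (i, j, k) \<in> triples1 n}
   \<union> (\<Union>i\<in>{1..n-1}. pre_word (lam i) ` rels (n - i) \<union> pre_word (rho (n - i)) ` rels i)
   \<union> (\<Union>i\<in>{1..n-1}.
        {relator (letter (pre (rho (n - i)) x) @ letter (pre (lam i) y))
                 (letter (pre (lam i) y) @ letter (pre (rho (n - i)) x))
         | x y. x \<in> gens i \<and> y \<in> gens (n - i)}))"
  by auto
termination by (relation "measure id") auto

declare gens.simps [simp del] rels.simps [simp del]

text \<open>
  \<open>corresponds A U V q n y c\<close>: the arrow \<open>c\<close> of the collapse of \<open>A n\<close> along \<open>q n\<close> is among those
  the formal symbol \<open>y\<close> stands for. It is a relation, because the description chooses objects and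
  representing arrows, and because a prefix such as \<open>Lam Lam\<close> may be read off in one step
  or in two.
\<close>

inductive corresponds :: "(nat \<Rightarrow> ('u, 'u) cat) \<Rightarrow> 'u U_family \<Rightarrow> 'u V_family
    \<Rightarrow> (nat \<Rightarrow> ('u, 'u, 'u, 'u) func) \<Rightarrow> nat \<Rightarrow> gen \<Rightarrow> 'u \<Rightarrow> bool"
  for A U V q where
  base: "\<lbrakk>(i, j, k) \<in> triples n; f \<in> Obj (A i); g \<in> Obj (A j); h \<in> Obj (A k)\<rbrakk> \<Longrightarrow>
    corresponds A U V q n (Gen [] i j k)
      (ar (q n) (ar (V i j k) (Ident (A i) f, Ident (A j) g, Ident (A k) h, \<iota>)))"
| lam: "\<lbrakk>1 \<le> a; a < n; \<phi> \<in> Arr (A (n - a)); f \<in> Obj (A a);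
     corresponds A U V q (n - a) y (ar (q (n - a)) \<phi>)\<rbrakk> \<Longrightarrow>
    corresponds A U V q n (pre (lam a) y) (ar (q n) (ar (U a (n - a)) (Ident (A a) f, \<phi>)))"
| rho: "\<lbrakk>1 \<le> a; a < n; \<phi> \<in> Arr (A (n - a)); f \<in> Obj (A a);
     corresponds A U V q (n - a) y (ar (q (n - a)) \<phi>)\<rbrakk> \<Longrightarrow>
    corresponds A U V q n (pre (rho a) y) (ar (q n) (ar (U (n - a) a) (\<phi>, Ident (A a) f)))"

end

theory Submission
  imports Defs "HOL-Library.Countable_Set"
begin

text \<open>
  Write \<open>\<Gamma> n\<close> for the presented group and \<open>M n\<close> for \<open>\<pi>(A\<^sub>n)\<close>. Functors from \<open>A\<^sub>n\<close> to a group are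
  controlled by the pushout: they are commuting pairs of functors on \<open>A\<^sub>a\<close> and \<open>A\<^sub>b\<close> for \<open>a + b = n\<close>
  together with one group element for every \<open>(i, j, k)\<close> that intertwines the two ways of bracketing.
  They descend to \<open>M n\<close> as soon as they are trivial on \<open>T\<^sub>n\<close>.

  Since \<open>L\<^sub>n\<close> is surjective on objects and \<open>T\<^sub>n\<close> is connected, classes in \<open>M n\<close> do not depend on the
  objects in the identity arguments of \<open>U\<close> and \<open>V\<close>. Hence \<open>\<lambda>\<^sup>a\<close> and \<open>\<rho>\<^sup>b\<close> are homomorphisms into \<open>M n\<close>,
  the formal generators have well-defined values there, functoriality of \<open>U\<close> and \<open>V\<close> gives the
  relators, and one obtains \<open>\<Psi>\<^sub>n : \<Gamma> n \<rightarrow> M n\<close>. By induction \<open>\<Psi>\<^sub>m\<close> is invertible for \<open>m < n\<close>. The functor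
  \<open>A\<^sub>n \<rightarrow> \<Gamma> n\<close> with \<open>U\<^sub>a\<^sub>,\<^sub>b(f, g) \<mapsto> \<rho>\<^sup>b(\<Psi>\<^sub>a\<^sup>-\<^sup>1[f]) * \<lambda>\<^sup>a(\<Psi>\<^sub>b\<^sup>-\<^sup>1[g])\<close> and \<open>V\<^sub>i\<^sub>,\<^sub>j\<^sub>,\<^sub>k(id, id, id, \<iota>) \<mapsto> \<langle>i, j, k\<rangle>\<close>
  then descends to the inverse of \<open>\<Psi>\<^sub>n\<close>.
\<close>

section \<open>Presented groups\<close>

text \<open>The pushouts are known only through \<open>is_pushout\<close>, whose test categories
  have arrows in \<open>'u\<close>. A group can serve as a target only after its carrier has been
  embedded in \<open>'u\<close>. For \<pi>(A_n) this is automatic; for the presented groups it is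
  the reason for the countability lemmas and for the infinite type. Uniqueness of functors, in
  contrast, is proved by generation and works for targets of any type. The induction over n is
  forced: the value of the functor on \<open>U a b\<close> must be given for arbitrary arrows of A_a
  and A_b, for which no expression in words is at hand. Only their classes are available, and the
  inverse of \<open>Psi\<close> at the lower level turns a class into an element of a presented
  group that \<open>shift\<close> can prefix. A second obstacle is that a prefix splits into blocks
  in many ways, whereas each \<lambda>^a comes from a functor \<open>U\<close> of its own. Values
  are therefore defined by peeling one letter at a time; <i,1,k> = e, inserted into the conjugation
  relations, shows that larger blocks give the same.\<close>

lemma words_simps [simp]:
  "[] \<in> words S" "u @ v \<in> words S \<longleftrightarrow> u \<in> words S \<and> v \<in> words S"
  "a # u \<in> words S \<longleftrightarrow> fst a \<in> S \<and> u \<in> words S"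
  by (auto simp: words_def mem_Times_iff)

lemma word_inv_in_words [simp]: "word_inv w \<in> words S \<longleftrightarrow> w \<in> words S"
  by (induction w) (auto simp: word_inv_def)

lemma word_inv_simps [simp]:
  "word_inv [] = []" "word_inv ((x, b) # w) = word_inv w @ [(x, \<not> b)]"
  by (simp_all add: word_inv_def)

section \<open>Words up to cancellation and the free group\<close>

lemma equiv_word_eq: "equiv (words S) (word_eq S)"
proof (rule equivI)
  have "sym ((cancel S \<union> (cancel S)\<inverse>)\<^sup>*)"
    by (rule sym_rtrancl) (auto simp: sym_def)
  then show "sym (word_eq S)"
    by (auto simp: word_eq_def sym_def)
  show "trans (word_eq S)"
    by (auto simp: word_eq_def trans_def)
qed (auto simp: word_eq_def refl_on_def)

lemma word_eq_trans: "(u, v) \<in> word_eq S \<Longrightarrow> (v, w) \<in> word_eq S \<Longrightarrow> (u, w) \<in> word_eq S"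
  by (auto simp: word_eq_def)

lemma cancel_context:
  assumes "(u, v) \<in> cancel S" "s \<in> words S" "t \<in> words S"
  shows "(s @ u @ t, s @ v @ t) \<in> cancel S"
proof -
  obtain a b x c where "u = a @ (x, c) # (x, \<not> c) # b" "v = a @ b" "a \<in> words S" "b \<in> words S" "x \<in> S"
    using assms(1) by (auto simp: cancel_def)
  then have "s @ u @ t = (s @ a) @ (x, c) # (x, \<not> c) # (b @ t) \<and> s @ v @ t = (s @ a) @ (b @ t)
      \<and> s @ a \<in> words S \<and> b @ t \<in> words S \<and> x \<in> S"
    using assms(2,3) by simp
  then show ?thesis
    unfolding cancel_def by blast
qed

lemma word_eq_context:
  assumes "(u, v) \<in> word_eq S" "s \<in> words S" "t \<in> words S"
  shows "(s @ u @ t, s @ v @ t) \<in> word_eq S"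
proof -
  have "(u, v) \<in> (cancel S \<union> (cancel S)\<inverse>)\<^sup>*"
    using assms(1) by (simp add: word_eq_def)
  then have "(s @ u @ t, s @ v @ t) \<in> (cancel S \<union> (cancel S)\<inverse>)\<^sup>*"
    by induction (use assms cancel_context in \<open>fastforce intro: rtrancl_into_rtrancl\<close>)+
  then show ?thesis
    using assms by (auto simp: word_eq_def)
qed

lemma word_eq_append:
  assumes "(u, u') \<in> word_eq S" "(v, v') \<in> word_eq S"
  shows "(u @ v, u' @ v') \<in> word_eq S"
proof -
  have "u' \<in> words S" "v \<in> words S"
    using assms by (auto simp: word_eq_def)
  then have "(u @ v, u' @ v) \<in> word_eq S" "(u' @ v, u' @ v') \<in> word_eq S"
    using word_eq_context[OF assms(1), of "[]" v] word_eq_context[OF assms(2), of u' "[]"] by simp_all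
  then show ?thesis
    by (rule word_eq_trans)
qed

lemma word_eq_cancel:
  assumes "w \<in> words S" shows "(w @ word_inv w, []) \<in> word_eq S"
  using assms
proof (induction w)
  case (Cons a w)
  obtain x b where a: "a = (x, b)" by force
  have "(a # w @ word_inv w @ [(x, \<not> b)], [a, (x, \<not> b)]) \<in> word_eq S"
    using word_eq_context[of "w @ word_inv w" "[]" S "[a]" "[(x, \<not> b)]"] Cons a by simp
  moreover have "([a, (x, \<not> b)], []) \<in> cancel S"
    using Cons a unfolding cancel_def
    by (auto intro!: exI[of _ "[]"])
  then have "([a, (x, \<not> b)], []) \<in> word_eq S"
    using Cons a unfolding word_eq_def by auto
  ultimately show ?case
    using a word_eq_trans by fastforce
qed (simp add: word_eq_def)

lemma word_inv_word_inv [simp]: "word_inv (word_inv w) = w"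
  by (induction w) (auto simp: word_inv_def rev_map)

lemma word_class_eq_iff:
  "u \<in> words S \<Longrightarrow> v \<in> words S \<Longrightarrow> word_class S u = word_class S v \<longleftrightarrow> (u, v) \<in> word_eq S"
  unfolding word_class_def using eq_equiv_class_iff[OF equiv_word_eq] by blast

lemma carrier_free_group: "carrier (free_group S) = word_class S ` words S"
  by (auto simp: free_group_def word_class_def quotient_def)

text \<open>The product is a union over all representatives of both factors. Congruence of
  \<open>word_eq\<close> makes every member of that union the same class, and both factors are
  nonempty, so the union is that class.\<close>

lemma mult_word_class:
  assumes "u \<in> words S" "v \<in> words S"
  shows "word_class S u \<otimes>\<^bsub>free_group S\<^esub> word_class S v = word_class S (u @ v)"
proof -
  have "word_class S (u' @ v') = word_class S (u @ v)"
    if "u' \<in> word_class S u" "v' \<in> word_class S v" for u' v'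
  proof -
    have *: "(u @ v, u' @ v') \<in> word_eq S"
      using that by (auto simp: word_class_def intro: word_eq_append)
    then show ?thesis
      unfolding word_class_def using equiv_class_eq[OF equiv_word_eq *] by simp
  qed
  then have "word_class S u \<otimes>\<^bsub>free_group S\<^esub> word_class S v =
      (\<Union>u'\<in>word_class S u. \<Union>v'\<in>word_class S v. word_class S (u @ v))"
    by (simp add: free_group_def)
  moreover have "u \<in> word_class S u" "v \<in> word_class S v"
    using assms by (auto simp: word_class_def word_eq_def)
  then have "word_class S u \<noteq> {}" "word_class S v \<noteq> {}"
    by blast+
  ultimately show ?thesis
    by simp
qed

lemma one_free_group: "\<one>\<^bsub>free_group S\<^esub> = word_class S []"
  by (simp add: free_group_def)

lemma group_free_group: "group (free_group S)"
proof (rule groupI)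
  fix X assume "X \<in> carrier (free_group S)"
  then obtain w where w: "w \<in> words S" "X = word_class S w"
    by (auto simp: carrier_free_group)
  then have "word_class S (word_inv w) \<otimes>\<^bsub>free_group S\<^esub> X = \<one>\<^bsub>free_group S\<^esub>"
    using word_eq_cancel[of "word_inv w" S] by (simp add: mult_word_class one_free_group word_class_eq_iff)
  then show "\<exists>Y\<in>carrier (free_group S). Y \<otimes>\<^bsub>free_group S\<^esub> X = \<one>\<^bsub>free_group S\<^esub>"
    using w by (auto simp: carrier_free_group)
qed (auto simp: carrier_free_group one_free_group mult_word_class)

section \<open>Normal closures and evaluation of words in a group\<close>

lemma (in group) normal_normal_closure:
  assumes "R \<subseteq> carrier G" shows "normal_closure G R \<lhd> G"
proof -
  \<comment> \<open>The whole group belongs to the intersected family, so the intersection is not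
    taken over the empty set and stays inside the carrier.\<close>
  have c: "carrier G \<lhd> G"
    by (rule normal_invI) (auto simp: subgroup_self)
  have "subgroup (normal_closure G R) G"
    unfolding normal_closure_def
    by (rule subgroups_Inter) (use assms c in \<open>auto simp: normal_imp_subgroup\<close>)
  then show ?thesis
    by (rule normal_invI) (auto simp: normal_closure_def normal_invE(2))
qed

lemma normal_closure_least: "N \<lhd> G \<Longrightarrow> R \<subseteq> N \<Longrightarrow> normal_closure G R \<subseteq> N"
  by (auto simp: normal_closure_def)

lemma subset_normal_closure: "R \<subseteq> normal_closure G R"
  by (auto simp: normal_closure_def)

text \<open>Evaluation is defined on words instead of on classes, so a relator can be evaluated in
  any group before it is known to vanish there; descent to classes is
  \<open>word_value_word_eq\<close>.\<close>

definition word_value :: "('a, 'b) monoid_scheme \<Rightarrow> ('g \<Rightarrow> 'a) \<Rightarrow> 'g word \<Rightarrow> 'a" where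
  "word_value H d w = foldr (\<lambda>(x, b) a. (if b then d x else inv\<^bsub>H\<^esub> d x) \<otimes>\<^bsub>H\<^esub> a) w \<one>\<^bsub>H\<^esub>"

lemma word_value_simps [simp]:
  "word_value H d [] = \<one>\<^bsub>H\<^esub>"
  "word_value H d ((x, b) # w) = (if b then d x else inv\<^bsub>H\<^esub> d x) \<otimes>\<^bsub>H\<^esub> word_value H d w"
  by (simp_all add: word_value_def)

lemma words_cases:
  assumes "a # w \<in> words S"
  obtains x b where "a = (x, b)" "x \<in> S" "w \<in> words S"
  using assms by (cases a) auto

lemma word_value_cong:
  "w \<in> words S \<Longrightarrow> (\<And>x. x \<in> S \<Longrightarrow> d x = d' x) \<Longrightarrow> word_value H d w = word_value H d' w"
  by (induction w) (auto elim!: words_cases)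

context group
begin

lemma word_value_closed [simp]:
  assumes "d \<in> S \<rightarrow> carrier G" "w \<in> words S" shows "word_value G d w \<in> carrier G"
  using assms(2) by (induction w) (use assms(1) in \<open>auto elim!: words_cases simp: Pi_iff\<close>)

lemma word_value_append:
  assumes "d \<in> S \<rightarrow> carrier G" "u \<in> words S" "v \<in> words S"
  shows "word_value G d (u @ v) = word_value G d u \<otimes> word_value G d v"
  using assms(2)
proof (induction u)
  case (Cons a u)
  then obtain x b where "a = (x, b)" "x \<in> S" "u \<in> words S"
    by (cases a) auto
  moreover from this have "d x \<in> carrier G"
    using assms(1) by auto
  ultimately show ?case
    using Cons assms by (auto simp: m_assoc)
qed (use assms in simp)

lemma word_value_word_inv:
  assumes "d \<in> S \<rightarrow> carrier G" "w \<in> words S"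
  shows "word_value G d (word_inv w) = inv (word_value G d w)"
  using assms(2)
proof (induction w)
  case (Cons a u)
  then obtain x b where "a = (x, b)" "x \<in> S" "u \<in> words S"
    by (cases a) auto
  moreover from this have "d x \<in> carrier G"
    using assms(1) by auto
  ultimately show ?case
    using Cons assms by (auto simp: word_value_append inv_mult_group)
qed simp

lemma word_value_relator:
  assumes "d \<in> S \<rightarrow> carrier G" "u \<in> words S" "v \<in> words S"
  shows "word_value G d (relator u v) = \<one> \<longleftrightarrow> word_value G d u = word_value G d v"
proof -
  have "word_value G d u \<in> carrier G" "word_value G d v \<in> carrier G"
    using assms by simp_all
  then have "word_value G d u \<otimes> inv (word_value G d v) = \<one> \<longleftrightarrow> word_value G d u = word_value G d v"
    by (metis inv_closed inv_equality inv_inv r_inv)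
  then show ?thesis
    unfolding relator_def using assms by (simp add: word_value_append word_value_word_inv)
qed

lemma word_value_word_eq:
  assumes d: "d \<in> S \<rightarrow> carrier G" and "(u, v) \<in> word_eq S"
  shows "word_value G d u = word_value G d v"
proof -
  have *: "word_value G d u = word_value G d v" if c: "(u, v) \<in> cancel S" for u v
  proof -
    obtain a b x c where *: "u = a @ (x, c) # (x, \<not> c) # b" "v = a @ b" "a \<in> words S" "b \<in> words S" "x \<in> S"
      using c by (auto simp: cancel_def)
    then have "d x \<in> carrier G" using d by auto
    with * d show ?thesis
      by (simp add: word_value_append flip: m_assoc) (simp add: m_assoc)
  qed
  have "(u, v) \<in> (cancel S \<union> (cancel S)\<inverse>)\<^sup>*"
    using assms(2) by (simp add: word_eq_def)
  then show ?thesis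
    by induction (use * in fastforce)+
qed

end

lemma (in group_hom) hom_word_value:
  assumes "d \<in> S \<rightarrow> carrier G" "w \<in> words S"
  shows "h (word_value G d w) = word_value H (h \<circ> d) w"
  using assms(2)
proof (induction w)
  case (Cons a u)
  then obtain x b where "a = (x, b)" "x \<in> S" "u \<in> words S"
    by (cases a) auto
  moreover from this have "d x \<in> carrier G"
    using assms(1) by auto
  ultimately show ?case
    using Cons assms by auto
qed simp

section \<open>Presented groups and their universal property\<close>

locale presentation =
  fixes S :: "'g set" and R :: "'g word set"
  assumes rels_words: "R \<subseteq> words S"
begin

abbreviation "Q \<equiv> presented_group S R"

lemma normal_relators: "relator_subgroup S R \<lhd> free_group S"
  unfolding relator_subgroup_def
  by (rule group.normal_normal_closure[OF group_free_group]) (use rels_words in \<open>auto simp: carrier_free_group\<close>)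

sublocale group Q
  unfolding presented_group_def by (rule normal.factorgroup_is_group[OF normal_relators])

text \<open>Naming the coset of a word hides the two stages of the quotient: word classes, and then
  cosets of the relator subgroup.\<close>

definition quot :: "'g word \<Rightarrow> 'g word set set" where
  "quot w = relator_subgroup S R #>\<^bsub>free_group S\<^esub> word_class S w"

lemma carrier_eq: "carrier Q = quot ` words S"
  by (auto simp: presented_group_def FactGroup_def RCOSETS_def carrier_free_group quot_def)

lemma coset_hom: "(\<lambda>a. relator_subgroup S R #>\<^bsub>free_group S\<^esub> a) \<in> hom (free_group S) Q"
  unfolding presented_group_def by (rule normal.r_coset_hom_Mod[OF normal_relators])

lemma quot_append:
  "u \<in> words S \<Longrightarrow> v \<in> words S \<Longrightarrow> quot (u @ v) = quot u \<otimes>\<^bsub>Q\<^esub> quot v"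
  unfolding quot_def
  using hom_mult[OF coset_hom, of "word_class S u" "word_class S v"]
  by (simp add: mult_word_class carrier_free_group)

lemma quot_Nil: "quot [] = \<one>\<^bsub>Q\<^esub>"
  unfolding quot_def
  using hom_one[OF coset_hom group_free_group is_group] by (simp add: one_free_group)

lemma quot_closed [simp]: "w \<in> words S \<Longrightarrow> quot w \<in> carrier Q"
  by (auto simp: carrier_eq)

lemma gen_closed [simp]: "x \<in> S \<Longrightarrow> presented_gen S R x \<in> carrier Q"
  unfolding presented_gen_def quot_def[symmetric] by simp

lemma gens_closed: "presented_gen S R \<in> S \<rightarrow> carrier Q"
  by simp

text \<open>Both sides are multiplicative, so a single letter is enough, and an inverse letter
  cancels against the positive one already in the free group. This lets elements of \<open>Q\<close>
  be handled as values of words.\<close>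

lemma quot_eq_word_value: "w \<in> words S \<Longrightarrow> quot w = word_value Q (presented_gen S R) w"
proof (induction w)
  case (Cons a w)
  then obtain x b where a: "a = (x, b)" "x \<in> S" "w \<in> words S"
    by (cases a) auto
  have "quot [(x, False)] = inv\<^bsub>Q\<^esub> quot [(x, True)]"
  proof (rule inv_equality[symmetric])
    have "([(x, False), (x, True)], []) \<in> word_eq S"
      using word_eq_cancel[of "[(x, False)]" S] a by simp
    then have "word_class S [(x, False), (x, True)] = word_class S []"
      using a by (simp add: word_class_eq_iff)
    then show "quot [(x, False)] \<otimes>\<^bsub>Q\<^esub> quot [(x, True)] = \<one>\<^bsub>Q\<^esub>"
      using a by (simp add: quot_append[symmetric] quot_Nil[symmetric]) (simp add: quot_def)
  qed (use a in auto)
  then have "quot [a] = (if b then presented_gen S R x else inv\<^bsub>Q\<^esub> presented_gen S R x)"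
    by (simp add: a presented_gen_def quot_def)
  then show ?case
    using quot_append[of "[a]" w] Cons a by simp
qed (simp add: quot_Nil)

lemma carrier_word_value:
  assumes "g \<in> carrier Q"
  obtains w where "w \<in> words S" "g = word_value Q (presented_gen S R) w"
proof -
  from assms obtain w where "w \<in> words S" "g = quot w"
    unfolding carrier_eq by blast
  then show ?thesis
    using that quot_eq_word_value by blast
qed

lemma relator_value: "r \<in> R \<Longrightarrow> word_value Q (presented_gen S R) r = \<one>\<^bsub>Q\<^esub>"
proof -
  assume r: "r \<in> R"
  then have "word_class S r \<in> relator_subgroup S R"
    unfolding relator_subgroup_def by (rule subsetD[OF subset_normal_closure imageI])
  then have "quot r = relator_subgroup S R"
    unfolding quot_def using rels_words r normal_imp_subgroup[OF normal_relators]
    by (intro group.coset_join2[OF group_free_group]) (auto simp: carrier_free_group)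
  also have "\<dots> = \<one>\<^bsub>Q\<^esub>"
    by (simp add: presented_group_def FactGroup_def)
  finally show ?thesis
    using quot_eq_word_value[of r] rels_words r by (simp add: subset_iff)
qed

text \<open>This is von Dyck's theorem. Evaluation at \<open>d\<close> is a homomorphism on the free
  group; its kernel is normal and contains the relators, hence their normal closure.\<close>

lemma universal:
  assumes H: "group H" and d: "d \<in> S \<rightarrow> carrier H"
    and R: "\<And>r. r \<in> R \<Longrightarrow> word_value H d r = \<one>\<^bsub>H\<^esub>"
  obtains h where "h \<in> hom Q H" "\<And>x. x \<in> S \<Longrightarrow> h (presented_gen S R x) = d x"
proof -
  interpret H: group H by fact
  \<comment> \<open>Any representative may be chosen, because equivalent words have equal
    values.\<close>
  define f where "f X = word_value H d (SOME w. w \<in> X)" for X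
  have f: "f (word_class S w) = word_value H d w" if "w \<in> words S" for w
  proof -
    have "w \<in> word_class S w"
      using that by (simp add: word_class_def word_eq_def)
    then have "(SOME w'. w' \<in> word_class S w) \<in> word_class S w"
      by (rule someI)
    then show ?thesis
      unfolding f_def using H.word_value_word_eq[OF d] by (auto simp: word_class_def)
  qed
  interpret F: group_hom "free_group S" H f
  proof (rule group_hom.intro[OF group_free_group H group_hom_axioms.intro])
    show "f \<in> hom (free_group S) H"
      by (rule homI) (use d in \<open>auto simp: carrier_free_group f mult_word_class H.word_value_append\<close>)
  qed
  have "relator_subgroup S R \<subseteq> kernel (free_group S) H f"
    unfolding relator_subgroup_def
    by (rule normal_closure_least[OF F.normal_kernel])
      (use rels_words R f in \<open>auto simp: kernel_def carrier_free_group\<close>)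
  then obtain h where h: "h \<in> hom (free_group S Mod relator_subgroup S R) H"
      "\<And>X. X \<in> carrier (free_group S) \<Longrightarrow> h (relator_subgroup S R #>\<^bsub>free_group S\<^esub> X) = f X"
    using F.FactGroup_universal_kernel[OF normal_relators] by blast
  show ?thesis
  proof
    show "h \<in> hom Q H"
      using h(1) by (simp add: presented_group_def)
    show "h (presented_gen S R x) = d x" if "x \<in> S" for x
    proof -
      have "d x \<in> carrier H" using d that by auto
      then show ?thesis
        using that f[of "[(x, True)]"] by (simp add: presented_gen_def h(2) carrier_free_group)
    qed
  qed
qed

lemma hom_eqI:
  assumes "group H" "h \<in> hom Q H" "h' \<in> hom Q H"
    and eq: "\<And>x. x \<in> S \<Longrightarrow> h (presented_gen S R x) = h' (presented_gen S R x)"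
    and g: "g \<in> carrier Q"
  shows "h g = h' g"
proof -
  interpret h: group_hom Q H h
    using assms is_group by (simp add: group_hom_def group_hom_axioms_def)
  interpret h': group_hom Q H h'
    using assms is_group by (simp add: group_hom_def group_hom_axioms_def)
  obtain w where w: "w \<in> words S" "g = word_value Q (presented_gen S R) w"
    using g by (rule carrier_word_value)
  show ?thesis
    using h.hom_word_value[OF gens_closed w(1)] h'.hom_word_value[OF gens_closed w(1)]
      word_value_cong[OF w(1), of "h \<circ> presented_gen S R" "h' \<circ> presented_gen S R" H] eq w(2) by simp
qed

text \<open>Wanted for an embedding of the carrier into the type of arrows, which lets
  \<open>Q\<close> serve as the target of functors induced by pushouts.\<close>

lemma countable_carrier:
  assumes "countable S" shows "countable (carrier Q)"
proof -
  have "countable (S \<times> (UNIV :: bool set))"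
    using assms by simp
  then show ?thesis
    unfolding carrier_eq words_def by (intro countable_image countable_lists)
qed

end


section \<open>Pushouts of categories\<close>

lemma is_functorD:
  assumes "is_functor C D F"
  shows "x \<in> Obj C \<Longrightarrow> ob F x \<in> Obj D"
    and "f \<in> Arr C \<Longrightarrow> ar F f \<in> Arr D"
    and "f \<in> Arr C \<Longrightarrow> Dom D (ar F f) = ob F (Dom C f)"
    and "f \<in> Arr C \<Longrightarrow> Cod D (ar F f) = ob F (Cod C f)"
    and "x \<in> Obj C \<Longrightarrow> ar F (Ident C x) = Ident D (ob F x)"
    and "f \<in> Arr C \<Longrightarrow> g \<in> Arr C \<Longrightarrow> Cod C f = Dom C g \<Longrightarrow> ar F (Comp C f g) = Comp D (ar F f) (ar F g)"
  using assms by (simp_all add: is_functor_def)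

lemma is_functorI:
  assumes "\<And>x. x \<in> Obj C \<Longrightarrow> ob F x \<in> Obj D"
    and "\<And>f. f \<in> Arr C \<Longrightarrow> ar F f \<in> Arr D"
    and "\<And>f. f \<in> Arr C \<Longrightarrow> Dom D (ar F f) = ob F (Dom C f)"
    and "\<And>f. f \<in> Arr C \<Longrightarrow> Cod D (ar F f) = ob F (Cod C f)"
    and "\<And>x. x \<in> Obj C \<Longrightarrow> ar F (Ident C x) = Ident D (ob F x)"
    and "\<And>f g. f \<in> Arr C \<Longrightarrow> g \<in> Arr C \<Longrightarrow> Cod C f = Dom C g \<Longrightarrow>
      ar F (Comp C f g) = Comp D (ar F f) (ar F g)"
  shows "is_functor C D F"
  using assms by (simp add: is_functor_def)

lemma func_comp_simps [simp]:
  "ob (F \<circ>\<^sub>F G) x = ob F (ob G x)" "ar (F \<circ>\<^sub>F G) f = ar F (ar G f)"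
  by (simp_all add: func_comp_def)

lemma is_pushoutD:
  assumes "is_pushout C B D F G X P Q"
  shows "category C" "category B" "category D" "is_functor C B F" "is_functor C D G"
    "category X" "is_functor B X P" "is_functor D X Q" "func_eq C (P \<circ>\<^sub>F F) (Q \<circ>\<^sub>F G)"
  using assms by (simp_all add: is_pushout_def)

lemma pushout_universal:
  assumes "is_pushout C B D F G (X :: ('o, 'm) cat) P Q"
    and "category (Y :: ('o, 'm) cat)" "is_functor B Y S" "is_functor D Y T"
    and "func_eq C (S \<circ>\<^sub>F F) (T \<circ>\<^sub>F G)"
  obtains H where "is_functor X Y H" "func_eq B (H \<circ>\<^sub>F P) S" "func_eq D (H \<circ>\<^sub>F Q) T"
    "\<And>H'. is_functor X Y H' \<Longrightarrow> func_eq B (H' \<circ>\<^sub>F P) S \<Longrightarrow> func_eq D (H' \<circ>\<^sub>F Q) T \<Longrightarrow> func_eq X H' H"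
proof -
  have "\<exists>H. is_functor X Y H \<and> func_eq B (H \<circ>\<^sub>F P) S \<and> func_eq D (H \<circ>\<^sub>F Q) T \<and>
        (\<forall>H'. is_functor X Y H' \<and> func_eq B (H' \<circ>\<^sub>F P) S \<and> func_eq D (H' \<circ>\<^sub>F Q) T \<longrightarrow> func_eq X H' H)"
    using assms unfolding is_pushout_def by blast
  then show ?thesis
    using that by blast
qed

text \<open>A pushout given by its universal property has no visible elements. This makes up for it
  and yields, by suitable choices of \<open>X0\<close> and \<open>X1\<close>, the description of
  objects and the induction over arrows below.\<close>

lemma pushout_generated:
  assumes po: "is_pushout C B D F G X P Q"
    and sub: "X0 \<subseteq> Obj X" "X1 \<subseteq> Arr X"
    and ob: "\<And>x. x \<in> Obj B \<Longrightarrow> ob P x \<in> X0" "\<And>x. x \<in> Obj D \<Longrightarrow> ob Q x \<in> X0"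
    and ar: "\<And>f. f \<in> Arr B \<Longrightarrow> ar P f \<in> X1" "\<And>f. f \<in> Arr D \<Longrightarrow> ar Q f \<in> X1"
    and dom_cod: "\<And>f. f \<in> X1 \<Longrightarrow> Dom X f \<in> X0" "\<And>f. f \<in> X1 \<Longrightarrow> Cod X f \<in> X0"
    and ident: "\<And>x. x \<in> X0 \<Longrightarrow> Ident X x \<in> X1"
    and comp: "\<And>f g. f \<in> X1 \<Longrightarrow> g \<in> X1 \<Longrightarrow> Cod X f = Dom X g \<Longrightarrow> Comp X f g \<in> X1"
  shows "X0 = Obj X" "X1 = Arr X"
proof -
  note X = is_pushoutD[OF po]
  interpret X: category X by (rule X)
  define Y where "Y = X\<lparr>Obj := X0, Arr := X1\<rparr>"
  have inX: "f \<in> Arr X" if "f \<in> X1" for f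
    using that sub by auto
  have inO: "x \<in> Obj X" if "x \<in> X0" for x
    using that sub by auto
  have Y: "category Y"
    by unfold_locales
      (auto simp: Y_def dom_cod ident comp X.Dom_Ident X.Cod_Ident X.Dom_Comp X.Cod_Comp inX inO
        X.Ident_left X.Ident_right X.Comp_assoc)
  have P: "is_functor B Y P"
    by (rule is_functorI) (auto simp: Y_def ob ar is_functorD[OF X(7)])
  have Q: "is_functor D Y Q"
    by (rule is_functorI) (auto simp: Y_def ob ar is_functorD[OF X(8)])
  txt \<open>The functor induced from \<open>X\<close> into its subcategory \<open>Y\<close> is the identity by uniqueness.\<close>
  obtain H where H: "is_functor X Y H" "func_eq B (H \<circ>\<^sub>F P) P" "func_eq D (H \<circ>\<^sub>F Q) Q"
    using pushout_universal[OF po Y P Q X(9)] by blast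
  have H': "is_functor X X H"
    using is_functorD[OF H(1)] by (intro is_functorI) (auto simp: Y_def inX inO)
  have id: "is_functor X X func_id"
    by (rule is_functorI) (auto simp: func_id_def)
  obtain K where K: "\<And>H'. is_functor X X H' \<Longrightarrow> func_eq B (H' \<circ>\<^sub>F P) P \<Longrightarrow> func_eq D (H' \<circ>\<^sub>F Q) Q
      \<Longrightarrow> func_eq X H' K"
    using pushout_universal[OF po X(6-9)] by blast
  have "func_eq X H K"
    by (rule K) (use H H' in auto)
  moreover have "func_eq X func_id K"
    by (rule K) (use id in \<open>auto simp: func_eq_def func_id_def\<close>)
  ultimately have *: "\<And>x. x \<in> Obj X \<Longrightarrow> ob H x = x" "\<And>f. f \<in> Arr X \<Longrightarrow> ar H f = f"
    by (simp_all add: func_eq_def func_id_def)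
  show "X0 = Obj X"
    using sub(1) *(1) is_functorD(1)[OF H(1)] by (force simp: Y_def)
  show "X1 = Arr X"
    using sub(2) *(2) is_functorD(2)[OF H(1)] by (force simp: Y_def)
qed

lemma pushout_Obj:
  assumes po: "is_pushout C B D F G X P Q"
  shows "Obj X = ob P ` Obj B \<union> ob Q ` Obj D"
proof -
  note X = is_pushoutD[OF po]
  interpret X: category X by (rule X)
  define X0 where "X0 = ob P ` Obj B \<union> ob Q ` Obj D"
  have "X0 = Obj X"
  \<comment> \<open>The arrows are those of the full subcategory on \<open>X0\<close>, so closure
    under composition is immediate.\<close>
  proof (rule pushout_generated(1)[OF po, where ?X1.0 = "{f \<in> Arr X. Dom X f \<in> X0 \<and> Cod X f \<in> X0}"])
    show X0: "X0 \<subseteq> Obj X"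
      using is_functorD(1)[OF X(7)] is_functorD(1)[OF X(8)] by (auto simp: X0_def)
    show "Ident X x \<in> {f \<in> Arr X. Dom X f \<in> X0 \<and> Cod X f \<in> X0}" if "x \<in> X0" for x
      using that X0 by (auto simp: X.Ident_Arr X.Dom_Ident X.Cod_Ident)
    show "ar P f \<in> {f \<in> Arr X. Dom X f \<in> X0 \<and> Cod X f \<in> X0}" if "f \<in> Arr B" for f
      using that category.Dom_Obj[OF X(2)] category.Cod_Obj[OF X(2)]
      by (auto simp: X0_def is_functorD[OF X(7)])
    show "ar Q f \<in> {f \<in> Arr X. Dom X f \<in> X0 \<and> Cod X f \<in> X0}" if "f \<in> Arr D" for f
      using that category.Dom_Obj[OF X(3)] category.Cod_Obj[OF X(3)]
      by (auto simp: X0_def is_functorD[OF X(8)])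
  qed (auto simp: X0_def X.Comp_Arr X.Dom_Comp X.Cod_Comp)
  then show ?thesis
    by (simp add: X0_def)
qed

lemma pushout_arrow_induct:
  assumes po: "is_pushout C B D F G X P Q" and f: "f \<in> Arr X"
    and ar: "\<And>f. f \<in> Arr B \<Longrightarrow> K (ar P f)" "\<And>f. f \<in> Arr D \<Longrightarrow> K (ar Q f)"
    and ident: "\<And>x. x \<in> Obj X \<Longrightarrow> K (Ident X x)"
    and comp: "\<And>f g. f \<in> Arr X \<Longrightarrow> g \<in> Arr X \<Longrightarrow> Cod X f = Dom X g \<Longrightarrow> K f \<Longrightarrow> K g \<Longrightarrow> K (Comp X f g)"
  shows "K f"
proof -
  note X = is_pushoutD[OF po]
  interpret X: category X by (rule X)
  have "{f \<in> Arr X. K f} = Arr X"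
    by (rule pushout_generated(2)[OF po order.refl])
      (auto simp: ar ident comp X.Dom_Obj X.Cod_Obj X.Ident_Arr X.Comp_Arr is_functorD[OF X(7)] is_functorD[OF X(8)])
  then show ?thesis
    using f by blast
qed


section \<open>Functors into groups\<close>

text \<open>A group is a category with one object, so only the arrow map of a functor into it
  carries information. Preservation of identities is derived in
  \<open>group_functor_Ident\<close>.\<close>

definition group_functor :: "('o, 'm) cat \<Rightarrow> ('a, 'b) monoid_scheme \<Rightarrow> ('m \<Rightarrow> 'a) \<Rightarrow> bool" where
  "group_functor C H F \<longleftrightarrow> F \<in> Arr C \<rightarrow> carrier H \<and>
    (\<forall>f\<in>Arr C. \<forall>g\<in>Arr C. Cod C f = Dom C g \<longrightarrow> F (Comp C f g) = F f \<otimes>\<^bsub>H\<^esub> F g)"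

lemma group_functorI:
  assumes "\<And>f. f \<in> Arr C \<Longrightarrow> F f \<in> carrier H"
    and "\<And>f g. f \<in> Arr C \<Longrightarrow> g \<in> Arr C \<Longrightarrow> Cod C f = Dom C g \<Longrightarrow> F (Comp C f g) = F f \<otimes>\<^bsub>H\<^esub> F g"
  shows "group_functor C H F"
  using assms by (auto simp: group_functor_def)

lemma group_functorD:
  assumes "group_functor C H F"
  shows "f \<in> Arr C \<Longrightarrow> F f \<in> carrier H"
    and "f \<in> Arr C \<Longrightarrow> g \<in> Arr C \<Longrightarrow> Cod C f = Dom C g \<Longrightarrow> F (Comp C f g) = F f \<otimes>\<^bsub>H\<^esub> F g"
  using assms by (auto simp: group_functor_def)

text \<open>An identity is idempotent, and the only idempotent of a group is its unit.\<close>

lemma group_functor_Ident: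
  assumes "group_functor C H F" "category C" "group H" "x \<in> Obj C"
  shows "F (Ident C x) = \<one>\<^bsub>H\<^esub>"
proof -
  interpret category C by fact
  interpret H: group H by fact
  have "Comp C (Ident C x) (Ident C x) = Ident C x"
    using Ident_left[of "Ident C x"] assms(4) by (simp add: Ident_Arr Dom_Ident)
  then have "F (Ident C x) \<otimes>\<^bsub>H\<^esub> F (Ident C x) = F (Ident C x)"
    using group_functorD(2)[OF assms(1), of "Ident C x" "Ident C x"] assms(4)
    by (simp add: Ident_Arr Dom_Ident Cod_Ident)
  then show ?thesis
    using H.l_cancel_one group_functorD(1)[OF assms(1), of "Ident C x"] assms(4) by (simp add: Ident_Arr)
qed

lemma group_functor_comp_functor:
  assumes "group_functor D H K" "is_functor C D F"
  shows "group_functor C H (\<lambda>f. K (ar F f))"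
  using assms by (auto intro!: group_functorI simp: is_functorD group_functorD)

lemma group_functor_comp_hom:
  assumes "group_functor C H F" "h \<in> hom H H'"
  shows "group_functor C H' (\<lambda>f. h (F f))"
  using assms by (auto intro!: group_functorI simp: group_functorD hom_mult hom_in_carrier)

text \<open>Derived from generation by arrows rather than from the uniqueness clause of
  \<open>is_pushout\<close>, so \<open>H\<close> may have elements of any type.\<close>

lemma pushout_group_functor_eqI:
  assumes po: "is_pushout C B D F G X P Q" and H: "group H"
    and J: "group_functor X H J" and K: "group_functor X H K"
    and "\<And>f. f \<in> Arr B \<Longrightarrow> J (ar P f) = K (ar P f)" "\<And>f. f \<in> Arr D \<Longrightarrow> J (ar Q f) = K (ar Q f)"
    and "f \<in> Arr X"
  shows "J f = K f"
  using po assms(7)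
proof (rule pushout_arrow_induct)
  show "J (Ident X x) = K (Ident X x)" if "x \<in> Obj X" for x
    using that group_functor_Ident[OF J _ H] group_functor_Ident[OF K _ H] is_pushoutD(6)[OF po] by simp
qed (auto simp: assms group_functorD(2)[OF J] group_functorD(2)[OF K])

text \<open>
  The test categories of \<^const>\<open>is_pushout\<close> have arrows of type \<open>'m\<close>, so a group that is to serve
  as a target must embed into \<open>'m\<close> as a set.
\<close>

lemma pushout_to_group:
  fixes X :: "('o, 'm) cat" and e :: "'a \<Rightarrow> 'm"
  assumes po: "is_pushout C B D F G X P Q" and H: "group H" and e: "inj_on e (carrier H)"
    and J: "group_functor B H J" and K: "group_functor D H K"
    and eq: "\<And>f. f \<in> Arr C \<Longrightarrow> J (ar F f) = K (ar G f)"
  obtains M where "group_functor X H M" "\<And>f. f \<in> Arr B \<Longrightarrow> M (ar P f) = J f"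
    "\<And>f. f \<in> Arr D \<Longrightarrow> M (ar Q f) = K f"
proof -
  interpret H: group H by fact
  note X = is_pushoutD[OF po]
  define e' where "e' = inv_into (carrier H) e"
  have e' [simp]: "e' (e a) = a" if "a \<in> carrier H" for a
    using that e by (simp add: e'_def)
  define z :: 'o where "z = undefined"
  \<comment> \<open>\<open>Y\<close> is \<open>H\<close> transported along \<open>e\<close>: one
    arbitrary object, and as arrows the copies \<open>e a\<close> of the elements.\<close>
  define Y where "Y = \<lparr>Obj = {z}, Arr = e ` carrier H, Dom = \<lambda>_. z, Cod = \<lambda>_. z,
    Ident = \<lambda>_. e \<one>\<^bsub>H\<^esub>, Comp = \<lambda>f g. e (e' f \<otimes>\<^bsub>H\<^esub> e' g)\<rparr>"
  have Y: "category Y"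
    by unfold_locales (auto simp: Y_def H.m_assoc)
  have toY: "is_functor B' Y \<lparr>ob = \<lambda>_. z, ar = e \<circ> L\<rparr>"
    if "group_functor B' H L" "category B'" for B' :: "('p, 'q) cat" and L
    using that
    by (intro is_functorI) (auto simp: Y_def group_functorD group_functor_Ident H)
  obtain M where M: "is_functor X Y M"
      "func_eq B (M \<circ>\<^sub>F P) \<lparr>ob = \<lambda>_. z, ar = e \<circ> J\<rparr>" "func_eq D (M \<circ>\<^sub>F Q) \<lparr>ob = \<lambda>_. z, ar = e \<circ> K\<rparr>"
  proof (rule pushout_universal[OF po Y toY[OF J X(2)] toY[OF K X(3)]])
    show "func_eq C (\<lparr>ob = \<lambda>_. z, ar = e \<circ> J\<rparr> \<circ>\<^sub>F F) (\<lparr>ob = \<lambda>_. z, ar = e \<circ> K\<rparr> \<circ>\<^sub>F G)"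
      by (simp add: func_eq_def eq)
  qed
  show ?thesis
  proof
    show "group_functor X H (\<lambda>f. e' (ar M f))"
    proof (rule group_functorI)
      show "e' (ar M f) \<in> carrier H" if "f \<in> Arr X" for f
        using is_functorD(2)[OF M(1) that] by (auto simp: Y_def)
      then show "e' (ar M (Comp X f g)) = e' (ar M f) \<otimes>\<^bsub>H\<^esub> e' (ar M g)"
        if "f \<in> Arr X" "g \<in> Arr X" "Cod X f = Dom X g" for f g
        using that is_functorD(6)[OF M(1) that] by (simp add: Y_def)
    qed
    show "e' (ar M (ar P f)) = J f" if "f \<in> Arr B" for f
      using M(2) that group_functorD(1)[OF J that] by (simp add: func_eq_def)
    show "e' (ar M (ar Q f)) = K f" if "f \<in> Arr D" for f
      using M(3) that group_functorD(1)[OF K that] by (simp add: func_eq_def)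
  qed
qed


section \<open>Products and coproducts\<close>

lemma prod_cat_simps [simp]:
  "Obj (C \<times>\<^sub>C D) = Obj C \<times> Obj D" "Arr (C \<times>\<^sub>C D) = Arr C \<times> Arr D"
  "Dom (C \<times>\<^sub>C D) (f, g) = (Dom C f, Dom D g)" "Cod (C \<times>\<^sub>C D) (f, g) = (Cod C f, Cod D g)"
  "Ident (C \<times>\<^sub>C D) (x, y) = (Ident C x, Ident D y)"
  "Comp (C \<times>\<^sub>C D) (f, g) (f', g') = (Comp C f f', Comp D g g')"
  by (simp_all add: prod_cat_def)

lemma prod_func_simps [simp]:
  "ob (F \<times>\<^sub>F G) (x, y) = (ob F x, ob G y)" "ar (F \<times>\<^sub>F G) (f, g) = (ar F f, ar G g)"
  by (simp_all add: prod_func_def)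

lemma indiscrete_simps [simp]:
  "Obj (indiscrete S) = S" "Arr (indiscrete S) = S \<times> S" "Dom (indiscrete S) = fst" "Cod (indiscrete S) = snd"
  "Ident (indiscrete S) x = (x, x)" "Comp (indiscrete S) f g = (fst f, snd g)"
  by (simp_all add: indiscrete_def)

lemma discrete_simps [simp]:
  "Obj (discrete S) = S" "Arr (discrete S) = {(a, a) | a. a \<in> S}"
  "Dom (discrete S) = fst" "Cod (discrete S) = snd"
  by (simp_all add: discrete_def)

lemma coprod_cat_simps [simp]:
  "Obj (coprod_cat I C) = (SIGMA i:I. Obj (C i))" "Arr (coprod_cat I C) = (SIGMA i:I. Arr (C i))"
  "Dom (coprod_cat I C) (i, f) = (i, Dom (C i) f)" "Cod (coprod_cat I C) (i, f) = (i, Cod (C i) f)"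
  "Ident (coprod_cat I C) (i, x) = (i, Ident (C i) x)"
  "Comp (coprod_cat I C) (i, f) (j, g) = (i, Comp (C i) f g)"
  by (simp_all add: coprod_cat_def)

lemma copair_simps [simp]:
  "ob (copair F) (i, x) = ob (F i) x" "ar (copair F) (i, f) = ar (F i) f"
  by (simp_all add: copair_def)

lemma is_functor_copairD:
  assumes "is_functor (coprod_cat I C) D (copair F)" "i \<in> I"
  shows "is_functor (C i) D (F i)"
proof (rule is_functorI)
  note * = is_functorD[OF assms(1)]
  show "ob (F i) x \<in> Obj D" "ar (F i) (Ident (C i) x) = Ident D (ob (F i) x)" if "x \<in> Obj (C i)" for x
    using *(1)[of "(i, x)"] *(5)[of "(i, x)"] that assms(2) by simp_all
  show "ar (F i) f \<in> Arr D" "Dom D (ar (F i) f) = ob (F i) (Dom (C i) f)"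
    "Cod D (ar (F i) f) = ob (F i) (Cod (C i) f)" if "f \<in> Arr (C i)" for f
    using *(2-4)[of "(i, f)"] that assms(2) by simp_all
  show "ar (F i) (Comp (C i) f g) = Comp D (ar (F i) f) (ar (F i) g)"
    if "f \<in> Arr (C i)" "g \<in> Arr (C i)" "Cod (C i) f = Dom (C i) g" for f g
    using *(6)[of "(i, f)" "(i, g)"] that assms(2) by simp
qed

lemma group_functor_coprodI:
  assumes "\<And>i. i \<in> I \<Longrightarrow> group_functor (C i) H (F i)"
  shows "group_functor (coprod_cat I C) H (\<lambda>(i, f). F i f)"
  using assms by (force intro!: group_functorI simp: group_functorD)


section \<open>Iterated pushouts\<close>

lemma pairs_iff [simp]: "(a, b) \<in> pairs n \<longleftrightarrow> 1 \<le> a \<and> 1 \<le> b \<and> a + b = n"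
  by (simp add: pairs_def)

lemma triples_iff [simp]: "(i, j, k) \<in> triples n \<longleftrightarrow> 1 \<le> i \<and> 1 \<le> j \<and> 1 \<le> k \<and> i + j + k = n"
  by (simp add: triples_def)

lemma triples1_iff [simp]: "(i, j, k) \<in> triples1 n \<longleftrightarrow> 1 \<le> i \<and> j = 1 \<and> 1 \<le> k \<and> i + j + k = n"
  by (auto simp: triples1_def)

lemma triples_pairs:
  assumes "(i, j, k) \<in> triples n"
  shows "(i, j + k) \<in> pairs n" "(j, k) \<in> pairs (j + k)" "(i + j, k) \<in> pairs n" "(i, j) \<in> pairs (i + j)"
  using assms by simp_all

lemma pairs_ge_2: "(a, b) \<in> pairs n \<Longrightarrow> 2 \<le> n"
  by simp

text \<open>With the inverse as an argument, functors and products can carry a chosen pair along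
  without an existential.\<close>

definition inverse_arrows :: "('o, 'm) cat \<Rightarrow> 'm \<Rightarrow> 'm \<Rightarrow> bool" where
  "inverse_arrows C f g \<longleftrightarrow> f \<in> Arr C \<and> g \<in> Arr C \<and> Dom C g = Cod C f \<and> Cod C g = Dom C f \<and>
    Comp C f g = Ident C (Dom C f) \<and> Comp C g f = Ident C (Cod C f)"

lemma groupoid_iff: "groupoid C \<longleftrightarrow> category C \<and> (\<forall>f\<in>Arr C. \<exists>g. inverse_arrows C f g)"
  by (auto simp: groupoid_def groupoid_axioms_def inverse_arrows_def)

lemma (in category) inverse_arrows_Ident:
  "x \<in> Obj C \<Longrightarrow> inverse_arrows C (Ident C x) (Ident C x)"
  using Ident_left[of "Ident C x"] by (simp add: inverse_arrows_def Ident_Arr Dom_Ident Cod_Ident)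

lemma (in category) inverse_arrows_Comp:
  assumes f: "inverse_arrows C f f'" and g: "inverse_arrows C g g'" and fg: "Cod C f = Dom C g"
  shows "inverse_arrows C (Comp C f g) (Comp C g' f')"
proof -
  \<comment> \<open>Half of the claim, for arbitrary pairs, so that the reversed pairs supply the
    other half.\<close>
  have *: "Comp C (Comp C a b) (Comp C b' a') = Ident C (Dom C a)"
    if "inverse_arrows C a a'" "inverse_arrows C b b'" "Cod C a = Dom C b" for a a' b b'
  proof -
    have "Comp C b (Comp C b' a') = a'"
      using that Comp_assoc[of b b' a'] Ident_left[of a'] by (simp add: inverse_arrows_def)
    then show ?thesis
      using that by (simp add: inverse_arrows_def Comp_assoc Comp_Arr Dom_Comp Cod_Comp)
  qed
  have "inverse_arrows C g' g" "inverse_arrows C f' f"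
    using f g by (simp_all add: inverse_arrows_def)
  with *[OF f g fg] *[of g' g f' f] fg f g show ?thesis
    by (simp add: inverse_arrows_def Comp_Arr Dom_Comp Cod_Comp)
qed

lemma inverse_arrows_functor:
  assumes "is_functor C D F" "category C" "inverse_arrows C f g"
  shows "inverse_arrows D (ar F f) (ar F g)"
  using assms(3) is_functorD(6)[OF assms(1), of f g] is_functorD(6)[OF assms(1), of g f]
    category.Dom_Obj[OF assms(2)] category.Cod_Obj[OF assms(2)]
  by (simp add: inverse_arrows_def is_functorD(1-5)[OF assms(1)])

lemma inverse_arrows_prod:
  "inverse_arrows C f f' \<Longrightarrow> inverse_arrows D g g' \<Longrightarrow> inverse_arrows (C \<times>\<^sub>C D) (f, g) (f', g')"
  by (simp add: inverse_arrows_def)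

lemma category_prod: "category C \<Longrightarrow> category D \<Longrightarrow> category (C \<times>\<^sub>C D)"
  unfolding category_def by simp

lemma category_indiscrete: "category (indiscrete S)"
  by unfold_locales auto

lemma terminal_cat_eq:
  assumes "terminal_cat C" shows "f \<in> Arr C \<Longrightarrow> g \<in> Arr C \<Longrightarrow> f = g"
  using assms by (auto simp: terminal_cat_def)

text \<open>Both towers are instances: \<open>J = triples\<close> gives the Catalan groupoids and
  \<open>J = triples1\<close> the subgroupoids, so the facts on objects, arrows and induced functors
  are proved once.\<close>

locale catalan_tower =
  fixes J :: "nat \<Rightarrow> (nat \<times> nat \<times> nat) set"
    and A :: "nat \<Rightarrow> ('u, 'u) cat" and U :: "'u U_family" and V :: "'u V_family"
  assumes tower: "iterated_pushout J A U V"
    and J_triples: "J n \<subseteq> triples n"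
begin

section \<open>Objects, arrows and inverses in a tower of pushouts\<close>

lemma pushout: "2 \<le> n \<Longrightarrow> is_pushout
      (coprod_cat (J n) (\<lambda>(i, j, k). A i \<times>\<^sub>C A j \<times>\<^sub>C A k \<times>\<^sub>C Idot))
      (coprod_cat (J n) (\<lambda>(i, j, k). A i \<times>\<^sub>C A j \<times>\<^sub>C A k \<times>\<^sub>C Icat))
      (coprod_cat (pairs n) (\<lambda>(a, b). A a \<times>\<^sub>C A b))
      func_id (W U)
      (A n) (copair (\<lambda>(i, j, k). V i j k)) (copair (\<lambda>(a, b). U a b))"
  using tower by (simp add: iterated_pushout_def)

lemma terminal: "terminal_cat (A 1)"
  using tower by (simp add: iterated_pushout_def)

lemma category_A: "1 \<le> n \<Longrightarrow> category (A n)"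
proof (cases "n = 1")
  case True
  then show ?thesis
    using terminal by (simp add: terminal_cat_def)
next
  case False
  assume "1 \<le> n"
  with False have "2 \<le> n" by simp
  then show ?thesis
    by (rule is_pushoutD(6)[OF pushout])
qed

lemma J_D: "(i, j, k) \<in> J n \<Longrightarrow> (i, j, k) \<in> triples n"
  using J_triples by blast

lemma U_functor: "(a, b) \<in> pairs n \<Longrightarrow> is_functor (A a \<times>\<^sub>C A b) (A n) (U a b)"
  using is_functor_copairD[OF is_pushoutD(8)[OF pushout[of n]], of "(a, b)"] by auto

lemma V_functor: "(i, j, k) \<in> J n \<Longrightarrow> is_functor (A i \<times>\<^sub>C A j \<times>\<^sub>C A k \<times>\<^sub>C Icat) (A n) (V i j k)"
  using is_functor_copairD[OF is_pushoutD(7)[OF pushout[of n]], of "(i, j, k)"] J_D[of i j k n] by auto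

lemma U_simps:
  assumes "(a, b) \<in> pairs n"
  shows "x \<in> Obj (A a) \<Longrightarrow> y \<in> Obj (A b) \<Longrightarrow> ob (U a b) (x, y) \<in> Obj (A n)"
    and "f \<in> Arr (A a) \<Longrightarrow> g \<in> Arr (A b) \<Longrightarrow> ar (U a b) (f, g) \<in> Arr (A n)"
    and "f \<in> Arr (A a) \<Longrightarrow> g \<in> Arr (A b) \<Longrightarrow> Dom (A n) (ar (U a b) (f, g)) = ob (U a b) (Dom (A a) f, Dom (A b) g)"
    and "f \<in> Arr (A a) \<Longrightarrow> g \<in> Arr (A b) \<Longrightarrow> Cod (A n) (ar (U a b) (f, g)) = ob (U a b) (Cod (A a) f, Cod (A b) g)"
    and "x \<in> Obj (A a) \<Longrightarrow> y \<in> Obj (A b) \<Longrightarrow>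
      ar (U a b) (Ident (A a) x, Ident (A b) y) = Ident (A n) (ob (U a b) (x, y))"
    and "f \<in> Arr (A a) \<Longrightarrow> g \<in> Arr (A b) \<Longrightarrow> f' \<in> Arr (A a) \<Longrightarrow> g' \<in> Arr (A b) \<Longrightarrow>
      Cod (A a) f = Dom (A a) f' \<Longrightarrow> Cod (A b) g = Dom (A b) g' \<Longrightarrow>
      ar (U a b) (Comp (A a) f f', Comp (A b) g g') = Comp (A n) (ar (U a b) (f, g)) (ar (U a b) (f', g'))"
  using is_functorD(1)[OF U_functor[OF assms], of "(x, y)"]
    is_functorD(2-4)[OF U_functor[OF assms], of "(f, g)"]
    is_functorD(5)[OF U_functor[OF assms], of "(x, y)"]
    is_functorD(6)[OF U_functor[OF assms], of "(f, g)" "(f', g')"] by simp_all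

text \<open>The commuting square read elementwise. End 0 of the interval is the bracketing i, (j, k)
  and end 1 is (i, j), k; this fixes the direction of all conjugation relations later.\<close>

lemma square:
  assumes "(i, j, k) \<in> J n"
  shows "x \<in> Obj (A i) \<Longrightarrow> y \<in> Obj (A j) \<Longrightarrow> z \<in> Obj (A k) \<Longrightarrow>
      ob (V i j k) (x, y, z, 0) = ob (U i (j + k)) (x, ob (U j k) (y, z))"
    and "x \<in> Obj (A i) \<Longrightarrow> y \<in> Obj (A j) \<Longrightarrow> z \<in> Obj (A k) \<Longrightarrow>
      ob (V i j k) (x, y, z, 1) = ob (U (i + j) k) (ob (U i j) (x, y), z)"
    and "f \<in> Arr (A i) \<Longrightarrow> g \<in> Arr (A j) \<Longrightarrow> h \<in> Arr (A k) \<Longrightarrow>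
      ar (V i j k) (f, g, h, 0, 0) = ar (U i (j + k)) (f, ar (U j k) (g, h))"
    and "f \<in> Arr (A i) \<Longrightarrow> g \<in> Arr (A j) \<Longrightarrow> h \<in> Arr (A k) \<Longrightarrow>
      ar (V i j k) (f, g, h, 1, 1) = ar (U (i + j) k) (ar (U i j) (f, g), h)"
proof -
  have "2 \<le> n"
    using J_D[OF assms] by simp
  from is_pushoutD(9)[OF pushout[OF this]]
  have *: "x \<in> Obj (A i) \<Longrightarrow> y \<in> Obj (A j) \<Longrightarrow> z \<in> Obj (A k) \<Longrightarrow> t \<in> {0, 1} \<Longrightarrow>
      ob (copair (\<lambda>(i, j, k). V i j k)) ((i, j, k), x, y, z, t) = ob (copair (\<lambda>(a, b). U a b)) (ob (W U) ((i, j, k), x, y, z, t))"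
    and **: "f \<in> Arr (A i) \<Longrightarrow> g \<in> Arr (A j) \<Longrightarrow> h \<in> Arr (A k) \<Longrightarrow> t \<in> {0, 1} \<Longrightarrow>
      ar (copair (\<lambda>(i, j, k). V i j k)) ((i, j, k), f, g, h, t, t) = ar (copair (\<lambda>(a, b). U a b)) (ar (W U) ((i, j, k), f, g, h, t, t))" for x y z f g h t
    using assms by (fastforce simp: func_eq_def func_id_def)+
  show "x \<in> Obj (A i) \<Longrightarrow> y \<in> Obj (A j) \<Longrightarrow> z \<in> Obj (A k) \<Longrightarrow>
      ob (V i j k) (x, y, z, 0) = ob (U i (j + k)) (x, ob (U j k) (y, z))"
    using *[of x y z 0] by (simp add: W_def)
  show "x \<in> Obj (A i) \<Longrightarrow> y \<in> Obj (A j) \<Longrightarrow> z \<in> Obj (A k) \<Longrightarrow>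
      ob (V i j k) (x, y, z, 1) = ob (U (i + j) k) (ob (U i j) (x, y), z)"
    using *[of x y z 1] by (simp add: W_def)
  show "f \<in> Arr (A i) \<Longrightarrow> g \<in> Arr (A j) \<Longrightarrow> h \<in> Arr (A k) \<Longrightarrow>
      ar (V i j k) (f, g, h, 0, 0) = ar (U i (j + k)) (f, ar (U j k) (g, h))"
    using **[of f g h 0] by (simp add: W_def)
  show "f \<in> Arr (A i) \<Longrightarrow> g \<in> Arr (A j) \<Longrightarrow> h \<in> Arr (A k) \<Longrightarrow>
      ar (V i j k) (f, g, h, 1, 1) = ar (U (i + j) k) (ar (U i j) (f, g), h)"
    using **[of f g h 1] by (simp add: W_def)
qed

lemma V_simps:
  assumes "(i, j, k) \<in> J n"
  shows "f \<in> Arr (A i) \<Longrightarrow> g \<in> Arr (A j) \<Longrightarrow> h \<in> Arr (A k) \<Longrightarrow> s \<in> {0, 1} \<Longrightarrow> t \<in> {0, 1} \<Longrightarrow>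
      ar (V i j k) (f, g, h, s, t) \<in> Arr (A n)"
    and "f \<in> Arr (A i) \<Longrightarrow> g \<in> Arr (A j) \<Longrightarrow> h \<in> Arr (A k) \<Longrightarrow> s \<in> {0, 1} \<Longrightarrow> t \<in> {0, 1} \<Longrightarrow>
      Dom (A n) (ar (V i j k) (f, g, h, s, t)) = ob (V i j k) (Dom (A i) f, Dom (A j) g, Dom (A k) h, s)"
    and "f \<in> Arr (A i) \<Longrightarrow> g \<in> Arr (A j) \<Longrightarrow> h \<in> Arr (A k) \<Longrightarrow> s \<in> {0, 1} \<Longrightarrow> t \<in> {0, 1} \<Longrightarrow>
      Cod (A n) (ar (V i j k) (f, g, h, s, t)) = ob (V i j k) (Cod (A i) f, Cod (A j) g, Cod (A k) h, t)"
  using is_functorD(2-4)[OF V_functor[OF assms], of "(f, g, h, s, t)"] by auto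

text \<open>An arrow of a product with the interval may traverse the interval last or first. The
  first form reduces all values of \<open>V\<close> to those at \<iota> and its inverse; equating
  both forms gives naturality of \<iota>.\<close>

lemma V_decompose:
  assumes "(i, j, k) \<in> J n" "f \<in> Arr (A i)" "g \<in> Arr (A j)" "h \<in> Arr (A k)" "s \<in> {0, 1}" "t \<in> {0, 1}"
  shows "ar (V i j k) (f, g, h, s, t) = Comp (A n) (ar (V i j k) (f, g, h, s, s))
      (ar (V i j k) (Ident (A i) (Cod (A i) f), Ident (A j) (Cod (A j) g), Ident (A k) (Cod (A k) h), s, t))"
    (is ?A)
    and "ar (V i j k) (f, g, h, s, t) = Comp (A n)
      (ar (V i j k) (Ident (A i) (Dom (A i) f), Ident (A j) (Dom (A j) g), Ident (A k) (Dom (A k) h), s, t))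
      (ar (V i j k) (f, g, h, t, t))" (is ?B)
proof -
  have "(i, j, k) \<in> triples n"
    by (rule J_D) fact
  then interpret i: category "A i" + j: category "A j" + k: category "A k"
    by (auto intro: category_A)
  show ?A
    using assms is_functorD(6)[OF V_functor[OF assms(1)], of "(f, g, h, s, s)"
      "(Ident (A i) (Cod (A i) f), Ident (A j) (Cod (A j) g), Ident (A k) (Cod (A k) h), s, t)"]
    by (auto simp: i.Cod_Obj j.Cod_Obj k.Cod_Obj i.Ident_Arr j.Ident_Arr k.Ident_Arr
        i.Dom_Ident j.Dom_Ident k.Dom_Ident i.Ident_right j.Ident_right k.Ident_right)
  show ?B
    using assms is_functorD(6)[OF V_functor[OF assms(1)],
        of "(Ident (A i) (Dom (A i) f), Ident (A j) (Dom (A j) g), Ident (A k) (Dom (A k) h), s, t)" "(f, g, h, t, t)"]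
    by (auto simp: i.Dom_Obj j.Dom_Obj k.Dom_Obj i.Ident_Arr j.Ident_Arr k.Ident_Arr
        i.Cod_Ident j.Cod_Ident k.Cod_Ident i.Ident_left j.Ident_left k.Ident_left)
qed

text \<open>The interval and its discrete part have the same objects, so by the square every object
  in the image of \<open>V\<close> is already in the image of some \<open>U\<close>.\<close>

lemma Obj_cases:
  assumes "x \<in> Obj (A n)" "2 \<le> n"
  obtains a b y z where "(a, b) \<in> pairs n" "y \<in> Obj (A a)" "z \<in> Obj (A b)" "x = ob (U a b) (y, z)"
proof -
  consider (V) i j k f g h t where "(i, j, k) \<in> J n" "f \<in> Obj (A i)" "g \<in> Obj (A j)" "h \<in> Obj (A k)" "t = 0 \<or> t = 1"
      "x = ob (V i j k) (f, g, h, t)"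
    | (U) a b y z where "(a, b) \<in> pairs n" "y \<in> Obj (A a)" "z \<in> Obj (A b)" "x = ob (U a b) (y, z)"
    using assms(1) unfolding pushout_Obj[OF pushout[OF assms(2)]] by fastforce
  then show ?thesis
  proof cases
    case V
    note t = triples_pairs[OF J_D[OF V(1)]]
    from V(5) show ?thesis
    proof
      assume "t = 0"
      then show ?thesis
        using that[of i "j + k" f "ob (U j k) (g, h)"] V t by (simp add: square[OF V(1)] U_simps(1)[OF t(2)])
    next
      assume "t = 1"
      then show ?thesis
        using that[of "i + j" k "ob (U i j) (f, g)" h] V t square(2)[OF V(1)] by (simp add: U_simps(1)[OF t(4)])
    qed
  qed (rule that)
qed

lemma nonempty: "1 \<le> n \<Longrightarrow> Obj (A n) \<noteq> {}"
proof (induction n rule: less_induct)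
  case (less n)
  show ?case
  proof (cases "n = 1")
    case True
    then show ?thesis
      using terminal by (auto simp: terminal_cat_def)
  next
    case False
    with less.prems have "(1, n - 1) \<in> pairs n" by simp
    moreover have "Obj (A 1) \<noteq> {}" "Obj (A (n - 1)) \<noteq> {}"
      using less.IH[of 1] less.IH[of "n - 1"] False less.prems by simp_all
    ultimately show ?thesis
      using U_simps(1)[of 1 "n - 1" n] by blast
  qed
qed

text \<open>A value of \<open>V\<close> at an identity of the interval is a value of
  \<open>U\<close>, and identities of \<open>A n\<close> are values of \<open>U\<close> on
  identities. Besides \<open>U\<close>, this leaves \<iota> and its inverse with identity arguments;
  both directions are listed since the closure is under composition only.\<close>

lemma arrow_induct:
  assumes n: "2 \<le> n" and f: "f \<in> Arr (A n)"
    and U: "\<And>a b f g. (a, b) \<in> pairs n \<Longrightarrow> f \<in> Arr (A a) \<Longrightarrow> g \<in> Arr (A b) \<Longrightarrow> K (ar (U a b) (f, g))"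
    and V: "\<And>i j k x y z. (i, j, k) \<in> J n \<Longrightarrow> x \<in> Obj (A i) \<Longrightarrow> y \<in> Obj (A j) \<Longrightarrow> z \<in> Obj (A k) \<Longrightarrow>
        K (ar (V i j k) (Ident (A i) x, Ident (A j) y, Ident (A k) z, 0, 1))"
      "\<And>i j k x y z. (i, j, k) \<in> J n \<Longrightarrow> x \<in> Obj (A i) \<Longrightarrow> y \<in> Obj (A j) \<Longrightarrow> z \<in> Obj (A k) \<Longrightarrow>
        K (ar (V i j k) (Ident (A i) x, Ident (A j) y, Ident (A k) z, 1, 0))"
    and comp: "\<And>f g. f \<in> Arr (A n) \<Longrightarrow> g \<in> Arr (A n) \<Longrightarrow> Cod (A n) f = Dom (A n) g \<Longrightarrow> K f \<Longrightarrow> K g \<Longrightarrow>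
        K (Comp (A n) f g)"
  shows "K f"
  using pushout[OF n] f
proof (rule pushout_arrow_induct)
  fix x assume x: "x \<in> Obj (A n)"
  then obtain a b y z where *: "(a, b) \<in> pairs n" "y \<in> Obj (A a)" "z \<in> Obj (A b)" "x = ob (U a b) (y, z)"
    using n by (rule Obj_cases)
  then have "category (A a)" "category (A b)"
    by (auto intro: category_A)
  then show "K (Ident (A n) x)"
    using U[of a b "Ident (A a) y" "Ident (A b) z"] U_simps(5)[OF *(1-3)] * by (simp add: category.Ident_Arr)
next
  fix F assume "F \<in> Arr (coprod_cat (J n) (\<lambda>(i, j, k). A i \<times>\<^sub>C A j \<times>\<^sub>C A k \<times>\<^sub>C Icat))"
  then obtain i j k f g h s t where F: "F = ((i, j, k), f, g, h, s, t)" and J: "(i, j, k) \<in> J n"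
    and fgh: "f \<in> Arr (A i)" "g \<in> Arr (A j)" "h \<in> Arr (A k)" and s: "s \<in> {0, 1}" and t: "t \<in> {0, 1}"
    by (cases F) auto
  note J' = J_D[OF J]
  note t' = triples_pairs[OF J']
  interpret i: category "A i" + j: category "A j" + k: category "A k"
    using J' by (auto intro: category_A)
  have ss: "K (ar (V i j k) (f, g, h, s, s))"
    using s fgh U[OF t'(1)] U[OF t'(3)] square(3,4)[OF J fgh] U_simps(2)[OF t'(2)] U_simps(2)[OF t'(4)] by auto
  have "K (ar (V i j k) (f, g, h, s, t))"
  proof (cases "s = t")
    case False
    let ?v = "ar (V i j k) (Ident (A i) (Cod (A i) f), Ident (A j) (Cod (A j) g), Ident (A k) (Cod (A k) h), s, t)"
    have "K ?v"
      using False s t fgh V[OF J, of "Cod (A i) f" "Cod (A j) g" "Cod (A k) h"]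
      by (auto simp: i.Cod_Obj j.Cod_Obj k.Cod_Obj)
    moreover have "?v \<in> Arr (A n)" "ar (V i j k) (f, g, h, s, s) \<in> Arr (A n)"
      "Cod (A n) (ar (V i j k) (f, g, h, s, s)) = Dom (A n) ?v"
      using fgh s t V_simps[OF J]
      by (simp_all add: i.Cod_Obj j.Cod_Obj k.Cod_Obj i.Ident_Arr j.Ident_Arr k.Ident_Arr
        i.Dom_Ident j.Dom_Ident k.Dom_Ident)
    ultimately show ?thesis
      unfolding V_decompose(1)[OF J fgh s t] using ss by (intro comp)
  qed (use ss in simp)
  then show "K (ar (copair (\<lambda>(i, j, k). V i j k)) F)"
    by (simp add: F)
next
  fix F assume "F \<in> Arr (coprod_cat (pairs n) (\<lambda>(a, b). A a \<times>\<^sub>C A b))"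
  then obtain a b f g where "F = ((a, b), f, g)" "(a, b) \<in> pairs n" "f \<in> Arr (A a)" "g \<in> Arr (A b)"
    by (cases F) auto
  then show "K (ar (copair (\<lambda>(a, b). U a b)) F)"
    using U by simp
qed (rule comp)

lemma inverse_arrows_V:
  assumes J: "(i, j, k) \<in> J n" and "x \<in> Obj (A i)" "y \<in> Obj (A j)" "z \<in> Obj (A k)"
  shows "inverse_arrows (A n) (ar (V i j k) (Ident (A i) x, Ident (A j) y, Ident (A k) z, 0, 1))
    (ar (V i j k) (Ident (A i) x, Ident (A j) y, Ident (A k) z, 1, 0))"
proof (rule inverse_arrows_functor[OF V_functor[OF J]])
  interpret i: category "A i" + j: category "A j" + k: category "A k"
    using J_D[OF J] by (auto intro: category_A)
  show "category (A i \<times>\<^sub>C A j \<times>\<^sub>C A k \<times>\<^sub>C Icat)"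
    by (intro category_prod category_indiscrete i.category_axioms j.category_axioms k.category_axioms)
  show "inverse_arrows (A i \<times>\<^sub>C A j \<times>\<^sub>C A k \<times>\<^sub>C Icat)
      (Ident (A i) x, Ident (A j) y, Ident (A k) z, 0, 1) (Ident (A i) x, Ident (A j) y, Ident (A k) z, 1, 0)"
    using assms by (intro inverse_arrows_prod i.inverse_arrows_Ident j.inverse_arrows_Ident k.inverse_arrows_Ident)
      (auto simp: inverse_arrows_def)
qed

text \<open>Invertibility spreads along \<open>arrow_induct\<close>; reversing the arrow of the
  interval inverts the value of \<open>V\<close>.\<close>

lemma groupoid_A: "1 \<le> n \<Longrightarrow> groupoid (A n)"
proof (induction n rule: less_induct)
  case (less n)
  interpret category "A n"
    using less.prems by (rule category_A)
  show ?case
  proof (cases "n = 1")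
    case True
    then have eq: "f = g" if "f \<in> Arr (A n)" "g \<in> Arr (A n)" for f g
      using that terminal_cat_eq[OF terminal] by simp
    have "f = Ident (A n) (Dom (A n) f)" if "f \<in> Arr (A n)" for f
      using that by (intro eq) (auto simp: Ident_Arr Dom_Obj)
    then show ?thesis
      unfolding groupoid_iff using inverse_arrows_Ident Dom_Obj category_axioms by metis
  next
    case False
    with less.prems have n: "2 \<le> n" by simp
    have "\<exists>g. inverse_arrows (A n) f g" if "f \<in> Arr (A n)" for f
      using n that
    proof (rule arrow_induct)
      fix a b f g assume *: "(a, b) \<in> pairs n" "f \<in> Arr (A a)" "g \<in> Arr (A b)"
      then have "groupoid (A a)" "groupoid (A b)"
        using less.IH[of a] less.IH[of b] by auto
      then obtain f' g' where "inverse_arrows (A a) f f'" "inverse_arrows (A b) g g'" "category (A a)" "category (A b)"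
        using * unfolding groupoid_iff by blast
      then show "\<exists>h. inverse_arrows (A n) (ar (U a b) (f, g)) h"
        using inverse_arrows_functor[OF U_functor[OF *(1)] category_prod inverse_arrows_prod] by blast
    next
      fix i j k x y z
      assume "(i, j, k) \<in> J n" "x \<in> Obj (A i)" "y \<in> Obj (A j)" "z \<in> Obj (A k)"
      then have *: "inverse_arrows (A n) (ar (V i j k) (Ident (A i) x, Ident (A j) y, Ident (A k) z, 0, 1))
          (ar (V i j k) (Ident (A i) x, Ident (A j) y, Ident (A k) z, 1, 0))"
        by (rule inverse_arrows_V)
      then show "\<exists>h. inverse_arrows (A n) (ar (V i j k) (Ident (A i) x, Ident (A j) y, Ident (A k) z, 0, 1)) h"
        by blast
      from * have "inverse_arrows (A n) (ar (V i j k) (Ident (A i) x, Ident (A j) y, Ident (A k) z, 1, 0))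
          (ar (V i j k) (Ident (A i) x, Ident (A j) y, Ident (A k) z, 0, 1))"
        by (simp add: inverse_arrows_def)
      then show "\<exists>h. inverse_arrows (A n) (ar (V i j k) (Ident (A i) x, Ident (A j) y, Ident (A k) z, 1, 0)) h"
        by blast
    qed (use inverse_arrows_Comp in blast)
    then show ?thesis
      by (simp add: groupoid_iff category_axioms)
  qed
qed

lemma group_functor_inverse:
  assumes "group_functor C H F" "category C" "group H" "inverse_arrows C f g"
  shows "F g = inv\<^bsub>H\<^esub> F f"
proof -
  interpret category C by fact
  interpret H: group H by fact
  have "F g \<otimes>\<^bsub>H\<^esub> F f = \<one>\<^bsub>H\<^esub>"
    using assms(4) group_functorD(2)[OF assms(1), of g f] group_functor_Ident[OF assms(1-3)]
    by (simp add: inverse_arrows_def Cod_Obj)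
  then show ?thesis
    using assms(4) group_functorD(1)[OF assms(1)] by (simp add: H.inv_equality inverse_arrows_def)
qed

text \<open>Testing \<iota> in one direction is enough, because a functor into a group sends the
  reversed arrow to the inverse element.\<close>

lemma group_functor_eqI:
  assumes n: "2 \<le> n" and H: "group H" and F: "group_functor (A n) H F" and G: "group_functor (A n) H G"
    and U: "\<And>a b f g. (a, b) \<in> pairs n \<Longrightarrow> f \<in> Arr (A a) \<Longrightarrow> g \<in> Arr (A b) \<Longrightarrow>
        F (ar (U a b) (f, g)) = G (ar (U a b) (f, g))"
    and V: "\<And>i j k x y z. (i, j, k) \<in> J n \<Longrightarrow> x \<in> Obj (A i) \<Longrightarrow> y \<in> Obj (A j) \<Longrightarrow> z \<in> Obj (A k) \<Longrightarrow>
        F (ar (V i j k) (Ident (A i) x, Ident (A j) y, Ident (A k) z, \<iota>)) =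
        G (ar (V i j k) (Ident (A i) x, Ident (A j) y, Ident (A k) z, \<iota>))"
    and f: "f \<in> Arr (A n)"
  shows "F f = G f"
  using n f
proof (rule arrow_induct)
  have "category (A n)"
    using n by (intro category_A) simp
  then show "F (ar (V i j k) (Ident (A i) x, Ident (A j) y, Ident (A k) z, 1, 0)) =
      G (ar (V i j k) (Ident (A i) x, Ident (A j) y, Ident (A k) z, 1, 0))"
    if "(i, j, k) \<in> J n" "x \<in> Obj (A i)" "y \<in> Obj (A j)" "z \<in> Obj (A k)" for i j k x y z
    using group_functor_inverse[OF F _ H inverse_arrows_V[OF that]]
      group_functor_inverse[OF G _ H inverse_arrows_V[OF that]] V[OF that] by simp
qed (use U V group_functorD(2)[OF F] group_functorD(2)[OF G] in auto)

end

section \<open>Constructing functors from a tower to a group, and connectedness\<close>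

lemma (in group) mult_inv_cancel:
  assumes "x \<in> carrier G" "y \<in> carrier G"
  shows "x \<otimes> (inv x \<otimes> y) = y" "inv x \<otimes> (x \<otimes> y) = y"
  using assms by (simp_all flip: m_assoc)

context catalan_tower
begin

text \<open>In \<open>natural\<close> the two products are the values at the bracketings of end 0
  and of end 1. The intended value \<open>c i j k\<close> of \<iota> stands after the first and
  before the second because composition is in path order.\<close>

lemma to_group:
  fixes e :: "'a \<Rightarrow> 'u" and H :: "('a, 'b) monoid_scheme"
  assumes n: "2 \<le> n" and H: "group H" and e: "inj_on e (carrier H)"
    and F: "\<And>a b. (a, b) \<in> pairs n \<Longrightarrow> group_functor (A a) H (F a b)"
    and G: "\<And>a b. (a, b) \<in> pairs n \<Longrightarrow> group_functor (A b) H (G a b)"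
    and FG: "\<And>a b f g. (a, b) \<in> pairs n \<Longrightarrow> f \<in> Arr (A a) \<Longrightarrow> g \<in> Arr (A b) \<Longrightarrow>
      F a b f \<otimes>\<^bsub>H\<^esub> G a b g = G a b g \<otimes>\<^bsub>H\<^esub> F a b f"
    and c: "\<And>i j k. (i, j, k) \<in> J n \<Longrightarrow> c i j k \<in> carrier H"
    and natural: "\<And>i j k f g h. (i, j, k) \<in> J n \<Longrightarrow> f \<in> Arr (A i) \<Longrightarrow> g \<in> Arr (A j) \<Longrightarrow> h \<in> Arr (A k) \<Longrightarrow>
      (F i (j + k) f \<otimes>\<^bsub>H\<^esub> G i (j + k) (ar (U j k) (g, h))) \<otimes>\<^bsub>H\<^esub> c i j k =
      c i j k \<otimes>\<^bsub>H\<^esub> (F (i + j) k (ar (U i j) (f, g)) \<otimes>\<^bsub>H\<^esub> G (i + j) k h)"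
  obtains \<Phi> where "group_functor (A n) H \<Phi>"
    "\<And>a b f g. (a, b) \<in> pairs n \<Longrightarrow> f \<in> Arr (A a) \<Longrightarrow> g \<in> Arr (A b) \<Longrightarrow>
      \<Phi> (ar (U a b) (f, g)) = F a b f \<otimes>\<^bsub>H\<^esub> G a b g"
    "\<And>i j k x y z. (i, j, k) \<in> J n \<Longrightarrow> x \<in> Obj (A i) \<Longrightarrow> y \<in> Obj (A j) \<Longrightarrow> z \<in> Obj (A k) \<Longrightarrow>
      \<Phi> (ar (V i j k) (Ident (A i) x, Ident (A j) y, Ident (A k) z, \<iota>)) = c i j k"
proof -
  interpret H: group H by fact
  define S where "S = (\<lambda>(a, b) (f, g). F a b f \<otimes>\<^bsub>H\<^esub> G a b g)"
  have S: "group_functor (A a \<times>\<^sub>C A b) H (S (a, b))" if ab: "(a, b) \<in> pairs n" for a b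
  proof (rule group_functorI)
    note F = group_functorD[OF F[OF ab]] and G = group_functorD[OF G[OF ab]]
    show "S (a, b) f \<in> carrier H" if "f \<in> Arr (A a \<times>\<^sub>C A b)" for f
      using that F(1) G(1) by (auto simp: S_def)
    fix x y assume *: "x \<in> Arr (A a \<times>\<^sub>C A b)" "y \<in> Arr (A a \<times>\<^sub>C A b)"
      "Cod (A a \<times>\<^sub>C A b) x = Dom (A a \<times>\<^sub>C A b) y"
    obtain f g where x: "x = (f, g)" by force
    obtain f' g' where y: "y = (f', g')" by force
    have c: "F a b f \<in> carrier H" "G a b g \<in> carrier H" "F a b f' \<in> carrier H" "G a b g' \<in> carrier H"
      using * F(1) G(1) by (auto simp: x y)
    \<comment> \<open>Interchange law of the product category: the values of \<open>f'\<close> and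
      \<open>g\<close> belong to different coordinates and swap by \<open>FG\<close>.\<close>
    have "F a b f \<otimes>\<^bsub>H\<^esub> F a b f' \<otimes>\<^bsub>H\<^esub> (G a b g \<otimes>\<^bsub>H\<^esub> G a b g') =
        F a b f \<otimes>\<^bsub>H\<^esub> (F a b f' \<otimes>\<^bsub>H\<^esub> G a b g) \<otimes>\<^bsub>H\<^esub> G a b g'"
      using c by (simp add: H.m_assoc)
    also have "\<dots> = F a b f \<otimes>\<^bsub>H\<^esub> G a b g \<otimes>\<^bsub>H\<^esub> (F a b f' \<otimes>\<^bsub>H\<^esub> G a b g')"
      using c * FG[OF ab, of f' g] by (simp add: H.m_assoc x y)
    finally show "S (a, b) (Comp (A a \<times>\<^sub>C A b) x y) = S (a, b) x \<otimes>\<^bsub>H\<^esub> S (a, b) y"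
      using * F(2) G(2) by (simp add: x y S_def)
  qed
  txt \<open>
    Conjugation by \<open>\<kappa>\<close> makes \<open>R\<close> functorial in the last argument by construction; naturality is
    exactly its compatibility with \<open>W\<close> at the object \<open>1\<close> of \<open>Idot\<close>.
  \<close>
  define \<kappa> where "\<kappa> = (\<lambda>(i, j, k) (t :: nat). if t = 0 then \<one>\<^bsub>H\<^esub> else c i j k)"
  define R where "R = (\<lambda>(i, j, k) (f, g, h, s, t). inv\<^bsub>H\<^esub> \<kappa> (i, j, k) s \<otimes>\<^bsub>H\<^esub>
    S (i, j + k) (f, ar (U j k) (g, h)) \<otimes>\<^bsub>H\<^esub> \<kappa> (i, j, k) t)"
  have \<kappa>: "\<kappa> (i, j, k) t \<in> carrier H" if "(i, j, k) \<in> J n" for i j k t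
    using c[OF that] by (simp add: \<kappa>_def)
  have R: "group_functor (A i \<times>\<^sub>C A j \<times>\<^sub>C A k \<times>\<^sub>C Icat) H (R (i, j, k))" if J: "(i, j, k) \<in> J n" for i j k
  proof (rule group_functorI)
    note t = triples_pairs[OF J_D[OF J]]
    have S_closed: "S (i, j + k) (f, ar (U j k) (g, h)) \<in> carrier H"
      if "f \<in> Arr (A i)" "g \<in> Arr (A j)" "h \<in> Arr (A k)" for f g h
      using that by (intro group_functorD(1)[OF S[OF t(1)]]) (simp add: U_simps(2)[OF t(2)])
    then show "R (i, j, k) f \<in> carrier H" if "f \<in> Arr (A i \<times>\<^sub>C A j \<times>\<^sub>C A k \<times>\<^sub>C Icat)" for f
      using that \<kappa>[OF J] by (auto simp: R_def)
    fix x y assume *: "x \<in> Arr (A i \<times>\<^sub>C A j \<times>\<^sub>C A k \<times>\<^sub>C Icat)" "y \<in> Arr (A i \<times>\<^sub>C A j \<times>\<^sub>C A k \<times>\<^sub>C Icat)"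
      "Cod (A i \<times>\<^sub>C A j \<times>\<^sub>C A k \<times>\<^sub>C Icat) x = Dom (A i \<times>\<^sub>C A j \<times>\<^sub>C A k \<times>\<^sub>C Icat) y"
    obtain f g h r s where x: "x = (f, g, h, r, s)" by (cases x) auto
    obtain f' g' h' s' u where y: "y = (f', g', h', s', u)" by (cases y) auto
    have a: "f \<in> Arr (A i)" "g \<in> Arr (A j)" "h \<in> Arr (A k)" "f' \<in> Arr (A i)" "g' \<in> Arr (A j)" "h' \<in> Arr (A k)"
      and cd: "Cod (A i) f = Dom (A i) f'" "Cod (A j) g = Dom (A j) g'" "Cod (A k) h = Dom (A k) h'"
      and s: "s' = s"
      using * by (auto simp: x y)
    have "S (i, j + k) (Comp (A i) f f', ar (U j k) (Comp (A j) g g', Comp (A k) h h')) =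
        S (i, j + k) (f, ar (U j k) (g, h)) \<otimes>\<^bsub>H\<^esub> S (i, j + k) (f', ar (U j k) (g', h'))"
      using a cd group_functorD(2)[OF S[OF t(1)], of "(f, ar (U j k) (g, h))" "(f', ar (U j k) (g', h'))"]
      by (simp add: U_simps[OF t(2)])
    moreover have "inv\<^bsub>H\<^esub> \<kappa> (i, j, k) r \<otimes>\<^bsub>H\<^esub> (X \<otimes>\<^bsub>H\<^esub> Y) \<otimes>\<^bsub>H\<^esub> \<kappa> (i, j, k) u =
        (inv\<^bsub>H\<^esub> \<kappa> (i, j, k) r \<otimes>\<^bsub>H\<^esub> X \<otimes>\<^bsub>H\<^esub> \<kappa> (i, j, k) s) \<otimes>\<^bsub>H\<^esub>
        (inv\<^bsub>H\<^esub> \<kappa> (i, j, k) s \<otimes>\<^bsub>H\<^esub> Y \<otimes>\<^bsub>H\<^esub> \<kappa> (i, j, k) u)"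
      if "X \<in> carrier H" "Y \<in> carrier H" for X Y
      using that \<kappa>[OF J] by (simp add: H.m_assoc H.mult_inv_cancel)
    ultimately show "R (i, j, k) (Comp (A i \<times>\<^sub>C A j \<times>\<^sub>C A k \<times>\<^sub>C Icat) x y) = R (i, j, k) x \<otimes>\<^bsub>H\<^esub> R (i, j, k) y"
      using a S_closed by (simp add: x y s R_def)
  qed
  obtain \<Phi> where \<Phi>: "group_functor (A n) H \<Phi>"
    "\<And>f. f \<in> Arr (coprod_cat (J n) (\<lambda>(i, j, k). A i \<times>\<^sub>C A j \<times>\<^sub>C A k \<times>\<^sub>C Icat)) \<Longrightarrow>
      \<Phi> (ar (copair (\<lambda>(i, j, k). V i j k)) f) = (\<lambda>(i, f). R i f) f"
    "\<And>f. f \<in> Arr (coprod_cat (pairs n) (\<lambda>(a, b). A a \<times>\<^sub>C A b)) \<Longrightarrow>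
      \<Phi> (ar (copair (\<lambda>(a, b). U a b)) f) = (\<lambda>(i, f). S i f) f"
  proof (rule pushout_to_group[OF pushout[OF n] H e])
    show "group_functor (coprod_cat (J n) (\<lambda>(i, j, k). A i \<times>\<^sub>C A j \<times>\<^sub>C A k \<times>\<^sub>C Icat)) H (\<lambda>(i, f). R i f)"
      by (rule group_functor_coprodI) (use R in auto)
    show "group_functor (coprod_cat (pairs n) (\<lambda>(a, b). A a \<times>\<^sub>C A b)) H (\<lambda>(i, f). S i f)"
      by (rule group_functor_coprodI) (use S in auto)
    fix x assume "x \<in> Arr (coprod_cat (J n) (\<lambda>(i, j, k). A i \<times>\<^sub>C A j \<times>\<^sub>C A k \<times>\<^sub>C Idot))"
    then obtain i j k f g h t where x: "x = ((i, j, k), f, g, h, t, t)" and J: "(i, j, k) \<in> J n"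
      and a: "f \<in> Arr (A i)" "g \<in> Arr (A j)" "h \<in> Arr (A k)" and t: "t = 0 \<or> t = 1"
      by (cases x) auto
    note tp = triples_pairs[OF J_D[OF J]]
    have *: "S (i, j + k) (f, ar (U j k) (g, h)) \<in> carrier H" "S (i + j, k) (ar (U i j) (f, g), h) \<in> carrier H"
      using a by (auto intro!: group_functorD(1)[OF S[OF tp(1)]] group_functorD(1)[OF S[OF tp(3)]]
          simp: U_simps(2)[OF tp(2)] U_simps(2)[OF tp(4)])
    from t have "R (i, j, k) (f, g, h, t, t) = (\<lambda>(i, f). S i f) (ar (W U) x)"
    proof
      assume "t = 1"
      then show ?thesis
        using natural[OF J a] c[OF J] *
        by (simp add: x W_def R_def S_def \<kappa>_def H.m_assoc) (simp add: H.mult_inv_cancel)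
    qed (use * in \<open>simp add: x W_def R_def \<kappa>_def\<close>)
    then show "(\<lambda>(i, f). R i f) (ar func_id x) = (\<lambda>(i, f). S i f) (ar (W U) x)"
      by (simp add: func_id_def x)
  qed blast
  show ?thesis
  proof
    show "\<Phi> (ar (U a b) (f, g)) = F a b f \<otimes>\<^bsub>H\<^esub> G a b g"
      if "(a, b) \<in> pairs n" "f \<in> Arr (A a)" "g \<in> Arr (A b)" for a b f g
      using that \<Phi>(3)[of "((a, b), f, g)"] by (simp add: S_def)
    show "\<Phi> (ar (V i j k) (Ident (A i) x, Ident (A j) y, Ident (A k) z, \<iota>)) = c i j k"
      if J: "(i, j, k) \<in> J n" and o: "x \<in> Obj (A i)" "y \<in> Obj (A j)" "z \<in> Obj (A k)" for i j k x y z
    proof -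
      note tp = triples_pairs[OF J_D[OF J]]
      interpret i: category "A i" + j: category "A j" + k: category "A k" + jk: category "A (j + k)"
        using J_D[OF J] by (auto intro: category_A)
      \<comment> \<open>With identities in the first three places the factor \<open>S\<close> is
        one, and \<open>\<kappa>\<close> is one at end 0, so only \<open>c i j k\<close>
        remains.\<close>
      have "F i (j + k) (Ident (A i) x) = \<one>\<^bsub>H\<^esub>" "G i (j + k) (Ident (A (j + k)) (ob (U j k) (y, z))) = \<one>\<^bsub>H\<^esub>"
        using group_functor_Ident[OF F[OF tp(1)] i.category_axioms H o(1)]
          group_functor_Ident[OF G[OF tp(1)] jk.category_axioms H U_simps(1)[OF tp(2) o(2,3)]] by simp_all
      then show ?thesis
        using \<Phi>(2)[of "((i, j, k), Ident (A i) x, Ident (A j) y, Ident (A k) z, \<iota>)"] J o c[OF J]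
        by (simp add: R_def S_def \<kappa>_def i.Ident_Arr j.Ident_Arr k.Ident_Arr U_simps(5)[OF tp(2)])
    qed
  qed (rule \<Phi>(1))
qed

text \<open>
  Connectedness is expressed by functions that are constant along arrows, which saves handling
  zigzags: \<open>\<kappa>\<close> may directly be a class in \<open>\<pi>(A\<^sub>n)\<close> that depends on an object.
\<close>

lemma connected:
  assumes J: "\<And>n. J n = triples1 n"
    and "1 \<le> n" "\<And>f. f \<in> Arr (A n) \<Longrightarrow> \<kappa> (Dom (A n) f) = \<kappa> (Cod (A n) f)"
    and "x \<in> Obj (A n)" "y \<in> Obj (A n)"
  shows "\<kappa> x = \<kappa> y"
  using assms(2-)
proof (induction n arbitrary: \<kappa> x y rule: less_induct)
  case (less n)
  show ?case
  proof (cases "n = 1")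
    case True
    then show ?thesis
      using less.prems(3,4) terminal by (auto simp: terminal_cat_def)
  next
    case False
    with less.prems have n: "2 \<le> n" by simp
    define o' where "o' m = (SOME x. x \<in> Obj (A m))" for m
    have o': "o' m \<in> Obj (A m)" if "1 \<le> m" for m
      using nonempty[OF that] some_in_eq by (simp add: o'_def some_in_eq)
    \<comment> \<open>Inside the image of one \<open>U a b\<close> each coordinate is moved
      separately, by the induction hypothesis for \<open>\<kappa>\<close> composed with
      \<open>U a b\<close> in that coordinate.\<close>
    have U: "\<kappa> (ob (U a b) (y, z)) = \<kappa> (ob (U a b) (y', z'))"
      if ab: "(a, b) \<in> pairs n" and o: "y \<in> Obj (A a)" "y' \<in> Obj (A a)" "z \<in> Obj (A b)" "z' \<in> Obj (A b)"
      for a b y y' z z'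
    proof -
      interpret a: category "A a" + b: category "A b"
        using ab by (auto intro: category_A)
      have "\<kappa> (ob (U a b) (y, z)) = \<kappa> (ob (U a b) (y', z))"
      proof (rule less.IH[of a "\<lambda>y. \<kappa> (ob (U a b) (y, z))"])
        fix f assume "f \<in> Arr (A a)"
        then show "\<kappa> (ob (U a b) (Dom (A a) f, z)) = \<kappa> (ob (U a b) (Cod (A a) f, z))"
          using less.prems(2)[of "ar (U a b) (f, Ident (A b) z)"] o
          by (simp add: U_simps[OF ab] b.Ident_Arr b.Dom_Ident b.Cod_Ident)
      qed (use ab o in auto)
      also have "\<dots> = \<kappa> (ob (U a b) (y', z'))"
      proof (rule less.IH[of b "\<lambda>z. \<kappa> (ob (U a b) (y', z))"])
        fix f assume "f \<in> Arr (A b)"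
        then show "\<kappa> (ob (U a b) (y', Dom (A b) f)) = \<kappa> (ob (U a b) (y', Cod (A b) f))"
          using less.prems(2)[of "ar (U a b) (Ident (A a) y', f)"] o
          by (simp add: U_simps[OF ab] a.Ident_Arr a.Dom_Ident a.Cod_Ident)
      qed (use ab o in auto)
      finally show ?thesis .
    qed
    \<comment> \<open>The common value of \<open>\<kappa>\<close> on the objects that split as a and
      n - a.\<close>
    define c where "c a = \<kappa> (ob (U a (n - a)) (o' a, o' (n - a)))" for a
    \<comment> \<open>The arrow \<open>V i 1 k\<close> joins the split (i, 1 + k) to (i + 1, k), so
      triples with middle index 1 connect all splits in a chain.\<close>
    have step: "c i = c (Suc i)" if i: "1 \<le> i" "Suc i < n" for i
    proof -
      define k where "k = n - i - 1"
      have k: "(i, 1, k) \<in> J n" "n - i = 1 + k" "n - Suc i = k"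
        using i by (auto simp: J k_def)
      note t = triples_pairs[OF J_D[OF k(1)]]
      interpret i: category "A i" + j: category "A 1" + k: category "A k"
        using J_D[OF k(1)] by (auto intro: category_A)
      have o: "o' i \<in> Obj (A i)" "o' 1 \<in> Obj (A 1)" "o' k \<in> Obj (A k)"
        using J_D[OF k(1)] by (auto intro: o')
      have "c i = \<kappa> (ob (V i 1 k) (o' i, o' 1, o' k, 0))"
        unfolding square(1)[OF k(1) o] c_def k(2)
        by (rule U[OF t(1)]) (use o o' U_simps(1)[OF t(2)] in auto)
      also have "\<dots> = \<kappa> (ob (V i 1 k) (o' i, o' 1, o' k, 1))"
        using less.prems(2)[of "ar (V i 1 k) (Ident (A i) (o' i), Ident (A 1) (o' 1), Ident (A k) (o' k), 0, 1)"] o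
          V_simps[OF k(1)] by (simp del: One_nat_def add: i.Ident_Arr j.Ident_Arr k.Ident_Arr i.Dom_Ident j.Dom_Ident k.Dom_Ident
          i.Cod_Ident j.Cod_Ident k.Cod_Ident)
      also have "\<dots> = c (Suc i)"
        unfolding square(2)[OF k(1) o] c_def k(3) unfolding Suc_eq_plus1
        by (rule U[OF t(3)]) (use o o' U_simps(1)[OF t(4)] in auto)
      finally show ?thesis .
    qed
    have c: "c a = c 1" if "1 \<le> a" "a < n" for a
      using that by (induction a rule: dec_induct) (use step in auto)
    have "\<kappa> x = c 1" if x: "x \<in> Obj (A n)" for x
    proof -
      obtain a b y z where *: "(a, b) \<in> pairs n" "y \<in> Obj (A a)" "z \<in> Obj (A b)" "x = ob (U a b) (y, z)"
        using x n by (rule Obj_cases)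
      have b: "n - a = b"
        using *(1) by auto
      have "\<kappa> x = c a"
        unfolding c_def *(4) b by (rule U[OF *(1)]) (use * o' in auto)
      then show ?thesis
        using c[of a] *(1) by auto
    qed
    then show ?thesis
      using less.prems(3,4) by simp
  qed
qed

end


section \<open>The groups \<open>\<pi>(A\<^sub>n)\<close>\<close>

lemma group_arrow_monoid:
  assumes "one_object_groupoid C"
  shows "group (arrow_monoid C)"
proof -
  from assms obtain x where x: "Obj C = {x}"
    by (auto simp: one_object_groupoid_def)
  interpret groupoid C
    using assms by (simp add: one_object_groupoid_def)
  have o: "Dom C f = x" "Cod C f = x" if "f \<in> Arr C" for f
    using Dom_Obj[OF that] Cod_Obj[OF that] x by auto
  show ?thesis
  proof (rule groupI; simp add: arrow_monoid_def x)
    show "\<exists>g\<in>Arr C. Comp C g f = Ident C x" if "f \<in> Arr C" for f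
      using invertible[OF that] o[OF that] by auto
    show "Comp C (Ident C x) f = f" if "f \<in> Arr C" for f
      using Ident_left[OF that] o[OF that] by simp
  qed (auto simp: o Comp_Arr Comp_assoc Ident_Arr x)
qed

locale catalan_collapse =
  fixes A T P :: "nat \<Rightarrow> ('u, 'u) cat"
    and U UT :: "'u U_family"
    and V VT :: "'u V_family"
    and L q :: "nat \<Rightarrow> ('u, 'u, 'u, 'u) func"
    and p :: "nat \<Rightarrow> (unit, unit \<times> unit, 'u, 'u) func"
  assumes A: "catalan_groupoids A U V"
    and T: "maximal_indiscrete_subgroupoids T UT VT"
    and L: "induced_inclusion T UT VT A U V L"
    and collapse: "1 \<le> n \<Longrightarrow> is_collapse (T n) (A n) (L n) (P n) (p n) (q n)"
begin

sublocale A: catalan_tower triples A U V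
  using A by unfold_locales (auto simp: catalan_groupoids_def)

sublocale T: catalan_tower triples1 T UT VT
  using T by unfold_locales (auto simp: maximal_indiscrete_subgroupoids_def triples1_def)

lemma L_functor: "1 \<le> n \<Longrightarrow> is_functor (T n) (A n) (L n)"
  using L by (simp add: induced_inclusion_def)

lemma L_U:
  assumes "(a, b) \<in> pairs n"
  shows "x \<in> Obj (T a) \<Longrightarrow> y \<in> Obj (T b) \<Longrightarrow> ob (L n) (ob (UT a b) (x, y)) = ob (U a b) (ob (L a) x, ob (L b) y)"
    and "f \<in> Arr (T a) \<Longrightarrow> g \<in> Arr (T b) \<Longrightarrow> ar (L n) (ar (UT a b) (f, g)) = ar (U a b) (ar (L a) f, ar (L b) g)"
proof -
  have "\<forall>(a, b)\<in>pairs n. func_eq (T a \<times>\<^sub>C T b) (L n \<circ>\<^sub>F UT a b) (U a b \<circ>\<^sub>F (L a \<times>\<^sub>F L b))"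
    using L pairs_ge_2[OF assms] unfolding induced_inclusion_def by blast
  from bspec[OF this assms]
  have "func_eq (T a \<times>\<^sub>C T b) (L n \<circ>\<^sub>F UT a b) (U a b \<circ>\<^sub>F (L a \<times>\<^sub>F L b))"
    by simp
  then show "x \<in> Obj (T a) \<Longrightarrow> y \<in> Obj (T b) \<Longrightarrow> ob (L n) (ob (UT a b) (x, y)) = ob (U a b) (ob (L a) x, ob (L b) y)"
    and "f \<in> Arr (T a) \<Longrightarrow> g \<in> Arr (T b) \<Longrightarrow> ar (L n) (ar (UT a b) (f, g)) = ar (U a b) (ar (L a) f, ar (L b) g)"
    by (simp_all add: func_eq_def)
qed

lemma L_V:
  assumes "(i, j, k) \<in> triples1 n" "f \<in> Arr (T i)" "g \<in> Arr (T j)" "h \<in> Arr (T k)"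
  shows "ar (L n) (ar (VT i j k) (f, g, h, \<iota>)) = ar (V i j k) (ar (L i) f, ar (L j) g, ar (L k) h, \<iota>)"
proof -
  have "2 \<le> n"
    using assms(1) by simp
  then have "\<forall>(i, j, k)\<in>triples1 n. func_eq (T i \<times>\<^sub>C T j \<times>\<^sub>C T k \<times>\<^sub>C Icat) (L n \<circ>\<^sub>F VT i j k)
      (V i j k \<circ>\<^sub>F (L i \<times>\<^sub>F L j \<times>\<^sub>F L k \<times>\<^sub>F func_id))"
    using L unfolding induced_inclusion_def by blast
  from bspec[OF this assms(1)]
  have "func_eq (T i \<times>\<^sub>C T j \<times>\<^sub>C T k \<times>\<^sub>C Icat) (L n \<circ>\<^sub>F VT i j k)
      (V i j k \<circ>\<^sub>F (L i \<times>\<^sub>F L j \<times>\<^sub>F L k \<times>\<^sub>F func_id))"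
    by simp
  then show ?thesis
    using assms by (simp add: func_eq_def func_id_def)
qed

text \<open>Every object is a nested \<open>U\<close> of objects of \<open>A 1\<close>, and
  \<open>L\<close> commutes with \<open>U\<close>.\<close>

lemma L_surj:
  assumes "x \<in> Obj (A n)" "1 \<le> n"
  obtains t where "t \<in> Obj (T n)" "x = ob (L n) t"
proof -
  have "x \<in> ob (L n) ` Obj (T n)"
    using assms
  proof (induction n arbitrary: x rule: less_induct)
    case (less n)
    show ?case
    proof (cases "n = 1")
      case True
      then show ?thesis
        using less.prems A.terminal T.terminal is_functorD(1)[OF L_functor[of 1]]
        by (auto simp: terminal_cat_def)
    next
      case False
      with less.prems have "2 \<le> n" by simp
      with less.prems(1) obtain a b y z where *: "(a, b) \<in> pairs n" "y \<in> Obj (A a)" "z \<in> Obj (A b)" "x = ob (U a b) (y, z)"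
        by (rule A.Obj_cases)
      then obtain y' z' where "y' \<in> Obj (T a)" "y = ob (L a) y'" "z' \<in> Obj (T b)" "z = ob (L b) z'"
        using less.IH[of a y] less.IH[of b z] by auto
      then show ?thesis
        using * L_U(1)[OF *(1)] T.U_simps(1)[OF *(1)] by (metis image_eqI)
    qed
  qed
  then show ?thesis
    using that by blast
qed

lemma P_pushout: "1 \<le> n \<Longrightarrow> is_pushout (T n) (indiscrete {()}) (A n) \<lparr>ob = (\<lambda>_. ()), ar = (\<lambda>_. ((), ()))\<rparr> (L n)
    (P n) (p n) (q n)"
  using collapse by (simp add: is_collapse_def)

lemma category_P: "1 \<le> n \<Longrightarrow> category (P n)"
  by (rule is_pushoutD(6)[OF P_pushout])

lemma q_functor: "1 \<le> n \<Longrightarrow> is_functor (A n) (P n) (q n)"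
  by (rule is_pushoutD(8)[OF P_pushout])

lemma p_arrow: "1 \<le> n \<Longrightarrow> ar (p n) f = Ident (P n) (ob (p n) ())"
  using is_functorD(5)[OF is_pushoutD(7)[OF P_pushout], of n "()"] by (cases f) simp

lemma q_L:
  assumes "1 \<le> n"
  shows "x \<in> Obj (T n) \<Longrightarrow> ob (q n) (ob (L n) x) = ob (p n) ()"
    and "f \<in> Arr (T n) \<Longrightarrow> ar (q n) (ar (L n) f) = Ident (P n) (ob (p n) ())"
  using is_pushoutD(9)[OF P_pushout[OF assms]] p_arrow[OF assms] by (simp_all add: func_eq_def)

text \<open>The point is the image of \<open>p\<close>, and since \<open>L n\<close> is surjective
  on objects, \<open>q n\<close> sends every object of \<open>A n\<close> to it.\<close>

lemma P_Obj: "1 \<le> n \<Longrightarrow> Obj (P n) = {ob (p n) ()}"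
proof -
  assume n: "1 \<le> n"
  have "ob (q n) x = ob (p n) ()" if x: "x \<in> Obj (A n)" for x
    using x n by (rule L_surj) (simp add: q_L(1)[OF n])
  then show ?thesis
    unfolding pushout_Obj[OF P_pushout[OF n]] by auto
qed

text \<open>Inverses come from \<open>A n\<close>, because the arrows are generated under
  composition by images of arrows of \<open>A n\<close> and identities.\<close>

lemma one_object_groupoid_P:
  assumes n: "1 \<le> n" shows "one_object_groupoid (P n)"
proof -
  interpret category "P n"
    using n by (rule category_P)
  have "\<exists>g. inverse_arrows (P n) f g" if "f \<in> Arr (P n)" for f
    using P_pushout[OF n] that
  proof (rule pushout_arrow_induct)
    show "\<exists>g. inverse_arrows (P n) (ar (p n) f) g" for f
      unfolding p_arrow[OF n] using inverse_arrows_Ident P_Obj[OF n] by blast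
    fix f assume "f \<in> Arr (A n)"
    then obtain g where "inverse_arrows (A n) f g"
      using A.groupoid_A[OF n] by (auto simp: groupoid_iff)
    then show "\<exists>g. inverse_arrows (P n) (ar (q n) f) g"
      using inverse_arrows_functor[OF q_functor A.category_A] n by blast
  qed (use inverse_arrows_Ident inverse_arrows_Comp in blast)+
  then show ?thesis
    unfolding one_object_groupoid_def groupoid_iff using P_Obj[OF n] category_axioms by blast
qed

definition M :: "nat \<Rightarrow> 'u monoid" where "M n = arrow_monoid (P n)"

lemma M_simps [simp]:
  "carrier (M n) = Arr (P n)" "f \<otimes>\<^bsub>M n\<^esub> g = Comp (P n) f g"
  by (simp_all add: M_def arrow_monoid_def)

lemma one_M: "1 \<le> n \<Longrightarrow> \<one>\<^bsub>M n\<^esub> = Ident (P n) (ob (p n) ())"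
  by (simp add: M_def arrow_monoid_def P_Obj)

lemma group_M: "1 \<le> n \<Longrightarrow> group (M n)"
  unfolding M_def by (rule group_arrow_monoid[OF one_object_groupoid_P])

declare M_simps(2) [simp del]

abbreviation cls :: "nat \<Rightarrow> 'u \<Rightarrow> 'u" where "cls n \<equiv> ar (q n)"

lemma group_functor_cls: "1 \<le> n \<Longrightarrow> group_functor (A n) (M n) (cls n)"
  by (auto intro!: group_functorI simp: is_functorD[OF q_functor] M_simps(2))

lemma cls_L: "1 \<le> n \<Longrightarrow> t \<in> Arr (T n) \<Longrightarrow> cls n (ar (L n) t) = \<one>\<^bsub>M n\<^esub>"
  by (simp add: q_L one_M)

lemma cls_closed: "1 \<le> n \<Longrightarrow> f \<in> Arr (A n) \<Longrightarrow> cls n f \<in> carrier (M n)"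
  by (simp add: is_functorD[OF q_functor])

lemma cls_Ident: "1 \<le> n \<Longrightarrow> x \<in> Obj (A n) \<Longrightarrow> cls n (Ident (A n) x) = \<one>\<^bsub>M n\<^esub>"
  by (rule group_functor_Ident[OF group_functor_cls A.category_A group_M])

text \<open>With a single object all pairs of arrows are composable, so functoriality is
  multiplicativity everywhere.\<close>

lemma group_functor_M_hom:
  assumes "1 \<le> n" "group_functor (P n) H F" shows "F \<in> hom (M n) H"
proof (rule homI)
  interpret category "P n"
    using assms(1) by (rule category_P)
  show "F (x \<otimes>\<^bsub>M n\<^esub> y) = F x \<otimes>\<^bsub>H\<^esub> F y" if "x \<in> carrier (M n)" "y \<in> carrier (M n)" for x y
  proof -
    have "Cod (P n) x = Dom (P n) y"
      using that Cod_Obj[of x] Dom_Obj[of y] P_Obj[OF assms(1)] by simp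
    then show ?thesis
      using that by (simp add: M_simps(2) group_functorD(2)[OF assms(2)])
  qed
qed (use group_functorD(1)[OF assms(2)] in simp)

lemma M_universal:
  fixes e :: "'a \<Rightarrow> 'u" and H :: "('a, 'b) monoid_scheme"
  assumes n: "1 \<le> n" and H: "group H" and e: "inj_on e (carrier H)"
    and F: "group_functor (A n) H F" and FL: "\<And>t. t \<in> Arr (T n) \<Longrightarrow> F (ar (L n) t) = \<one>\<^bsub>H\<^esub>"
  obtains h where "h \<in> hom (M n) H" "\<And>f. f \<in> Arr (A n) \<Longrightarrow> h (cls n f) = F f"
proof -
  interpret H: group H by fact
  have one: "group_functor (indiscrete {()}) H (\<lambda>_. \<one>\<^bsub>H\<^esub>)"
    by (rule group_functorI) auto
  obtain h where h: "group_functor (P n) H h" "\<And>f. f \<in> Arr (A n) \<Longrightarrow> h (cls n f) = F f"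
    by (rule pushout_to_group[OF P_pushout[OF n] H e one F]) (use FL in auto)
  then show ?thesis
    using that group_functor_M_hom[OF n h(1)] by blast
qed

lemma M_hom_eqI:
  assumes n: "1 \<le> n" and H: "group H" and h: "h \<in> hom (M n) H" "h' \<in> hom (M n) H"
    and eq: "\<And>f. f \<in> Arr (A n) \<Longrightarrow> h (cls n f) = h' (cls n f)"
    and x: "x \<in> carrier (M n)"
  shows "h x = h' x"
proof -
  have g: "group_functor (P n) H h" if "h \<in> hom (M n) H" for h
    using hom_in_carrier[OF that] hom_mult[OF that] by (auto intro!: group_functorI simp: M_simps(2))
  have one: "h (ar (p n) f) = \<one>\<^bsub>H\<^esub>" if "h \<in> hom (M n) H" for h f
    using hom_one[OF that group_M[OF n] H] by (simp add: p_arrow[OF n] one_M[OF n])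
  show ?thesis
    by (rule pushout_group_functor_eqI[OF P_pushout[OF n] H g[OF h(1)] g[OF h(2)] _ eq])
      (use x one[OF h(1)] one[OF h(2)] in simp_all)
qed

section \<open>Classes in \<pi>(A_n): independence of objects, and the relations they
  satisfy\<close>

lemma cls_U_L:
  assumes "(a, b) \<in> pairs n" "s \<in> Arr (T a)" "t \<in> Arr (T b)"
  shows "cls n (ar (U a b) (ar (L a) s, ar (L b) t)) = \<one>\<^bsub>M n\<^esub>"
  unfolding L_U(2)[OF assms, symmetric] using assms T.U_simps(2)[OF assms(1)] by (intro cls_L) auto

text \<open>The two ways of traversing an arrow of a product one coordinate at a time. Their
  comparison is the source both of independence of objects and of the commutation of \<rho> with
  \<lambda>.\<close>

lemma cls_U_natural:
  assumes ab: "(a, b) \<in> pairs n" and f: "f \<in> Arr (A a)" and g: "g \<in> Arr (A b)"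
  shows "cls n (ar (U a b) (f, g)) =
      cls n (ar (U a b) (f, Ident (A b) (Dom (A b) g))) \<otimes>\<^bsub>M n\<^esub> cls n (ar (U a b) (Ident (A a) (Cod (A a) f), g))"
    and "cls n (ar (U a b) (f, g)) =
      cls n (ar (U a b) (Ident (A a) (Dom (A a) f), g)) \<otimes>\<^bsub>M n\<^esub> cls n (ar (U a b) (f, Ident (A b) (Cod (A b) g)))"
proof -
  interpret a: category "A a" + b: category "A b"
    using ab by (auto intro: A.category_A)
  have n: "1 \<le> n"
    using ab by simp
  note simps = a.Dom_Obj a.Cod_Obj b.Dom_Obj b.Cod_Obj a.Ident_Arr b.Ident_Arr a.Dom_Ident a.Cod_Ident
    b.Dom_Ident b.Cod_Ident a.Ident_left a.Ident_right b.Ident_left b.Ident_right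
  show "cls n (ar (U a b) (f, g)) =
      cls n (ar (U a b) (f, Ident (A b) (Dom (A b) g))) \<otimes>\<^bsub>M n\<^esub> cls n (ar (U a b) (Ident (A a) (Cod (A a) f), g))"
    using f g A.U_simps(6)[OF ab, of f "Ident (A b) (Dom (A b) g)" "Ident (A a) (Cod (A a) f)" g]
      group_functorD(2)[OF group_functor_cls[OF n], of "ar (U a b) (f, Ident (A b) (Dom (A b) g))"
        "ar (U a b) (Ident (A a) (Cod (A a) f), g)"] A.U_simps(2-4)[OF ab]
    by (simp add: simps)
  show "cls n (ar (U a b) (f, g)) =
      cls n (ar (U a b) (Ident (A a) (Dom (A a) f), g)) \<otimes>\<^bsub>M n\<^esub> cls n (ar (U a b) (f, Ident (A b) (Cod (A b) g)))"
    using f g A.U_simps(6)[OF ab, of "Ident (A a) (Dom (A a) f)" g f "Ident (A b) (Cod (A b) g)"]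
      group_functorD(2)[OF group_functor_cls[OF n], of "ar (U a b) (Ident (A a) (Dom (A a) f), g)"
        "ar (U a b) (f, Ident (A b) (Cod (A b) g))"] A.U_simps(2-4)[OF ab]
    by (simp add: simps)
qed

text \<open>Transfers connectedness of \<open>T n\<close> to the objects of \<open>A n\<close>, as
  \<open>L n\<close> is surjective on them. A quantity depending on an object is thus compared only
  along arrows coming from \<open>T n\<close>, whose classes are trivial.\<close>

lemma const_on_Obj:
  assumes n: "1 \<le> n" and \<kappa>: "\<And>t. t \<in> Arr (T n) \<Longrightarrow>
      \<kappa> (Dom (A n) (ar (L n) t)) = \<kappa> (Cod (A n) (ar (L n) t))"
    and x: "x \<in> Obj (A n)" and y: "y \<in> Obj (A n)"
  shows "\<kappa> x = \<kappa> y"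
proof -
  obtain x' y' where *: "x' \<in> Obj (T n)" "x = ob (L n) x'" "y' \<in> Obj (T n)" "y = ob (L n) y'"
    using L_surj[OF x n] L_surj[OF y n] by metis
  have "\<kappa> (ob (L n) x') = \<kappa> (ob (L n) y')"
    by (rule T.connected[OF refl n, where \<kappa> = "\<lambda>x. \<kappa> (ob (L n) x)"])
      (use * \<kappa> in \<open>simp_all add: is_functorD[OF L_functor[OF n]]\<close>)
  then show ?thesis
    using * by simp
qed

text \<open>Makes \<open>cls_U_L\<close> applicable when one argument is an identity. The clauses on
  domain and codomain let an object be held fixed in \<open>iota_arrow_indep\<close>.\<close>

lemma L_Ident:
  assumes "1 \<le> n" "x \<in> Obj (A n)"
  obtains t where "t \<in> Arr (T n)" "Ident (A n) x = ar (L n) t" "x = Dom (A n) (ar (L n) t)" "x = Cod (A n) (ar (L n) t)"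
proof -
  interpret T: category "T n"
    using assms(1) by (rule T.category_A)
  interpret A: category "A n"
    using assms(1) by (rule A.category_A)
  obtain x' where "x' \<in> Obj (T n)" "x = ob (L n) x'"
    using assms(2,1) by (rule L_surj)
  then show ?thesis
    using that[of "Ident (T n) x'"] is_functorD(5)[OF L_functor[OF assms(1)]] assms(2)
    by (simp add: T.Ident_Arr A.Dom_Ident A.Cod_Ident)
qed

text \<open>For an arrow \<open>t\<close> of the smaller tower both factorisations of
  \<open>U (L t, g)\<close> contain a trivial factor. What remains is the class at the codomain of
  \<open>L t\<close> on one side and at its domain on the other; the second coordinate is
  symmetric.\<close>

lemma cls_U_indep:
  assumes ab: "(a, b) \<in> pairs n"
  shows "x \<in> Obj (A a) \<Longrightarrow> x' \<in> Obj (A a) \<Longrightarrow> g \<in> Arr (A b) \<Longrightarrow>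
      cls n (ar (U a b) (Ident (A a) x, g)) = cls n (ar (U a b) (Ident (A a) x', g))"
    and "y \<in> Obj (A b) \<Longrightarrow> y' \<in> Obj (A b) \<Longrightarrow> f \<in> Arr (A a) \<Longrightarrow>
      cls n (ar (U a b) (f, Ident (A b) y)) = cls n (ar (U a b) (f, Ident (A b) y'))"
proof -
  interpret a: category "A a" + b: category "A b"
    using ab by (auto intro: A.category_A)
  have n: "1 \<le> a" "1 \<le> b" "1 \<le> n"
    using ab by simp_all
  interpret M: group "M n"
    by (rule group_M) fact
  have L: "ar (L m) t \<in> Arr (A m)" if "t \<in> Arr (T m)" "1 \<le> m" for t m
    using that by (simp add: is_functorD[OF L_functor])
  have U: "cls n (ar (U a b) (f, g)) \<in> carrier (M n)" if "f \<in> Arr (A a)" "g \<in> Arr (A b)" for f g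
    using that cls_closed[OF n(3)] A.U_simps(2)[OF ab] by simp
  show "cls n (ar (U a b) (Ident (A a) x, g)) = cls n (ar (U a b) (Ident (A a) x', g))"
    if "x \<in> Obj (A a)" "x' \<in> Obj (A a)" and g: "g \<in> Arr (A b)"
    using n(1) _ that(1,2)
  proof (rule const_on_Obj)
    fix t assume t: "t \<in> Arr (T a)"
    have one: "cls n (ar (U a b) (ar (L a) t, Ident (A b) y)) = \<one>\<^bsub>M n\<^esub>" if "y \<in> Obj (A b)" for y
      using n(2) that by (rule L_Ident) (use t cls_U_L[OF ab] in simp)
    show "cls n (ar (U a b) (Ident (A a) (Dom (A a) (ar (L a) t)), g)) =
        cls n (ar (U a b) (Ident (A a) (Cod (A a) (ar (L a) t)), g))"
      using cls_U_natural[OF ab L[OF t n(1)] g] L[OF t n(1)] g one U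
      by (simp add: a.Dom_Obj a.Cod_Obj b.Dom_Obj b.Cod_Obj a.Ident_Arr)
  qed
  show "cls n (ar (U a b) (f, Ident (A b) y)) = cls n (ar (U a b) (f, Ident (A b) y'))"
    if "y \<in> Obj (A b)" "y' \<in> Obj (A b)" and f: "f \<in> Arr (A a)"
    using n(2) _ that(1,2)
  proof (rule const_on_Obj)
    fix t assume t: "t \<in> Arr (T b)"
    have one: "cls n (ar (U a b) (Ident (A a) x, ar (L b) t)) = \<one>\<^bsub>M n\<^esub>" if "x \<in> Obj (A a)" for x
      using n(1) that by (rule L_Ident) (use t cls_U_L[OF ab] in simp)
    show "cls n (ar (U a b) (f, Ident (A b) (Dom (A b) (ar (L b) t)))) =
        cls n (ar (U a b) (f, Ident (A b) (Cod (A b) (ar (L b) t))))"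
      using cls_U_natural[OF ab f L[OF t n(2)]] L[OF t n(2)] f one U
      by (simp add: a.Dom_Obj a.Cod_Obj b.Dom_Obj b.Cod_Obj b.Ident_Arr)
  qed
qed

text \<open>
  \<open>la n b\<close> is \<open>\<lambda>\<^sup>a\<close> and \<open>rh n a\<close> is \<open>\<rho>\<^sup>b\<close> as a map into \<open>\<pi>(A\<^sub>n)\<close>, where \<open>a + b = n\<close>: the second argument
  names the source.
\<close>

definition la :: "nat \<Rightarrow> nat \<Rightarrow> 'u \<Rightarrow> 'u" where
  "la n b = (SOME h. h \<in> hom (M b) (M n) \<and> (\<forall>x\<in>Obj (A (n - b)). \<forall>\<phi>\<in>Arr (A b).
    h (cls b \<phi>) = cls n (ar (U (n - b) b) (Ident (A (n - b)) x, \<phi>))))"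

definition rh :: "nat \<Rightarrow> nat \<Rightarrow> 'u \<Rightarrow> 'u" where
  "rh n a = (SOME h. h \<in> hom (M a) (M n) \<and> (\<forall>x\<in>Obj (A (n - a)). \<forall>\<phi>\<in>Arr (A a).
    h (cls a \<phi>) = cls n (ar (U a (n - a)) (\<phi>, Ident (A (n - a)) x))))"

text \<open>The functor \<open>U a b\<close> with an identity in the first place has trivial class
  on the image of \<open>T b\<close>, so it descends to \<open>M b\<close>. Independence of the
  chosen object makes \<open>la_cls\<close> hold for every \<open>x\<close>.\<close>

lemma
  assumes ab: "(a, b) \<in> pairs n"
  shows la_hom: "la n b \<in> hom (M b) (M n)"
    and la_cls: "x \<in> Obj (A a) \<Longrightarrow> \<phi> \<in> Arr (A b) \<Longrightarrow> la n b (cls b \<phi>) = cls n (ar (U a b) (Ident (A a) x, \<phi>))"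
proof -
  have n: "1 \<le> a" "1 \<le> b" "1 \<le> n" "n - b = a"
    using ab by auto
  interpret a: category "A a" + b: category "A b"
    using n by (auto intro: A.category_A)
  obtain x where x: "x \<in> Obj (A a)"
    using A.nonempty[OF n(1)] by auto
  have F: "group_functor (A b) (M n) (\<lambda>\<phi>. cls n (ar (U a b) (Ident (A a) x, \<phi>)))"
  proof (rule group_functorI)
    show "cls n (ar (U a b) (Ident (A a) x, f)) \<in> carrier (M n)" if "f \<in> Arr (A b)" for f
      using that x n by (intro cls_closed) (simp_all add: A.U_simps[OF ab] a.Ident_Arr)
    show "cls n (ar (U a b) (Ident (A a) x, Comp (A b) f g)) =
        cls n (ar (U a b) (Ident (A a) x, f)) \<otimes>\<^bsub>M n\<^esub> cls n (ar (U a b) (Ident (A a) x, g))"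
      if "f \<in> Arr (A b)" "g \<in> Arr (A b)" "Cod (A b) f = Dom (A b) g" for f g
      using that x A.U_simps(6)[OF ab, of "Ident (A a) x" f "Ident (A a) x" g] a.Ident_left[of "Ident (A a) x"]
      by (simp add: a.Ident_Arr a.Dom_Ident a.Cod_Ident A.U_simps(1-5)[OF ab] group_functorD(2)[OF group_functor_cls[OF n(3)]])
  qed
  have one: "cls n (ar (U a b) (Ident (A a) x, ar (L b) t)) = \<one>\<^bsub>M n\<^esub>" if "t \<in> Arr (T b)" for t
    using n(1) x by (rule L_Ident) (use that cls_U_L[OF ab] in simp)
  \<comment> \<open>The target has its elements in \<open>'u\<close> already, so the identity serves
    as the embedding.\<close>
  obtain h where h: "h \<in> hom (M b) (M n)"
      "\<And>\<phi>. \<phi> \<in> Arr (A b) \<Longrightarrow> h (cls b \<phi>) = cls n (ar (U a b) (Ident (A a) x, \<phi>))"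
    by (rule M_universal[OF n(2) group_M[OF n(3)] inj_on_id F]) (use one in auto)
  have "\<exists>h. h \<in> hom (M b) (M n) \<and> (\<forall>x\<in>Obj (A (n - b)). \<forall>\<phi>\<in>Arr (A b).
      h (cls b \<phi>) = cls n (ar (U (n - b) b) (Ident (A (n - b)) x, \<phi>)))"
    using h cls_U_indep(1)[OF ab x] unfolding n(4) by (intro exI[of _ h]) simp
  from someI_ex[OF this, folded la_def]
  show "la n b \<in> hom (M b) (M n)"
    and "x \<in> Obj (A a) \<Longrightarrow> \<phi> \<in> Arr (A b) \<Longrightarrow> la n b (cls b \<phi>) = cls n (ar (U a b) (Ident (A a) x, \<phi>))" for x \<phi>
    unfolding n(4) by blast+
qed

lemma
  assumes ab: "(a, b) \<in> pairs n"
  shows rh_hom: "rh n a \<in> hom (M a) (M n)"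
    and rh_cls: "x \<in> Obj (A b) \<Longrightarrow> \<phi> \<in> Arr (A a) \<Longrightarrow> rh n a (cls a \<phi>) = cls n (ar (U a b) (\<phi>, Ident (A b) x))"
proof -
  have n: "1 \<le> a" "1 \<le> b" "1 \<le> n" "n - a = b"
    using ab by auto
  interpret a: category "A a" + b: category "A b"
    using n by (auto intro: A.category_A)
  obtain x where x: "x \<in> Obj (A b)"
    using A.nonempty[OF n(2)] by auto
  have F: "group_functor (A a) (M n) (\<lambda>\<phi>. cls n (ar (U a b) (\<phi>, Ident (A b) x)))"
  proof (rule group_functorI)
    show "cls n (ar (U a b) (f, Ident (A b) x)) \<in> carrier (M n)" if "f \<in> Arr (A a)" for f
      using that x n by (intro cls_closed) (simp_all add: A.U_simps[OF ab] b.Ident_Arr)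
    show "cls n (ar (U a b) (Comp (A a) f g, Ident (A b) x)) =
        cls n (ar (U a b) (f, Ident (A b) x)) \<otimes>\<^bsub>M n\<^esub> cls n (ar (U a b) (g, Ident (A b) x))"
      if "f \<in> Arr (A a)" "g \<in> Arr (A a)" "Cod (A a) f = Dom (A a) g" for f g
      using that x A.U_simps(6)[OF ab, of f "Ident (A b) x" g "Ident (A b) x"] b.Ident_left[of "Ident (A b) x"]
      by (simp add: b.Ident_Arr b.Dom_Ident b.Cod_Ident A.U_simps(1-5)[OF ab] group_functorD(2)[OF group_functor_cls[OF n(3)]])
  qed
  have one: "cls n (ar (U a b) (ar (L a) t, Ident (A b) x)) = \<one>\<^bsub>M n\<^esub>" if "t \<in> Arr (T a)" for t
    using n(2) x by (rule L_Ident) (use that cls_U_L[OF ab] in simp)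
  obtain h where h: "h \<in> hom (M a) (M n)"
      "\<And>\<phi>. \<phi> \<in> Arr (A a) \<Longrightarrow> h (cls a \<phi>) = cls n (ar (U a b) (\<phi>, Ident (A b) x))"
    by (rule M_universal[OF n(1) group_M[OF n(3)] inj_on_id F]) (use one in auto)
  have "\<exists>h. h \<in> hom (M a) (M n) \<and> (\<forall>x\<in>Obj (A (n - a)). \<forall>\<phi>\<in>Arr (A a).
      h (cls a \<phi>) = cls n (ar (U a (n - a)) (\<phi>, Ident (A (n - a)) x)))"
    using h cls_U_indep(2)[OF ab x] unfolding n(4) by (intro exI[of _ h]) simp
  from someI_ex[OF this, folded rh_def]
  show "rh n a \<in> hom (M a) (M n)"
    and "x \<in> Obj (A b) \<Longrightarrow> \<phi> \<in> Arr (A a) \<Longrightarrow> rh n a (cls a \<phi>) = cls n (ar (U a b) (\<phi>, Ident (A b) x))" for x \<phi>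
    unfolding n(4) by blast+
qed

text \<open>Either coordinate can be traversed first, hence the two orders; their equality is
  relation 4.\<close>

lemma cls_U:
  assumes ab: "(a, b) \<in> pairs n" and f: "f \<in> Arr (A a)" and g: "g \<in> Arr (A b)"
  shows "cls n (ar (U a b) (f, g)) = rh n a (cls a f) \<otimes>\<^bsub>M n\<^esub> la n b (cls b g)"
    and "cls n (ar (U a b) (f, g)) = la n b (cls b g) \<otimes>\<^bsub>M n\<^esub> rh n a (cls a f)"
proof -
  interpret a: category "A a" + b: category "A b"
    using ab by (auto intro: A.category_A)
  show "cls n (ar (U a b) (f, g)) = rh n a (cls a f) \<otimes>\<^bsub>M n\<^esub> la n b (cls b g)"
    using cls_U_natural(1)[OF assms] rh_cls[OF ab b.Dom_Obj[OF g] f] la_cls[OF ab a.Cod_Obj[OF f] g] by simp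
  show "cls n (ar (U a b) (f, g)) = la n b (cls b g) \<otimes>\<^bsub>M n\<^esub> rh n a (cls a f)"
    using cls_U_natural(2)[OF assms] rh_cls[OF ab b.Cod_Obj[OF g] f] la_cls[OF ab a.Dom_Obj[OF f] g] by simp
qed

abbreviation iota_arrow :: "nat \<Rightarrow> nat \<Rightarrow> nat \<Rightarrow> 'u \<Rightarrow> 'u \<Rightarrow> 'u \<Rightarrow> 'u" where
  "iota_arrow i j k x y z \<equiv> ar (V i j k) (Ident (A i) x, Ident (A j) y, Ident (A k) z, \<iota>)"

lemma iota_arrow_Arr:
  assumes "(i, j, k) \<in> triples n" "x \<in> Obj (A i)" "y \<in> Obj (A j)" "z \<in> Obj (A k)"
  shows "iota_arrow i j k x y z \<in> Arr (A n)"
proof -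
  interpret i: category "A i" + j: category "A j" + k: category "A k"
    using assms(1) by (auto intro: A.category_A)
  show ?thesis
    using assms A.V_simps(1)[OF assms(1)] by (simp add: i.Ident_Arr j.Ident_Arr k.Ident_Arr)
qed

text \<open>The arrow \<open>V i j k (f, g, h, \<iota>)\<close> is traversed once with \<iota> last
  and once with \<iota> first. Relations 1(a) to 1(c) are special cases.\<close>

lemma cls_V_natural:
  assumes J: "(i, j, k) \<in> triples n" and f: "f \<in> Arr (A i)" and g: "g \<in> Arr (A j)" and h: "h \<in> Arr (A k)"
  shows "cls n (ar (U i (j + k)) (f, ar (U j k) (g, h))) \<otimes>\<^bsub>M n\<^esub>
      cls n (iota_arrow i j k (Cod (A i) f) (Cod (A j) g) (Cod (A k) h)) =
    cls n (iota_arrow i j k (Dom (A i) f) (Dom (A j) g) (Dom (A k) h)) \<otimes>\<^bsub>M n\<^esub>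
      cls n (ar (U (i + j) k) (ar (U i j) (f, g), h))"
proof -
  interpret i: category "A i" + j: category "A j" + k: category "A k"
    using J by (auto intro: A.category_A)
  have n: "1 \<le> n"
    using J by simp
  have cls: "cls n (Comp (A n) F G) = cls n F \<otimes>\<^bsub>M n\<^esub> cls n G"
    if "F \<in> Arr (A n)" "G \<in> Arr (A n)" "Cod (A n) F = Dom (A n) G" for F G
    using that by (rule group_functorD(2)[OF group_functor_cls[OF n]])
  note simps = iota_arrow_Arr[OF J] i.Cod_Obj j.Cod_Obj k.Cod_Obj i.Dom_Obj j.Dom_Obj k.Dom_Obj
    i.Ident_Arr j.Ident_Arr k.Ident_Arr i.Dom_Ident j.Dom_Ident k.Dom_Ident i.Cod_Ident j.Cod_Ident k.Cod_Ident
  let ?v = "ar (V i j k) (f, g, h, \<iota>)"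
  have "cls n ?v = cls n (ar (V i j k) (f, g, h, 0, 0)) \<otimes>\<^bsub>M n\<^esub>
      cls n (iota_arrow i j k (Cod (A i) f) (Cod (A j) g) (Cod (A k) h))"
    unfolding A.V_decompose(1)[OF J f g h insertI1 insertI2[OF singletonI]]
    by (rule cls) (use f g h A.V_simps[OF J] in \<open>simp_all add: simps\<close>)
  moreover have "cls n ?v = cls n (iota_arrow i j k (Dom (A i) f) (Dom (A j) g) (Dom (A k) h)) \<otimes>\<^bsub>M n\<^esub>
      cls n (ar (V i j k) (f, g, h, 1, 1))"
    unfolding A.V_decompose(2)[OF J f g h insertI1 insertI2[OF singletonI]]
    by (rule cls) (use f g h A.V_simps[OF J] in \<open>simp_all add: simps\<close>)
  ultimately show ?thesis
    using A.square(3,4)[OF J f g h] by simp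
qed

text \<open>Naturality at arrows from the smaller tower: both \<open>U\<close> factors are trivial
  there, which leaves equality of the classes of \<iota> at the domains and at the codomains. The
  three objects are then exchanged one by one, the others held fixed by identities seen as images of
  \<open>L\<close>.\<close>

lemma iota_arrow_indep:
  assumes J: "(i, j, k) \<in> triples n" and x: "x \<in> Obj (A i)" "x' \<in> Obj (A i)"
    and y: "y \<in> Obj (A j)" "y' \<in> Obj (A j)" and z: "z \<in> Obj (A k)" "z' \<in> Obj (A k)"
  shows "cls n (iota_arrow i j k x y z) = cls n (iota_arrow i j k x' y' z')"
proof -
  note t = triples_pairs[OF J]
  have n: "1 \<le> i" "1 \<le> j" "1 \<le> k" "1 \<le> n"
    using J by simp_all
  interpret i: category "A i" + j: category "A j" + k: category "A k"
    using n by (auto intro: A.category_A)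
  interpret M: group "M n"
    by (rule group_M) fact
  have L: "ar (L m) t \<in> Arr (A m)" if "t \<in> Arr (T m)" "1 \<le> m" for t m
    using that by (simp add: is_functorD[OF L_functor])
  have step: "cls n (iota_arrow i j k (Dom (A i) (ar (L i) r)) (Dom (A j) (ar (L j) s)) (Dom (A k) (ar (L k) u))) =
      cls n (iota_arrow i j k (Cod (A i) (ar (L i) r)) (Cod (A j) (ar (L j) s)) (Cod (A k) (ar (L k) u)))"
    if a: "r \<in> Arr (T i)" "s \<in> Arr (T j)" "u \<in> Arr (T k)" for r s u
  proof -
    note Lr = L[OF a(1) n(1)] and Ls = L[OF a(2) n(2)] and Lu = L[OF a(3) n(3)]
    have "cls n (ar (U i (j + k)) (ar (L i) r, ar (U j k) (ar (L j) s, ar (L k) u))) = \<one>\<^bsub>M n\<^esub>"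
      "cls n (ar (U (i + j) k) (ar (U i j) (ar (L i) r, ar (L j) s), ar (L k) u)) = \<one>\<^bsub>M n\<^esub>"
      unfolding L_U(2)[OF t(2) a(2,3), symmetric] L_U(2)[OF t(4) a(1,2), symmetric]
      using cls_U_L[OF t(1) a(1)] cls_U_L[OF t(3) _ a(3)] T.U_simps(2)[OF t(2) a(2,3)] T.U_simps(2)[OF t(4) a(1,2)]
      by simp_all
    moreover have "cls n (iota_arrow i j k x y z) \<in> carrier (M n)"
      if "x \<in> Obj (A i)" "y \<in> Obj (A j)" "z \<in> Obj (A k)" for x y z
      using iota_arrow_Arr[OF J that] n(4) by (intro cls_closed)
    ultimately show ?thesis
      using cls_V_natural[OF J Lr Ls Lu] Lr Ls Lu
      by (simp add: i.Dom_Obj j.Dom_Obj k.Dom_Obj i.Cod_Obj j.Cod_Obj k.Cod_Obj del: M_simps)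
  qed
  have "cls n (iota_arrow i j k x y z) = cls n (iota_arrow i j k x' y z)"
    using n(1) _ x
  proof (rule const_on_Obj)
    fix t assume "t \<in> Arr (T i)"
    obtain s where s: "s \<in> Arr (T j)" "y = Dom (A j) (ar (L j) s)" "y = Cod (A j) (ar (L j) s)"
      using L_Ident[OF n(2) y(1)] by metis
    obtain u where u: "u \<in> Arr (T k)" "z = Dom (A k) (ar (L k) u)" "z = Cod (A k) (ar (L k) u)"
      using L_Ident[OF n(3) z(1)] by metis
    show "cls n (iota_arrow i j k (Dom (A i) (ar (L i) t)) y z) = cls n (iota_arrow i j k (Cod (A i) (ar (L i) t)) y z)"
      using step[OF \<open>t \<in> Arr (T i)\<close> s(1) u(1)] unfolding s(2,3)[symmetric] u(2,3)[symmetric] .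
  qed
  also have "\<dots> = cls n (iota_arrow i j k x' y' z)"
    using n(2) _ y
  proof (rule const_on_Obj)
    fix t assume "t \<in> Arr (T j)"
    obtain r where r: "r \<in> Arr (T i)" "x' = Dom (A i) (ar (L i) r)" "x' = Cod (A i) (ar (L i) r)"
      using L_Ident[OF n(1) x(2)] by metis
    obtain u where u: "u \<in> Arr (T k)" "z = Dom (A k) (ar (L k) u)" "z = Cod (A k) (ar (L k) u)"
      using L_Ident[OF n(3) z(1)] by metis
    show "cls n (iota_arrow i j k x' (Dom (A j) (ar (L j) t)) z) = cls n (iota_arrow i j k x' (Cod (A j) (ar (L j) t)) z)"
      using step[OF r(1) \<open>t \<in> Arr (T j)\<close> u(1)] unfolding r(2,3)[symmetric] u(2,3)[symmetric] .
  qed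
  also have "\<dots> = cls n (iota_arrow i j k x' y' z')"
    using n(3) _ z
  proof (rule const_on_Obj)
    fix t assume "t \<in> Arr (T k)"
    obtain r where r: "r \<in> Arr (T i)" "x' = Dom (A i) (ar (L i) r)" "x' = Cod (A i) (ar (L i) r)"
      using L_Ident[OF n(1) x(2)] by metis
    obtain s where s: "s \<in> Arr (T j)" "y' = Dom (A j) (ar (L j) s)" "y' = Cod (A j) (ar (L j) s)"
      using L_Ident[OF n(2) y(2)] by metis
    show "cls n (iota_arrow i j k x' y' (Dom (A k) (ar (L k) t))) = cls n (iota_arrow i j k x' y' (Cod (A k) (ar (L k) t)))"
      using step[OF r(1) s(1) \<open>t \<in> Arr (T k)\<close>] unfolding r(2,3)[symmetric] s(2,3)[symmetric] .
  qed
  finally show ?thesis .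
qed

text \<open>The choice of objects is immaterial by \<open>iota_arrow_indep\<close>, and the sum of
  the indices determines the level.\<close>

definition v :: "nat \<Rightarrow> nat \<Rightarrow> nat \<Rightarrow> 'u" where
  "v i j k = cls (i + j + k)
    (iota_arrow i j k (SOME x. x \<in> Obj (A i)) (SOME x. x \<in> Obj (A j)) (SOME x. x \<in> Obj (A k)))"

lemma cls_iota_arrow:
  assumes "(i, j, k) \<in> triples n" "x \<in> Obj (A i)" "y \<in> Obj (A j)" "z \<in> Obj (A k)"
  shows "cls n (iota_arrow i j k x y z) = v i j k"
proof -
  have "(SOME x. x \<in> Obj (A m)) \<in> Obj (A m)" if "1 \<le> m" for m
    using A.nonempty[OF that] by (simp add: some_in_eq)
  moreover have "1 \<le> i" "1 \<le> j" "1 \<le> k" and n: "i + j + k = n"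
    using assms(1) by simp_all
  ultimately show ?thesis
    unfolding v_def n by (intro iota_arrow_indep[OF assms(1)] assms(2-))
qed

text \<open>For middle index 1 the arrow already comes from \<open>T n\<close>, which is
  collapsed.\<close>

lemma v_one:
  assumes "(i, 1, k) \<in> triples n" shows "v i 1 k = \<one>\<^bsub>M n\<^esub>"
proof -
  have n: "1 \<le> i" "1 \<le> (1 :: nat)" "1 \<le> k" "1 \<le> n" and J: "(i, 1, k) \<in> triples1 n"
    using assms by simp_all
  interpret T1: category "T i" + T2: category "T 1" + T3: category "T k"
    using n by (auto intro: T.category_A)
  obtain x y z where o: "x \<in> Obj (T i)" "y \<in> Obj (T 1)" "z \<in> Obj (T k)"
    using T.nonempty n by (metis ex_in_conv)
  have "ar (VT i 1 k) (Ident (T i) x, Ident (T 1) y, Ident (T k) z, \<iota>) \<in> Arr (T n)"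
    using T.V_simps(1)[OF J] o by (simp del: One_nat_def add: T1.Ident_Arr T2.Ident_Arr T3.Ident_Arr)
  from cls_L[OF n(4) this]
  have "cls n (iota_arrow i 1 k (ob (L i) x) (ob (L 1) y) (ob (L k) z)) = \<one>\<^bsub>M n\<^esub>"
    using L_V[OF J T1.Ident_Arr[OF o(1)] T2.Ident_Arr[OF o(2)] T3.Ident_Arr[OF o(3)]] o
      is_functorD(5)[OF L_functor[OF n(1)]] is_functorD(5)[OF L_functor[OF n(2)]] is_functorD(5)[OF L_functor[OF n(3)]]
    by (simp del: One_nat_def)
  then show ?thesis
    using cls_iota_arrow[OF assms] o is_functorD(1)[OF L_functor] n by metis
qed

text \<open>Naturality of \<iota> with identities in two of the three places. Writing conjugation as
  an intertwining equation avoids inverses.\<close>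

lemma conj_relations:
  assumes J: "(i, j, k) \<in> triples n" and f: "f \<in> Arr (A i)" and g: "g \<in> Arr (A j)" and h: "h \<in> Arr (A k)"
  shows "v i j k \<otimes>\<^bsub>M n\<^esub> rh n (i + j) (rh (i + j) i (cls i f)) = rh n i (cls i f) \<otimes>\<^bsub>M n\<^esub> v i j k"
    and "v i j k \<otimes>\<^bsub>M n\<^esub> rh n (i + j) (la (i + j) j (cls j g)) = la n (j + k) (rh (j + k) j (cls j g)) \<otimes>\<^bsub>M n\<^esub> v i j k"
    and "v i j k \<otimes>\<^bsub>M n\<^esub> la n k (cls k h) = la n (j + k) (la (j + k) k (cls k h)) \<otimes>\<^bsub>M n\<^esub> v i j k"
proof -
  note t = triples_pairs[OF J]
  have n: "1 \<le> i" "1 \<le> j" "1 \<le> k" "1 \<le> n"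
    using J by simp_all
  interpret i: category "A i" + j: category "A j" + k: category "A k"
    using n by (auto intro: A.category_A)
  obtain x y z where o: "x \<in> Obj (A i)" "y \<in> Obj (A j)" "z \<in> Obj (A k)"
    using A.nonempty n by (metis ex_in_conv)
  note simps = cls_iota_arrow[OF J] i.Dom_Obj j.Dom_Obj k.Dom_Obj i.Cod_Obj j.Cod_Obj k.Cod_Obj
    i.Dom_Ident j.Dom_Ident k.Dom_Ident i.Cod_Ident j.Cod_Ident k.Cod_Ident
  note IA = i.Ident_Arr[OF o(1)] j.Ident_Arr[OF o(2)] k.Ident_Arr[OF o(3)]
  have "cls n (ar (U i (j + k)) (f, ar (U j k) (Ident (A j) y, Ident (A k) z))) = rh n i (cls i f)"
    "cls n (ar (U (i + j) k) (ar (U i j) (f, Ident (A j) y), Ident (A k) z)) = rh n (i + j) (rh (i + j) i (cls i f))"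
    using rh_cls[OF t(1) A.U_simps(1)[OF t(2) o(2,3)] f] A.U_simps(5)[OF t(2) o(2,3)]
      rh_cls[OF t(3) o(3) A.U_simps(2)[OF t(4) f IA(2)]] rh_cls[OF t(4) o(2) f] by simp_all
  then show "v i j k \<otimes>\<^bsub>M n\<^esub> rh n (i + j) (rh (i + j) i (cls i f)) = rh n i (cls i f) \<otimes>\<^bsub>M n\<^esub> v i j k"
    using cls_V_natural[OF J f IA(2,3)] f o by (simp del: One_nat_def add: simps)
  have "cls n (ar (U i (j + k)) (Ident (A i) x, ar (U j k) (g, Ident (A k) z))) = la n (j + k) (rh (j + k) j (cls j g))"
    "cls n (ar (U (i + j) k) (ar (U i j) (Ident (A i) x, g), Ident (A k) z)) = rh n (i + j) (la (i + j) j (cls j g))"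
    using la_cls[OF t(1) o(1) A.U_simps(2)[OF t(2) g IA(3)]] rh_cls[OF t(2) o(3) g]
      rh_cls[OF t(3) o(3) A.U_simps(2)[OF t(4) IA(1) g]] la_cls[OF t(4) o(1) g] by simp_all
  then show "v i j k \<otimes>\<^bsub>M n\<^esub> rh n (i + j) (la (i + j) j (cls j g)) = la n (j + k) (rh (j + k) j (cls j g)) \<otimes>\<^bsub>M n\<^esub> v i j k"
    using cls_V_natural[OF J IA(1) g IA(3)] g o by (simp del: One_nat_def add: simps)
  have "cls n (ar (U i (j + k)) (Ident (A i) x, ar (U j k) (Ident (A j) y, h))) = la n (j + k) (la (j + k) k (cls k h))"
    "cls n (ar (U (i + j) k) (ar (U i j) (Ident (A i) x, Ident (A j) y), h)) = la n k (cls k h)"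
    using la_cls[OF t(1) o(1) A.U_simps(2)[OF t(2) IA(2) h]] la_cls[OF t(2) o(2) h]
      la_cls[OF t(3) A.U_simps(1)[OF t(4) o(1,2)] h] A.U_simps(5)[OF t(4) o(1,2)] by simp_all
  then show "v i j k \<otimes>\<^bsub>M n\<^esub> la n k (cls k h) = la n (j + k) (la (j + k) k (cls k h)) \<otimes>\<^bsub>M n\<^esub> v i j k"
    using cls_V_natural[OF J IA(1,2) h] h o by (simp del: One_nat_def add: simps)
qed

end


section \<open>Generators and relators\<close>

instance side :: countable
  by countable_datatype

instance gen :: countable
  by countable_datatype

lemma gens_rec:
  assumes "2 \<le> n"
  shows "gens n = (\<Union>i\<in>{1..n-1}. pre (lam i) ` gens (n - i) \<union> pre (rho (n - i)) ` gens i)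
     \<union> {Gen [] i j k | i j k. (i, j, k) \<in> triples n}"
  by (subst gens.simps) (rule if_not_P, use assms in simp)

lemma gens_ge_2: "y \<in> gens n \<Longrightarrow> 2 \<le> n"
  by (subst (asm) gens.simps) (simp split: if_splits)

text \<open>Blocks of one letter already produce every symbol, so the inductive definition reduces
  to a count of length and indices.\<close>

lemma gens_eq:
  "gens n = {Gen X i j k | X i j k. 1 \<le> i \<and> 1 \<le> j \<and> 1 \<le> k \<and> length X + i + j + k = n}"
proof (induction n rule: less_induct)
  case (less n)
  show ?case
  proof (intro equalityI subsetI)
    fix y assume y: "y \<in> gens n"
    then have n: "2 \<le> n"
      by (rule gens_ge_2)
    from y consider (A) "y \<in> (\<Union>i\<in>{1..n-1}. pre (lam i) ` gens (n - i) \<union> pre (rho (n - i)) ` gens i)"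
      | (B) "y \<in> {Gen [] i j k | i j k. (i, j, k) \<in> triples n}"
      unfolding gens_rec[OF n] by (elim UnE)
    then show "y \<in> {Gen X i j k | X i j k. 1 \<le> i \<and> 1 \<le> j \<and> 1 \<le> k \<and> length X + i + j + k = n}"
    proof cases
      case A
      then obtain i where i: "i \<in> {1..n - 1}" "y \<in> pre (lam i) ` gens (n - i) \<union> pre (rho (n - i)) ` gens i"
        by blast
      from i(2) show ?thesis
      proof
        assume "y \<in> pre (lam i) ` gens (n - i)"
        moreover have "n - i < n"
          using i(1) by auto
        ultimately show ?thesis
          using i(1) less.IH[of "n - i"] by auto
      next
        assume "y \<in> pre (rho (n - i)) ` gens i"
        moreover have "i < n"
          using i(1) by auto
        ultimately show ?thesis
          using i(1) less.IH[of i] by auto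
      qed
    qed auto
  next
    fix y assume "y \<in> {Gen X i j k | X i j k. 1 \<le> i \<and> 1 \<le> j \<and> 1 \<le> k \<and> length X + i + j + k = n}"
    then obtain X i j k where y: "y = Gen X i j k" and ijk: "1 \<le> i" "1 \<le> j" "1 \<le> k" "length X + i + j + k = n"
      by blast
    then have n: "2 \<le> n" by simp
    show "y \<in> gens n"
    proof (cases X)
      case Nil
      then have "(i, j, k) \<in> triples n"
        using ijk by simp
      then show ?thesis
        unfolding gens_rec[OF n] y Nil by blast
    next
      case (Cons s Y)
      have "gens (n - 1) = {Gen X i j k | X i j k. 1 \<le> i \<and> 1 \<le> j \<and> 1 \<le> k \<and> length X + i + j + k = n - 1}"
        by (rule less.IH) (use n in simp)
      moreover have "length Y + i + j + k = n - 1"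
        using ijk Cons by simp
      ultimately have Y: "Gen Y i j k \<in> gens (n - 1)"
        using ijk by blast
      \<comment> \<open>A block of \<rho> has length \<open>n - i\<close>, so the one with a single
        letter is found at \<open>i = n - 1\<close>.\<close>
      have mem: "1 \<in> {1..n - 1}" "n - 1 \<in> {1..n - 1}" "n - (n - 1) = 1"
        using n by auto
      show ?thesis
      proof (cases s)
        case Lam
        then have "y = pre (lam 1) (Gen Y i j k)"
          using y Cons by simp
        then show ?thesis
          unfolding gens_rec[OF n] using Y mem(1) by blast
      next
        case Rho
        have "y = pre (rho (n - (n - 1))) (Gen Y i j k)"
          unfolding mem(3) using y Cons Rho by simp
        then show ?thesis
          unfolding gens_rec[OF n] using Y mem(2) by blast
      qed
    qed
  qed
qed

lemma Gen_in_gens [simp]: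
  "Gen X i j k \<in> gens n \<longleftrightarrow> 1 \<le> i \<and> 1 \<le> j \<and> 1 \<le> k \<and> length X + i + j + k = n"
  by (auto simp: gens_eq)

lemma pre_in_gens: "pre X y \<in> gens (length X + n) \<longleftrightarrow> y \<in> gens n"
  by (cases y) auto

lemma pre_lam_in_gens: "(a, b) \<in> pairs n \<Longrightarrow> pre (lam a) y \<in> gens n \<longleftrightarrow> y \<in> gens b"
  using pre_in_gens[of "lam a" y b] by auto

lemma pre_rho_in_gens: "(a, b) \<in> pairs n \<Longrightarrow> pre (rho b) y \<in> gens n \<longleftrightarrow> y \<in> gens a"
  using pre_in_gens[of "rho b" y a] by (auto simp: add.commute)

lemma pre_pre: "pre X (pre Y y) = pre (X @ Y) y"
  by (cases y) simp

text \<open>Peeling off a single letter matches the recursion of \<open>gam\<close>.\<close>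

lemma gen_cases:
  assumes "y \<in> gens n"
  obtains (base) i j k where "(i, j, k) \<in> triples n" "y = Gen [] i j k"
    | (lam) y' where "(1, n - 1) \<in> pairs n" "y' \<in> gens (n - 1)" "y = pre (lam 1) y'"
    | (rho) y' where "(n - 1, 1) \<in> pairs n" "y' \<in> gens (n - 1)" "y = pre (rho 1) y'"
proof -
  obtain X i j k where y: "y = Gen X i j k" "1 \<le> i" "1 \<le> j" "1 \<le> k" "length X + i + j + k = n"
    using assms by (auto simp: gens_eq)
  show ?thesis
  proof (cases X)
    case Nil
    then show ?thesis
      using base[of i j k] y by simp
  next
    case (Cons s Y)
    then show ?thesis
      using y lam[of "Gen Y i j k"] rho[of "Gen Y i j k"] by (cases s) auto
  qed
qed

text \<open>Relations 1 and 4 of \<open>rels\<close> get names here and below, so that membership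
  can be unfolded one family at a time.\<close>

definition conj_rels :: "nat \<Rightarrow> nat \<Rightarrow> nat \<Rightarrow> gen word set" where
  "conj_rels i j k =
     {relator (conj_word (Gen [] i j k) (pre (rho k) (pre (rho j) x))) (letter (pre (rho (j + k)) x)) | x. x \<in> gens i}
   \<union> {relator (conj_word (Gen [] i j k) (pre (rho k) (pre (lam i) y))) (letter (pre (lam i) (pre (rho k) y)))
       | y. y \<in> gens j}
   \<union> {relator (conj_word (Gen [] i j k) (pre (lam (i + j)) z)) (letter (pre (lam i) (pre (lam j) z))) | z. z \<in> gens k}"

definition comm_rels :: "nat \<Rightarrow> nat \<Rightarrow> gen word set" where
  "comm_rels a b = {relator (letter (pre (rho b) x) @ letter (pre (lam a) y)) (letter (pre (lam a) y) @ letter (pre (rho b) x))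
     | x y. x \<in> gens a \<and> y \<in> gens b}"

lemma rels_eq:
  assumes "2 \<le> n"
  shows "rels n = (\<Union>(i, j, k)\<in>triples n. conj_rels i j k)
     \<union> {relator (letter (Gen [] i j k)) [] | i j k. (i, j, k) \<in> triples1 n}
     \<union> (\<Union>i\<in>{1..n-1}. pre_word (lam i) ` rels (n - i) \<union> pre_word (rho (n - i)) ` rels i)
     \<union> (\<Union>i\<in>{1..n-1}. comm_rels i (n - i))"
  unfolding conj_rels_def comm_rels_def using assms
  by (subst rels.simps) (rule if_not_P, simp)

lemma rels_ge_2: "r \<in> rels n \<Longrightarrow> 2 \<le> n"
  by (subst (asm) rels.simps) (simp split: if_splits)

text \<open>This rule and \<open>relsI\<close> index by pairs (a, b) with a + b = n in place of
  \<open>i\<close> and \<open>n - i\<close>, which keeps subtraction out of the treatment of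
  relators.\<close>

lemma rels_cases:
  assumes "r \<in> rels n"
  obtains (conj_rho_rho) i j k x where "(i, j, k) \<in> triples n" "x \<in> gens i"
      "r = relator (conj_word (Gen [] i j k) (pre (rho k) (pre (rho j) x))) (letter (pre (rho (j + k)) x))"
  | (conj_rho_lam) i j k y where "(i, j, k) \<in> triples n" "y \<in> gens j"
      "r = relator (conj_word (Gen [] i j k) (pre (rho k) (pre (lam i) y))) (letter (pre (lam i) (pre (rho k) y)))"
  | (conj_lam) i j k z where "(i, j, k) \<in> triples n" "z \<in> gens k"
      "r = relator (conj_word (Gen [] i j k) (pre (lam (i + j)) z)) (letter (pre (lam i) (pre (lam j) z)))"
  | (one) i k where "(i, 1, k) \<in> triples n" "r = relator (letter (Gen [] i 1 k)) []"
  | (lam) a b r' where "(a, b) \<in> pairs n" "r' \<in> rels b" "r = pre_word (lam a) r'"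
  | (rho) a b r' where "(a, b) \<in> pairs n" "r' \<in> rels a" "r = pre_word (rho b) r'"
  | (comm) a b x y where "(a, b) \<in> pairs n" "x \<in> gens a" "y \<in> gens b"
      "r = relator (letter (pre (rho b) x) @ letter (pre (lam a) y)) (letter (pre (lam a) y) @ letter (pre (rho b) x))"
proof -
  have n: "2 \<le> n"
    using assms by (rule rels_ge_2)
  have pairs: "(i, n - i) \<in> pairs n" if "i \<in> {1..n - 1}" for i
    using that by auto
  from assms consider (A) "r \<in> (\<Union>(i, j, k)\<in>triples n. conj_rels i j k)"
    | (B) "r \<in> {relator (letter (Gen [] i j k)) [] | i j k. (i, j, k) \<in> triples1 n}"
    | (C) "r \<in> (\<Union>i\<in>{1..n-1}. pre_word (lam i) ` rels (n - i) \<union> pre_word (rho (n - i)) ` rels i)"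
    | (D) "r \<in> (\<Union>i\<in>{1..n-1}. comm_rels i (n - i))"
    unfolding rels_eq[OF n] by (elim UnE)
  then show ?thesis
  proof cases
    case A
    then obtain i j k where J: "(i, j, k) \<in> triples n" and r: "r \<in> conj_rels i j k"
      by blast
    from r show ?thesis
      unfolding conj_rels_def
      by (elim UnE CollectE exE conjE) (rule conj_rho_rho conj_rho_lam conj_lam; (rule J | assumption))+
  next
    case B
    then obtain i j k where J: "(i, j, k) \<in> triples1 n" and r: "r = relator (letter (Gen [] i j k)) []"
      by blast
    then show ?thesis
      by (intro one[of i k]) (auto simp: triples1_def)
  next
    case C
    then obtain i where i: "i \<in> {1..n - 1}" and r: "r \<in> pre_word (lam i) ` rels (n - i) \<union> pre_word (rho (n - i)) ` rels i"
      by blast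
    from r show ?thesis
      by (elim UnE imageE) (rule lam[OF pairs[OF i]] rho[OF pairs[OF i]]; assumption)+
  next
    case D
    then obtain i where i: "i \<in> {1..n - 1}" and r: "r \<in> comm_rels i (n - i)"
      by blast
    from r show ?thesis
      unfolding comm_rels_def by (elim CollectE exE conjE) (rule comm[OF pairs[OF i]])
  qed
qed

lemma relsI:
  shows "(i, j, k) \<in> triples n \<Longrightarrow> x \<in> gens i \<Longrightarrow>
      relator (conj_word (Gen [] i j k) (pre (rho k) (pre (rho j) x))) (letter (pre (rho (j + k)) x)) \<in> rels n"
    and "(i, j, k) \<in> triples n \<Longrightarrow> y \<in> gens j \<Longrightarrow>
      relator (conj_word (Gen [] i j k) (pre (rho k) (pre (lam i) y))) (letter (pre (lam i) (pre (rho k) y))) \<in> rels n"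
    and "(i, j, k) \<in> triples n \<Longrightarrow> z \<in> gens k \<Longrightarrow>
      relator (conj_word (Gen [] i j k) (pre (lam (i + j)) z)) (letter (pre (lam i) (pre (lam j) z))) \<in> rels n"
    and "(i, 1, k) \<in> triples n \<Longrightarrow> relator (letter (Gen [] i 1 k)) [] \<in> rels n"
    and "(a, b) \<in> pairs n \<Longrightarrow> r \<in> rels b \<Longrightarrow> pre_word (lam a) r \<in> rels n"
    and "(a, b) \<in> pairs n \<Longrightarrow> r \<in> rels a \<Longrightarrow> pre_word (rho b) r \<in> rels n"
    and "(a, b) \<in> pairs n \<Longrightarrow> x \<in> gens a \<Longrightarrow> y \<in> gens b \<Longrightarrow>
      relator (letter (pre (rho b) x) @ letter (pre (lam a) y)) (letter (pre (lam a) y) @ letter (pre (rho b) x)) \<in> rels n"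
proof -
  have conj: "conj_rels i j k \<subseteq> rels n" if J: "(i, j, k) \<in> triples n" for i j k
  proof -
    have n: "2 \<le> n"
      using J by simp
    show ?thesis
      unfolding rels_eq[OF n] using J by blast
  qed
  show "(i, j, k) \<in> triples n \<Longrightarrow> x \<in> gens i \<Longrightarrow>
      relator (conj_word (Gen [] i j k) (pre (rho k) (pre (rho j) x))) (letter (pre (rho (j + k)) x)) \<in> rels n"
    by (erule subsetD[OF conj], unfold conj_rels_def, blast)
  show "(i, j, k) \<in> triples n \<Longrightarrow> y \<in> gens j \<Longrightarrow>
      relator (conj_word (Gen [] i j k) (pre (rho k) (pre (lam i) y))) (letter (pre (lam i) (pre (rho k) y))) \<in> rels n"
    by (erule subsetD[OF conj], unfold conj_rels_def, blast)
  show "(i, j, k) \<in> triples n \<Longrightarrow> z \<in> gens k \<Longrightarrow>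
      relator (conj_word (Gen [] i j k) (pre (lam (i + j)) z)) (letter (pre (lam i) (pre (lam j) z))) \<in> rels n"
    by (erule subsetD[OF conj], unfold conj_rels_def, blast)
  show "relator (letter (Gen [] i 1 k)) [] \<in> rels n" if J: "(i, 1, k) \<in> triples n"
  proof -
    have n: "2 \<le> n" and "(i, 1, k) \<in> triples1 n"
      using J by simp_all
    then show ?thesis
      unfolding rels_eq[OF n] by blast
  qed
  assume ab: "(a, b) \<in> pairs n"
  then have a: "a \<in> {1..n - 1}" and b: "b = n - a" and n: "2 \<le> n"
    by auto
  show "r \<in> rels b \<Longrightarrow> pre_word (lam a) r \<in> rels n"
    and "r \<in> rels a \<Longrightarrow> pre_word (rho b) r \<in> rels n"
    unfolding rels_eq[OF n] b using a by blast+
  have "comm_rels a b \<subseteq> rels n"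
    unfolding rels_eq[OF n] b using a by blast
  then show "x \<in> gens a \<Longrightarrow> y \<in> gens b \<Longrightarrow>
      relator (letter (pre (rho b) x) @ letter (pre (lam a) y)) (letter (pre (lam a) y) @ letter (pre (rho b) x)) \<in> rels n"
    unfolding comm_rels_def by blast
qed

lemma pre_word_in_words:
  assumes "\<And>y. y \<in> S \<Longrightarrow> pre X y \<in> S'" "w \<in> words S" shows "pre_word X w \<in> words S'"
  using assms(2) by (induction w) (auto simp: pre_word_def assms(1) elim!: words_cases)

lemma word_value_pre_word:
  "word_value H d (pre_word X w) = word_value H (d \<circ> pre X) w"
  by (induction w) (auto simp: pre_word_def)

lemma relator_in_words [simp]: "relator u v \<in> words S \<longleftrightarrow> u \<in> words S \<and> v \<in> words S"
  by (simp add: relator_def)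

lemma conj_word_in_words [simp]: "conj_word c x \<in> words S \<longleftrightarrow> c \<in> S \<and> x \<in> S"
  by (auto simp: conj_word_def)

lemma conj_gens:
  assumes J: "(i, j, k) \<in> triples n"
  shows "Gen [] i j k \<in> gens n"
    and "x \<in> gens i \<Longrightarrow> pre (rho j) x \<in> gens (i + j)" "x \<in> gens i \<Longrightarrow> pre (rho k) (pre (rho j) x) \<in> gens n"
    and "x \<in> gens i \<Longrightarrow> pre (rho (j + k)) x \<in> gens n"
    and "y \<in> gens j \<Longrightarrow> pre (lam i) y \<in> gens (i + j)" "y \<in> gens j \<Longrightarrow> pre (rho k) (pre (lam i) y) \<in> gens n"
    and "y \<in> gens j \<Longrightarrow> pre (rho k) y \<in> gens (j + k)" "y \<in> gens j \<Longrightarrow> pre (lam i) (pre (rho k) y) \<in> gens n"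
    and "z \<in> gens k \<Longrightarrow> pre (lam (i + j)) z \<in> gens n"
    and "z \<in> gens k \<Longrightarrow> pre (lam j) z \<in> gens (j + k)" "z \<in> gens k \<Longrightarrow> pre (lam i) (pre (lam j) z) \<in> gens n"
  using J triples_pairs[OF J, THEN pre_lam_in_gens] triples_pairs[OF J, THEN pre_rho_in_gens]
  by (simp_all del: pairs_iff)

lemma rels_words: "rels n \<subseteq> words (gens n)"
proof (induction n rule: less_induct)
  case (less n)
  have "r \<in> words (gens n)" if "r \<in> rels n" for r
    using that
  proof (cases rule: rels_cases)
    case (lam a b r')
    then have "r' \<in> words (gens b)"
      using less.IH[of b] by auto
    then show ?thesis
      unfolding lam(3) by (rule pre_word_in_words[rotated]) (simp add: pre_lam_in_gens[OF lam(1)])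
  next
    case (rho a b r')
    then have "r' \<in> words (gens a)"
      using less.IH[of a] by auto
    then show ?thesis
      unfolding rho(3) by (rule pre_word_in_words[rotated]) (simp add: pre_rho_in_gens[OF rho(1)])
  next
    case conj_rho_rho
    then show ?thesis
      using conj_gens(1,3,4)[OF conj_rho_rho(1)] by (simp del: Gen_in_gens)
  next
    case conj_rho_lam
    then show ?thesis
      using conj_gens(1,6,8)[OF conj_rho_lam(1)] by (simp del: Gen_in_gens)
  next
    case conj_lam
    then show ?thesis
      using conj_gens(1,9,11)[OF conj_lam(1)] by (simp del: Gen_in_gens)
  next
    case one
    then show ?thesis
      by simp
  next
    case comm
    then show ?thesis
      using pre_lam_in_gens[OF comm(1)] pre_rho_in_gens[OF comm(1)] by simp
  qed
  then show ?case
    by blast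
qed

section \<open>The presented groups of all levels and the prefix maps between them\<close>

interpretation presented: presentation "gens n" "rels n" for n
  by unfold_locales (rule rels_words)

context group
begin

lemma conj_relator_value:
  assumes d: "d \<in> S \<rightarrow> carrier G" and "c \<in> S" "x \<in> S" "y \<in> S"
  shows "word_value G d (relator (conj_word c x) (letter y)) = \<one> \<longleftrightarrow> d c \<otimes> d x = d y \<otimes> d c"
proof -
  have c: "d c \<in> carrier G" "d x \<in> carrier G" "d y \<in> carrier G"
    using assms by auto
  have "word_value G d (relator (conj_word c x) (letter y)) = \<one> \<longleftrightarrow> d c \<otimes> d x \<otimes> inv d c = d y"
    using assms c by (subst word_value_relator[OF d]) (simp_all add: conj_word_def m_assoc)
  also have "\<dots> \<longleftrightarrow> d c \<otimes> d x = d y \<otimes> d c"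
    by (rule inv_solve_right') (use c in simp_all)
  finally show ?thesis .
qed

lemma comm_relator_value:
  assumes d: "d \<in> S \<rightarrow> carrier G" and "x \<in> S" "y \<in> S"
  shows "word_value G d (relator (letter x @ letter y) (letter y @ letter x)) = \<one> \<longleftrightarrow> d x \<otimes> d y = d y \<otimes> d x"
proof -
  have "d x \<in> carrier G" "d y \<in> carrier G"
    using assms by auto
  then show ?thesis
    using assms by (subst word_value_relator[OF d]) simp_all
qed

lemma letter_relator_value:
  assumes d: "d \<in> S \<rightarrow> carrier G" and "x \<in> S"
  shows "word_value G d (relator (letter x) []) = \<one> \<longleftrightarrow> d x = \<one>"
proof -
  have "d x \<in> carrier G"
    using assms by auto
  then show ?thesis
    using assms by (subst word_value_relator[OF d]) simp_all
qed

end

text \<open>The map sending g to c h(g) c^-1 is a homomorphism, and the equation says that it agrees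
  with \<open>h'\<close>; hence agreement on generators suffices.\<close>

lemma (in presentation) hom_intertwine:
  assumes H: "group H" and h: "h \<in> hom Q H" "h' \<in> hom Q H" and c: "c \<in> carrier H"
    and eq: "\<And>y. y \<in> S \<Longrightarrow> c \<otimes>\<^bsub>H\<^esub> h (presented_gen S R y) = h' (presented_gen S R y) \<otimes>\<^bsub>H\<^esub> c"
    and g: "g \<in> carrier Q"
  shows "c \<otimes>\<^bsub>H\<^esub> h g = h' g \<otimes>\<^bsub>H\<^esub> c"
proof -
  interpret H: group H by fact
  have solve: "c \<otimes>\<^bsub>H\<^esub> a \<otimes>\<^bsub>H\<^esub> inv\<^bsub>H\<^esub> c = b \<longleftrightarrow> c \<otimes>\<^bsub>H\<^esub> a = b \<otimes>\<^bsub>H\<^esub> c" if "a \<in> carrier H" "b \<in> carrier H" for a b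
    by (rule H.inv_solve_right') (use that c in simp_all)
  note cl = hom_in_carrier[OF h(1)] hom_in_carrier[OF h(2)]
  have "c \<otimes>\<^bsub>H\<^esub> h g \<otimes>\<^bsub>H\<^esub> inv\<^bsub>H\<^esub> c = h' g"
  proof (rule hom_eqI[OF H _ h(2) _ g])
    show "(\<lambda>g. c \<otimes>\<^bsub>H\<^esub> h g \<otimes>\<^bsub>H\<^esub> inv\<^bsub>H\<^esub> c) \<in> hom Q H"
      by (rule homI) (simp_all add: c cl hom_mult[OF h(1)] H.m_assoc H.mult_inv_cancel)
    show "c \<otimes>\<^bsub>H\<^esub> h (presented_gen S R y) \<otimes>\<^bsub>H\<^esub> inv\<^bsub>H\<^esub> c = h' (presented_gen S R y)" if "y \<in> S" for y
      using eq[OF that] that by (subst solve) (simp_all add: cl)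
  qed
  then show ?thesis
    using solve cl g by simp
qed

abbreviation Gam :: "nat \<Rightarrow> gen word set set monoid" where
  "Gam n \<equiv> presented_group (gens n) (rels n)"

abbreviation pgen :: "nat \<Rightarrow> gen \<Rightarrow> gen word set set" where
  "pgen n \<equiv> presented_gen (gens n) (rels n)"

text \<open>The operators \<lambda>^a and \<rho>^b on presented groups. They exist because relation
  3 closes the relators under prefixing.\<close>

definition shift :: "side list \<Rightarrow> nat \<Rightarrow> nat \<Rightarrow> gen word set set \<Rightarrow> gen word set set" where
  "shift X m n = (SOME h. h \<in> hom (Gam m) (Gam n) \<and> (\<forall>y\<in>gens m. h (pgen m y) = pgen n (pre X y)))"

lemma shift_aux:
  assumes gens: "\<And>y. y \<in> gens m \<Longrightarrow> pre X y \<in> gens n" and rels: "\<And>r. r \<in> rels m \<Longrightarrow> pre_word X r \<in> rels n"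
  shows "shift X m n \<in> hom (Gam m) (Gam n) \<and> (\<forall>y\<in>gens m. shift X m n (pgen m y) = pgen n (pre X y))"
proof -
  have d: "pgen n \<circ> pre X \<in> gens m \<rightarrow> carrier (Gam n)"
    using gens presented.gen_closed by auto
  have "word_value (Gam n) (pgen n \<circ> pre X) r = \<one>\<^bsub>Gam n\<^esub>" if "r \<in> rels m" for r
    using presented.relator_value[OF rels[OF that]] by (simp add: word_value_pre_word)
  then obtain h where "h \<in> hom (Gam m) (Gam n)" "\<And>y. y \<in> gens m \<Longrightarrow> h (pgen m y) = (pgen n \<circ> pre X) y"
    using presented.universal[OF presented.group_axioms d] by blast
  then have "\<exists>h. h \<in> hom (Gam m) (Gam n) \<and> (\<forall>y\<in>gens m. h (pgen m y) = pgen n (pre X y))"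
    by auto
  from someI_ex[OF this, folded shift_def] show ?thesis .
qed

lemma shift:
  assumes "(a, b) \<in> pairs n"
  shows shift_lam_hom: "shift (lam a) b n \<in> hom (Gam b) (Gam n)"
    and shift_lam_gen: "y \<in> gens b \<Longrightarrow> shift (lam a) b n (pgen b y) = pgen n (pre (lam a) y)"
    and shift_rho_hom: "shift (rho b) a n \<in> hom (Gam a) (Gam n)"
    and shift_rho_gen: "x \<in> gens a \<Longrightarrow> shift (rho b) a n (pgen a x) = pgen n (pre (rho b) x)"
  using shift_aux[of b "lam a" n] shift_aux[of a "rho b" n] pre_lam_in_gens[OF assms] pre_rho_in_gens[OF assms]
    relsI(5,6)[OF assms] by blast+

text \<open>Relation 4 speaks of generators only. Two rounds of \<open>hom_intertwine\<close> extend
  it one side at a time: a generator against an arbitrary element, and then two arbitrary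
  elements.\<close>

lemma shift_commute:
  assumes ab: "(a, b) \<in> pairs n" and g: "g \<in> carrier (Gam a)" and h: "h \<in> carrier (Gam b)"
  shows "shift (rho b) a n g \<otimes>\<^bsub>Gam n\<^esub> shift (lam a) b n h = shift (lam a) b n h \<otimes>\<^bsub>Gam n\<^esub> shift (rho b) a n g"
proof -
  have gens: "pgen n (pre (rho b) x) \<otimes>\<^bsub>Gam n\<^esub> pgen n (pre (lam a) y) = pgen n (pre (lam a) y) \<otimes>\<^bsub>Gam n\<^esub> pgen n (pre (rho b) x)"
    if "x \<in> gens a" "y \<in> gens b" for x y
    using presented.relator_value[OF relsI(7)[OF ab that]] that pre_lam_in_gens[OF ab, of y] pre_rho_in_gens[OF ab, of x]
    by (subst (asm) presented.comm_relator_value[OF presented.gens_closed]) simp_all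
  have *: "pgen n (pre (lam a) y) \<otimes>\<^bsub>Gam n\<^esub> shift (rho b) a n g = shift (rho b) a n g \<otimes>\<^bsub>Gam n\<^esub> pgen n (pre (lam a) y)"
    if y: "y \<in> gens b" for y
  proof (rule presented.hom_intertwine[OF presented.group_axioms shift_rho_hom[OF ab] shift_rho_hom[OF ab] _ _ g])
    show "pgen n (pre (lam a) y) \<in> carrier (Gam n)"
      using y pre_lam_in_gens[OF ab] by (intro presented.gen_closed) simp
  qed (use gens y shift_rho_gen[OF ab] in simp)
  show ?thesis
  proof (rule presented.hom_intertwine[OF presented.group_axioms shift_lam_hom[OF ab] shift_lam_hom[OF ab] _ _ h])
    show "shift (rho b) a n g \<in> carrier (Gam n)"
      using shift_rho_hom[OF ab] g by (rule hom_in_carrier)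
  qed (use * shift_lam_gen[OF ab] in simp)
qed

text \<open>The three relations 1 extended from generators to all elements by
  \<open>hom_intertwine\<close>, as both sides are built from composites of prefix
  homomorphisms.\<close>

lemma shift_conj:
  assumes J: "(i, j, k) \<in> triples n"
  shows "x \<in> carrier (Gam i) \<Longrightarrow> pgen n (Gen [] i j k) \<otimes>\<^bsub>Gam n\<^esub> shift (rho k) (i + j) n (shift (rho j) i (i + j) x) =
      shift (rho (j + k)) i n x \<otimes>\<^bsub>Gam n\<^esub> pgen n (Gen [] i j k)"
    and "y \<in> carrier (Gam j) \<Longrightarrow> pgen n (Gen [] i j k) \<otimes>\<^bsub>Gam n\<^esub> shift (rho k) (i + j) n (shift (lam i) j (i + j) y) =
      shift (lam i) (j + k) n (shift (rho k) j (j + k) y) \<otimes>\<^bsub>Gam n\<^esub> pgen n (Gen [] i j k)"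
    and "z \<in> carrier (Gam k) \<Longrightarrow> pgen n (Gen [] i j k) \<otimes>\<^bsub>Gam n\<^esub> shift (lam (i + j)) k n z =
      shift (lam i) (j + k) n (shift (lam j) k (j + k) z) \<otimes>\<^bsub>Gam n\<^esub> pgen n (Gen [] i j k)"
proof -
  note t = triples_pairs[OF J] and g = conj_gens[OF J]
  note closed = presented.gen_closed[OF g(1)]
  note conj_value = iffD1[OF presented.conj_relator_value[OF presented.gens_closed] presented.relator_value]
  show "pgen n (Gen [] i j k) \<otimes>\<^bsub>Gam n\<^esub> shift (rho k) (i + j) n (shift (rho j) i (i + j) x) =
      shift (rho (j + k)) i n x \<otimes>\<^bsub>Gam n\<^esub> pgen n (Gen [] i j k)" if "x \<in> carrier (Gam i)"
    using presented.hom_intertwine[OF presented.group_axioms hom_compose[OF shift_rho_hom[OF t(4)] shift_rho_hom[OF t(3)]]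
        shift_rho_hom[OF t(1)] closed _ that]
    by (simp add: shift_rho_gen[OF t(4)] shift_rho_gen[OF t(3)] shift_rho_gen[OF t(1)] g del: Gen_in_gens)
       (use conj_value[OF g(1) g(3) g(4) relsI(1)[OF J]] in blast)
  show "pgen n (Gen [] i j k) \<otimes>\<^bsub>Gam n\<^esub> shift (rho k) (i + j) n (shift (lam i) j (i + j) y) =
      shift (lam i) (j + k) n (shift (rho k) j (j + k) y) \<otimes>\<^bsub>Gam n\<^esub> pgen n (Gen [] i j k)" if "y \<in> carrier (Gam j)"
    using presented.hom_intertwine[OF presented.group_axioms hom_compose[OF shift_lam_hom[OF t(4)] shift_rho_hom[OF t(3)]]
        hom_compose[OF shift_rho_hom[OF t(2)] shift_lam_hom[OF t(1)]] closed _ that]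
    by (simp add: shift_lam_gen[OF t(4)] shift_rho_gen[OF t(3)] shift_rho_gen[OF t(2)] shift_lam_gen[OF t(1)] g del: Gen_in_gens)
       (use conj_value[OF g(1) g(6) g(8) relsI(2)[OF J]] in blast)
  show "pgen n (Gen [] i j k) \<otimes>\<^bsub>Gam n\<^esub> shift (lam (i + j)) k n z =
      shift (lam i) (j + k) n (shift (lam j) k (j + k) z) \<otimes>\<^bsub>Gam n\<^esub> pgen n (Gen [] i j k)" if "z \<in> carrier (Gam k)"
    using presented.hom_intertwine[OF presented.group_axioms shift_lam_hom[OF t(3)]
        hom_compose[OF shift_lam_hom[OF t(2)] shift_lam_hom[OF t(1)]] closed _ that]
    by (simp add: shift_lam_gen[OF t(3)] shift_lam_gen[OF t(2)] shift_lam_gen[OF t(1)] g del: Gen_in_gens)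
       (use conj_value[OF g(1) g(9) g(11) relsI(3)[OF J]] in blast)
qed

lemma pgen_one:
  assumes J: "(i, 1, k) \<in> triples n" shows "pgen n (Gen [] i 1 k) = \<one>\<^bsub>Gam n\<^esub>"
  using presented.relator_value[OF relsI(4)[OF J]]
    presented.letter_relator_value[OF presented.gens_closed conj_gens(1)[OF J]] by simp

context catalan_collapse
begin

section \<open>Values of the formal symbols in \<pi>(A_n)\<close>

declare M_simps [simp del]

text \<open>Taking the prefix as a list makes the recursion structural. The source level of each
  step is recovered as the length of the remaining prefix plus the three indices, and the target is
  one higher.\<close>

fun gam :: "side list \<Rightarrow> nat \<Rightarrow> nat \<Rightarrow> nat \<Rightarrow> 'u" where
  "gam [] i j k = v i j k"
| "gam (Lam # X) i j k = la (Suc (length X + i + j + k)) (length X + i + j + k) (gam X i j k)"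
| "gam (Rho # X) i j k = rh (Suc (length X + i + j + k)) (length X + i + j + k) (gam X i j k)"

fun gamma :: "gen \<Rightarrow> 'u" where
  "gamma (Gen X i j k) = gam X i j k"

lemma gamma_lam_one: "y \<in> gens m \<Longrightarrow> gamma (pre (lam 1) y) = la (Suc m) m (gamma y)"
  by (cases y) auto

lemma gamma_rho_one: "y \<in> gens m \<Longrightarrow> gamma (pre (rho 1) y) = rh (Suc m) m (gamma y)"
  by (cases y) auto

text \<open>Besides the existence half of \<open>corresponds_iff\<close>, this yields an arrow
  representing each symbol, as \<open>la_cls\<close>, \<open>rh_cls\<close> and
  \<open>conj_relations\<close> speak of classes of arrows.\<close>

lemma corresponds_arrow:
  assumes "y \<in> gens n"
  obtains \<phi> where "\<phi> \<in> Arr (A n)" "gamma y = cls n \<phi>" "corresponds A U V q n y (cls n \<phi>)"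
proof -
  have "\<exists>\<phi>\<in>Arr (A n). gamma y = cls n \<phi> \<and> corresponds A U V q n y (cls n \<phi>)"
    using assms
  proof (induction n arbitrary: y rule: less_induct)
    case (less n)
    from less.prems show ?case
    proof (cases rule: gen_cases)
      case (base i j k)
      then have "1 \<le> i" "1 \<le> j" "1 \<le> k"
        by simp_all
      then obtain f g h where o: "f \<in> Obj (A i)" "g \<in> Obj (A j)" "h \<in> Obj (A k)"
        using A.nonempty by (metis ex_in_conv)
      show ?thesis
      proof (intro bexI conjI)
        show "gamma y = cls n (iota_arrow i j k f g h)"
          unfolding cls_iota_arrow[OF base(1) o] base(2) by simp
        show "corresponds A U V q n y (cls n (iota_arrow i j k f g h))"
          unfolding base(2) by (rule corresponds.base[OF base(1) o])
      qed (rule iota_arrow_Arr[OF base(1) o])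
    next
      case (lam y')
      then have n: "1 \<le> n - 1" "n - 1 < n" "Suc (n - 1) = n" "(1 :: nat) < n"
        by auto
      from less.IH[OF n(2) lam(2)] obtain \<phi> where \<phi>: "\<phi> \<in> Arr (A (n - 1))" "gamma y' = cls (n - 1) \<phi>"
          "corresponds A U V q (n - 1) y' (cls (n - 1) \<phi>)"
        by blast
      obtain f where f: "f \<in> Obj (A 1)"
        using A.nonempty[of 1] by auto
      have id: "Ident (A 1) f \<in> Arr (A 1)"
        using f by (intro category.Ident_Arr A.category_A) auto
      show ?thesis
      proof (intro bexI conjI)
        show "gamma y = cls n (ar (U 1 (n - 1)) (Ident (A 1) f, \<phi>))"
          using gamma_lam_one[OF lam(2)] la_cls[OF lam(1) f \<phi>(1)] \<phi>(2) n(3) lam(3) by simp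
        show "corresponds A U V q n y (cls n (ar (U 1 (n - 1)) (Ident (A 1) f, \<phi>)))"
          unfolding lam(3) by (rule corresponds.lam[OF order.refl n(4) \<phi>(1) f \<phi>(3)])
      qed (rule A.U_simps(2)[OF lam(1) id \<phi>(1)])
    next
      case (rho y')
      then have n: "1 \<le> n - 1" "n - 1 < n" "Suc (n - 1) = n" "(1 :: nat) < n"
        by auto
      from less.IH[OF n(2) rho(2)] obtain \<phi> where \<phi>: "\<phi> \<in> Arr (A (n - 1))" "gamma y' = cls (n - 1) \<phi>"
          "corresponds A U V q (n - 1) y' (cls (n - 1) \<phi>)"
        by blast
      obtain f where f: "f \<in> Obj (A 1)"
        using A.nonempty[of 1] by auto
      have id: "Ident (A 1) f \<in> Arr (A 1)"
        using f by (intro category.Ident_Arr A.category_A) auto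
      show ?thesis
      proof (intro bexI conjI)
        show "gamma y = cls n (ar (U (n - 1) 1) (\<phi>, Ident (A 1) f))"
          using gamma_rho_one[OF rho(2)] rh_cls[OF rho(1) f \<phi>(1)] \<phi>(2) n(3) rho(3) by simp
        show "corresponds A U V q n y (cls n (ar (U (n - 1) 1) (\<phi>, Ident (A 1) f)))"
          unfolding rho(3) by (rule corresponds.rho[OF order.refl n(4) \<phi>(1) f \<phi>(3)])
      qed (rule A.U_simps(2)[OF rho(1) \<phi>(1) id])
    qed
  qed
  then show ?thesis
    using that by blast
qed

lemma gens_ge_1: "y \<in> gens n \<Longrightarrow> 1 \<le> n"
  using gens_ge_2 by fastforce

lemma gamma_closed: "y \<in> gens n \<Longrightarrow> gamma y \<in> carrier (M n)"
  using corresponds_arrow cls_closed gens_ge_1 by metis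

text \<open>Prefixes can be merged one letter at a time because \<open>\<langle>i, 1, k\<rangle> = e\<close>.\<close>

lemma gamma_lam:
  assumes "1 \<le> a" "y \<in> gens m"
  shows "gamma (pre (lam a) y) = la (a + m) m (gamma y)"
  using assms
proof (induction a arbitrary: m y rule: nat_induct_at_least)
  case base
  then show ?case
    using gamma_lam_one by simp
next
  case (Suc a)
  \<comment> \<open>At this triple \<open>v\<close> is one, so \<open>conj_relations(3)\<close>
    reads \<lambda>^(a+1) = \<lambda>^a \<lambda>.\<close>
  have J: "(a, 1, m) \<in> triples (Suc a + m)"
    using Suc.hyps gens_ge_1[OF Suc.prems] by simp
  note t = triples_pairs[OF J]
  interpret group "M (Suc (a + m))"
    by (rule group_M) simp
  obtain \<phi> where \<phi>: "\<phi> \<in> Arr (A m)" "gamma y = cls m \<phi>"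
    using corresponds_arrow[OF Suc.prems] by blast
  obtain f g where "f \<in> Arr (A a)" "g \<in> Arr (A 1)"
    using A.nonempty Suc.hyps category.Ident_Arr A.category_A by (metis ex_in_conv order.refl)
  then have "la (Suc a + m) m (cls m \<phi>) = la (Suc a + m) (1 + m) (la (1 + m) m (cls m \<phi>))"
    using conj_relations(3)[OF J _ _ \<phi>(1)] v_one[OF J] hom_in_carrier[OF la_hom[OF t(3)] cls_closed[OF _ \<phi>(1)]]
      hom_in_carrier[OF la_hom[OF t(1)] hom_in_carrier[OF la_hom[OF t(2)] cls_closed[OF _ \<phi>(1)]]]
      gens_ge_1[OF Suc.prems] by simp
  moreover have "pre (lam (Suc a)) y = pre (lam a) (pre (lam 1) y)"
    by (simp add: pre_pre replicate_append_same)
  moreover have "pre (lam 1) y \<in> gens (Suc m)"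
    using Suc.prems pre_in_gens[of "lam 1" y m] by simp
  ultimately show ?case
    using Suc.IH[of "pre (lam 1) y" "Suc m"] gamma_lam_one[OF Suc.prems] \<phi>(2) by simp
qed

lemma gamma_rho:
  assumes "1 \<le> a" "y \<in> gens m"
  shows "gamma (pre (rho a) y) = rh (a + m) m (gamma y)"
  using assms
proof (induction a arbitrary: m y rule: nat_induct_at_least)
  case base
  then show ?case
    using gamma_rho_one by simp
next
  case (Suc a)
  \<comment> \<open>Here \<open>conj_relations(1)\<close> reads \<rho>^a \<rho> =
    \<rho>^(a+1).\<close>
  have J: "(m, 1, a) \<in> triples (Suc a + m)"
    using Suc.hyps gens_ge_1[OF Suc.prems] by simp
  note t = triples_pairs[OF J]
  interpret group "M (Suc (a + m))"
    by (rule group_M) simp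
  obtain \<phi> where \<phi>: "\<phi> \<in> Arr (A m)" "gamma y = cls m \<phi>"
    using corresponds_arrow[OF Suc.prems] by blast
  obtain f g where "f \<in> Arr (A a)" "g \<in> Arr (A 1)"
    using A.nonempty Suc.hyps category.Ident_Arr A.category_A by (metis ex_in_conv order.refl)
  then have "rh (Suc a + m) m (cls m \<phi>) = rh (Suc a + m) (m + 1) (rh (m + 1) m (cls m \<phi>))"
    using conj_relations(1)[OF J \<phi>(1)] v_one[OF J] hom_in_carrier[OF rh_hom[OF t(1)] cls_closed[OF _ \<phi>(1)]]
      hom_in_carrier[OF rh_hom[OF t(3)] hom_in_carrier[OF rh_hom[OF t(4)] cls_closed[OF _ \<phi>(1)]]]
      gens_ge_1[OF Suc.prems] by simp
  moreover have "pre (rho (Suc a)) y = pre (rho a) (pre (rho 1) y)"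
    by (simp add: pre_pre replicate_append_same)
  moreover have "pre (rho 1) y \<in> gens (Suc m)"
    using Suc.prems pre_in_gens[of "rho 1" y m] by simp
  ultimately show ?case
    using Suc.IH[of "pre (rho 1) y" "Suc m"] gamma_rho_one[OF Suc.prems] \<phi>(2) by simp
qed

lemma gamma_pairs:
  assumes "(a, b) \<in> pairs n"
  shows "y \<in> gens b \<Longrightarrow> gamma (pre (lam a) y) = la n b (gamma y)"
    and "x \<in> gens a \<Longrightarrow> gamma (pre (rho b) x) = rh n a (gamma x)"
  using assms gamma_lam[of a y b] gamma_rho[of b x a] by (auto simp: add.commute)

text \<open>Induction over the description shows that no choice of objects, arrows or blocks
  influences the value. Membership of the symbol is carried along because \<open>gamma_pairs\<close>
  asks for it at the lower level.\<close>

lemma corresponds_iff: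
  assumes "y \<in> gens n" shows "corresponds A U V q n y c \<longleftrightarrow> c = gamma y"
proof
  have "y \<in> gens n \<and> c = gamma y" if "corresponds A U V q n y c" for n y c
    using that
  proof induction
    case (base i j k n f g h)
    then show ?case
      using cls_iota_arrow[OF base] conj_gens(1)[OF base(1)] by simp
  next
    case (lam a n \<phi> f y)
    then have ab: "(a, n - a) \<in> pairs n"
      by simp
    show ?case
      using lam.IH la_cls[OF ab lam.hyps(4,3)] gamma_pairs(1)[OF ab, of y] pre_lam_in_gens[OF ab] by simp
  next
    case (rho a n \<phi> f y)
    then have ab: "(n - a, a) \<in> pairs n"
      by simp
    show ?case
      using rho.IH rh_cls[OF ab rho.hyps(4,3)] gamma_pairs(2)[OF ab, of y] pre_rho_in_gens[OF ab] by simp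
  qed
  then show "corresponds A U V q n y c \<Longrightarrow> c = gamma y"
    by blast
  show "c = gamma y \<Longrightarrow> corresponds A U V q n y c"
    using corresponds_arrow[OF assms] by metis
qed

text \<open>Each family has its source: naturality of \<iota> for relations 1, \<open>v_one\<close>
  for 2, the homomorphisms \<open>la\<close> and \<open>rh\<close> together with the induction for
  3, and the two orders in \<open>cls_U\<close> for 4.\<close>

lemma gamma_relators: "r \<in> rels n \<Longrightarrow> word_value (M n) gamma r = \<one>\<^bsub>M n\<^esub>"
proof (induction n arbitrary: r rule: less_induct)
  case (less n)
  have n: "1 \<le> n"
    using rels_ge_2[OF less.prems] by simp
  interpret M: group "M n"
    by (rule group_M[OF n])
  have d: "gamma \<in> gens n \<rightarrow> carrier (M n)"
    using gamma_closed by blast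
  have arr: "\<exists>f. f \<in> Arr (A m)" if "1 \<le> m" for m
    using A.nonempty[OF that] category.Ident_Arr[OF A.category_A[OF that]] by blast
  from less.prems show ?case
  proof (cases rule: rels_cases)
    case (conj_rho_rho i j k x)
    note t = triples_pairs[OF conj_rho_rho(1)] and g = conj_gens[OF conj_rho_rho(1)]
    obtain f where "f \<in> Arr (A i)" "gamma x = cls i f"
      using corresponds_arrow[OF conj_rho_rho(2)] by blast
    moreover obtain g' h where "g' \<in> Arr (A j)" "h \<in> Arr (A k)"
      using arr[of j] arr[of k] conj_rho_rho(1) by auto
    ultimately show ?thesis
      unfolding conj_rho_rho(3) M.conj_relator_value[OF d g(1) g(3)[OF conj_rho_rho(2)] g(4)[OF conj_rho_rho(2)]]
      using conj_relations(1)[OF conj_rho_rho(1)] conj_rho_rho(2) g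
      by (simp add: gamma_pairs[OF t(1)] gamma_pairs[OF t(3)] gamma_pairs[OF t(4)] del: Gen_in_gens)
  next
    case (conj_rho_lam i j k y)
    note t = triples_pairs[OF conj_rho_lam(1)] and g = conj_gens[OF conj_rho_lam(1)]
    obtain g' where "g' \<in> Arr (A j)" "gamma y = cls j g'"
      using corresponds_arrow[OF conj_rho_lam(2)] by blast
    moreover obtain f h where "f \<in> Arr (A i)" "h \<in> Arr (A k)"
      using arr[of i] arr[of k] conj_rho_lam(1) by auto
    ultimately show ?thesis
      unfolding conj_rho_lam(3) M.conj_relator_value[OF d g(1) g(6)[OF conj_rho_lam(2)] g(8)[OF conj_rho_lam(2)]]
      using conj_relations(2)[OF conj_rho_lam(1)] conj_rho_lam(2) g
      by (simp add: gamma_pairs[OF t(1)] gamma_pairs[OF t(2)] gamma_pairs[OF t(3)] gamma_pairs[OF t(4)] del: Gen_in_gens)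
  next
    case (conj_lam i j k z)
    note t = triples_pairs[OF conj_lam(1)] and g = conj_gens[OF conj_lam(1)]
    obtain h where "h \<in> Arr (A k)" "gamma z = cls k h"
      using corresponds_arrow[OF conj_lam(2)] by blast
    moreover obtain f g' where "f \<in> Arr (A i)" "g' \<in> Arr (A j)"
      using arr[of i] arr[of j] conj_lam(1) by auto
    ultimately show ?thesis
      unfolding conj_lam(3) M.conj_relator_value[OF d g(1) g(9)[OF conj_lam(2)] g(11)[OF conj_lam(2)]]
      using conj_relations(3)[OF conj_lam(1)] conj_lam(2) g
      by (simp add: gamma_pairs[OF t(1)] gamma_pairs[OF t(2)] gamma_pairs[OF t(3)] del: Gen_in_gens)
  next
    case (one i k)
    then show ?thesis
      using M.letter_relator_value[OF d conj_gens(1)[OF one(1)]] v_one[OF one(1)] by simp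
  next
    case (lam a b r')
    have b: "b < n" "1 \<le> b"
      using lam(1) by auto
    interpret h: group_hom "M b" "M n" "la n b"
      using group_M[OF b(2)] M.group_axioms la_hom[OF lam(1)] by (simp add: group_hom_def group_hom_axioms_def)
    have "r' \<in> words (gens b)"
      using rels_words lam(2) by blast
    then have "word_value (M n) gamma r = word_value (M n) (la n b \<circ> gamma) r'"
      unfolding lam(3) word_value_pre_word by (rule word_value_cong) (simp add: gamma_pairs[OF lam(1)])
    also have "\<dots> = la n b (word_value (M b) gamma r')"
      by (rule h.hom_word_value[symmetric]) (use gamma_closed \<open>r' \<in> words (gens b)\<close> in auto)
    finally show ?thesis
      using less.IH[OF b(1) lam(2)] by simp
  next
    case (rho a b r')
    have a: "a < n" "1 \<le> a"
      using rho(1) by auto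
    interpret h: group_hom "M a" "M n" "rh n a"
      using group_M[OF a(2)] M.group_axioms rh_hom[OF rho(1)] by (simp add: group_hom_def group_hom_axioms_def)
    have "r' \<in> words (gens a)"
      using rels_words rho(2) by blast
    then have "word_value (M n) gamma r = word_value (M n) (rh n a \<circ> gamma) r'"
      unfolding rho(3) word_value_pre_word by (rule word_value_cong) (simp add: gamma_pairs[OF rho(1)])
    also have "\<dots> = rh n a (word_value (M a) gamma r')"
      by (rule h.hom_word_value[symmetric]) (use gamma_closed \<open>r' \<in> words (gens a)\<close> in auto)
    finally show ?thesis
      using less.IH[OF a(1) rho(2)] by simp
  next
    case (comm a b x y)
    obtain f g where fg: "f \<in> Arr (A a)" "gamma x = cls a f" "g \<in> Arr (A b)" "gamma y = cls b g"
      using corresponds_arrow[OF comm(2)] corresponds_arrow[OF comm(3)] by metis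
    have g: "pre (rho b) x \<in> gens n" "pre (lam a) y \<in> gens n"
      using pre_lam_in_gens[OF comm(1)] pre_rho_in_gens[OF comm(1)] comm by blast+
    show ?thesis
      unfolding comm(4) M.comm_relator_value[OF d g]
      using cls_U[OF comm(1) fg(1,3)] fg by (simp add: gamma_pairs[OF comm(1)] comm)
  qed
qed

definition Psi :: "nat \<Rightarrow> gen word set set \<Rightarrow> 'u" where
  "Psi n = (SOME h. h \<in> hom (Gam n) (M n) \<and> (\<forall>y\<in>gens n. h (pgen n y) = gamma y))"

lemma
  assumes "1 \<le> n"
  shows Psi_hom: "Psi n \<in> hom (Gam n) (M n)"
    and Psi_gen: "y \<in> gens n \<Longrightarrow> Psi n (pgen n y) = gamma y"
proof -
  have d: "gamma \<in> gens n \<rightarrow> carrier (M n)"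
    using gamma_closed by blast
  obtain h where "h \<in> hom (Gam n) (M n)" "\<And>y. y \<in> gens n \<Longrightarrow> h (pgen n y) = gamma y"
    using presented.universal[OF group_M[OF assms] d gamma_relators] by blast
  then have "\<exists>h. h \<in> hom (Gam n) (M n) \<and> (\<forall>y\<in>gens n. h (pgen n y) = gamma y)"
    by blast
  from someI_ex[OF this, folded Psi_def]
  show "Psi n \<in> hom (Gam n) (M n)" and "y \<in> gens n \<Longrightarrow> Psi n (pgen n y) = gamma y"
    by blast+
qed

text \<open>On generators both sides are the value of the prefixed symbol. This compatibility is
  what determines the inverse of \<open>Psi\<close> on values of \<open>U\<close> in
  \<open>Psi_iso\<close>.\<close>

lemma Psi_shift:
  assumes ab: "(a, b) \<in> pairs n"
  shows "g \<in> carrier (Gam b) \<Longrightarrow> Psi n (shift (lam a) b n g) = la n b (Psi b g)"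
    and "h \<in> carrier (Gam a) \<Longrightarrow> Psi n (shift (rho b) a n h) = rh n a (Psi a h)"
proof -
  have n: "1 \<le> n" "1 \<le> a" "1 \<le> b"
    using ab by auto
  note hom = Psi_hom[OF n(1)] Psi_hom[OF n(2)] Psi_hom[OF n(3)]
  show "Psi n (shift (lam a) b n g) = la n b (Psi b g)" if "g \<in> carrier (Gam b)"
  proof -
    have "(Psi n \<circ> shift (lam a) b n) (pgen b y) = (la n b \<circ> Psi b) (pgen b y)" if "y \<in> gens b" for y
      using that by (simp add: shift_lam_gen[OF ab] Psi_gen[OF n(1)] Psi_gen[OF n(3)] gamma_pairs[OF ab] pre_lam_in_gens[OF ab])
    from presented.hom_eqI[OF group_M[OF n(1)] hom_compose[OF shift_lam_hom[OF ab] hom(1)]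
        hom_compose[OF hom(3) la_hom[OF ab]] this that]
    show ?thesis by simp
  qed
  show "Psi n (shift (rho b) a n h) = rh n a (Psi a h)" if "h \<in> carrier (Gam a)"
  proof -
    have "(Psi n \<circ> shift (rho b) a n) (pgen a x) = (rh n a \<circ> Psi a) (pgen a x)" if "x \<in> gens a" for x
      using that by (simp add: shift_rho_gen[OF ab] Psi_gen[OF n(1)] Psi_gen[OF n(2)] gamma_pairs[OF ab] pre_rho_in_gens[OF ab])
    from presented.hom_eqI[OF group_M[OF n(1)] hom_compose[OF shift_rho_hom[OF ab] hom(1)]
        hom_compose[OF hom(2) rh_hom[OF ab]] this that]
    show ?thesis by simp
  qed
qed

end

section \<open>The isomorphism\<close>

lemma exists_inj_countable:
  assumes "infinite (UNIV :: 'u set)" "countable X"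
  obtains e :: "'a \<Rightarrow> 'u" where "inj_on e X"
proof -
  obtain f :: "nat \<Rightarrow> 'u" where "inj f"
    using infinite_countable_subset[OF assms(1)] by blast
  then have "inj_on (f \<circ> to_nat_on X) X"
    using inj_on_to_nat_on[OF assms(2)] by (intro comp_inj_on) (auto intro: inj_on_subset)
  then show ?thesis
    by (rule that)
qed

context catalan_collapse
begin

text \<open>Isolates what is left to check once a functor to the presented group is found, for the
  base case and the inductive step alike. \<open>Psi_\<Phi>\<close> settles one composite and
  \<open>\<Phi>_gen\<close> the other, on generators. Countability supplies the embedding that
  \<open>M_universal\<close> asks for.\<close>

lemma Psi_bij_if:
  assumes inf: "infinite (UNIV :: 'u set)" and n: "1 \<le> n"
    and \<Phi>: "group_functor (A n) (Gam n) \<Phi>"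
    and \<Phi>_L: "\<And>t. t \<in> Arr (T n) \<Longrightarrow> \<Phi> (ar (L n) t) = \<one>\<^bsub>Gam n\<^esub>"
    and Psi_\<Phi>: "\<And>f. f \<in> Arr (A n) \<Longrightarrow> Psi n (\<Phi> f) = cls n f"
    and \<Phi>_gen: "\<And>y. y \<in> gens n \<Longrightarrow> \<exists>f\<in>Arr (A n). gamma y = cls n f \<and> \<Phi> f = pgen n y"
  shows "Psi n \<in> iso (Gam n) (M n)"
proof -
  obtain e :: "gen word set set \<Rightarrow> 'u" where e: "inj_on e (carrier (Gam n))"
    using exists_inj_countable[OF inf presented.countable_carrier] by blast
  obtain h where h: "h \<in> hom (M n) (Gam n)" "\<And>f. f \<in> Arr (A n) \<Longrightarrow> h (cls n f) = \<Phi> f"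
    using M_universal[OF n presented.group_axioms e \<Phi> \<Phi>_L] by blast
  note Psi = Psi_hom[OF n]
  have id: "id \<in> hom G G" for G :: "('z, 'w) monoid_scheme"
    by (rule homI) auto
  have "(Psi n \<circ> h) x = id x" if "x \<in> carrier (M n)" for x
    using n group_M[OF n] hom_compose[OF h(1) Psi] id _ that
    by (rule M_hom_eqI) (simp add: h(2) Psi_\<Phi>)
  moreover have "(h \<circ> Psi n) g = id g" if "g \<in> carrier (Gam n)" for g
    using presented.group_axioms hom_compose[OF Psi h(1)] id _ that
  proof (rule presented.hom_eqI)
    fix y assume y: "y \<in> gens n"
    then show "(h \<circ> Psi n) (pgen n y) = id (pgen n y)"
      using \<Phi>_gen[OF y] h(2) Psi_gen[OF n y] by auto
  qed
  ultimately have "bij_betw (Psi n) (carrier (Gam n)) (carrier (M n))"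
    using hom_in_carrier[OF Psi] hom_in_carrier[OF h(1)] by (intro bij_betwI[where g = h]) auto
  then show ?thesis
    using Psi by (simp add: iso_def)
qed

lemma Psi_iso:
  assumes inf: "infinite (UNIV :: 'u set)" and "1 \<le> n"
  shows "Psi n \<in> iso (Gam n) (M n)"
  using assms(2)
proof (induction n rule: less_induct)
  case (less n)
  note n = \<open>1 \<le> n\<close>
  show ?case
  proof (cases "n = 1")
    case True
    have "cls n f = \<one>\<^bsub>M n\<^esub>" if f: "f \<in> Arr (A n)" for f
    proof -
      interpret category "A n"
        by (rule A.category_A[OF n])
      have "Ident (A n) (Dom (A n) f) \<in> Arr (A n)"
        by (intro Ident_Arr Dom_Obj f)
      then have "f = Ident (A n) (Dom (A n) f)"
        using f A.terminal unfolding True by (intro terminal_cat_eq)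
      then show ?thesis
        using cls_Ident[OF n Dom_Obj[OF f]] by simp
    qed
    \<comment> \<open>At level 1 there are no symbols and every class is trivial, so the constant
      functor will do.\<close>
    then show ?thesis
      using True gens_ge_2[of _ n] hom_one[OF Psi_hom[OF n] presented.group_axioms group_M[OF n]]
      by (intro Psi_bij_if[OF inf n, where \<Phi> = "\<lambda>_. \<one>\<^bsub>Gam n\<^esub>"]) (fastforce intro!: group_functorI)+
  next
    case False
    with n have n2: "2 \<le> n" by simp
    \<comment> \<open>Inverses of \<open>Psi\<close> at lower levels; they turn classes of arrows
      into elements that can be prefixed.\<close>
    define \<Theta> where "\<Theta> m = inv_into (carrier (Gam m)) (Psi m)" for m
    have iso: "Psi m \<in> iso (Gam m) (M m)" if "1 \<le> m" "m < n" for m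
      using less.IH that by blast
    have bij: "bij_betw (Psi m) (carrier (Gam m)) (carrier (M m))" if "1 \<le> m" "m < n" for m
      using iso[OF that] by (simp add: iso_def)
    have \<Theta>_hom: "\<Theta> m \<in> hom (M m) (Gam m)" if "1 \<le> m" "m < n" for m
      using group.iso_set_sym[OF presented.group_axioms iso[OF that]] by (simp add: \<Theta>_def iso_def)
    have Psi_\<Theta>: "Psi m (\<Theta> m x) = x" if "1 \<le> m" "m < n" "x \<in> carrier (M m)" for m x
      unfolding \<Theta>_def by (rule bij_betw_inv_into_right[OF bij[OF that(1,2)] that(3)])
    have \<Theta>_Psi: "\<Theta> m (Psi m g) = g" if "1 \<le> m" "m < n" "g \<in> carrier (Gam m)" for m g
      unfolding \<Theta>_def by (rule bij_betw_inv_into_left[OF bij[OF that(1,2)] that(3)])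
    have \<Theta>_closed: "\<Theta> m (cls m f) \<in> carrier (Gam m)" if "1 \<le> m" "m < n" "f \<in> Arr (A m)" for m f
      using hom_in_carrier[OF \<Theta>_hom[OF that(1,2)] cls_closed[OF that(1,3)]] .
    \<comment> \<open>Obtained by applying \<open>Psi m\<close> to the right side. It is needed at m
      = j + k and m = i + j, for the inner \<open>U\<close> of the two bracketings in
      \<open>natural\<close>.\<close>
    have \<Theta>_U: "\<Theta> m (cls m (ar (U a b) (f, g))) =
        shift (rho b) a m (\<Theta> a (cls a f)) \<otimes>\<^bsub>Gam m\<^esub> shift (lam a) b m (\<Theta> b (cls b g))"
      if ab: "(a, b) \<in> pairs m" and m: "m < n" and f: "f \<in> Arr (A a)" and g: "g \<in> Arr (A b)" for a b m f g
    proof -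
      have less: "1 \<le> a" "a < n" "1 \<le> b" "b < n" "1 \<le> m"
        using ab m by auto
      have cl: "shift (rho b) a m (\<Theta> a (cls a f)) \<in> carrier (Gam m)"
        "shift (lam a) b m (\<Theta> b (cls b g)) \<in> carrier (Gam m)"
        using hom_in_carrier[OF shift_rho_hom[OF ab] \<Theta>_closed[OF less(1,2) f]]
          hom_in_carrier[OF shift_lam_hom[OF ab] \<Theta>_closed[OF less(3,4) g]] .
      have "Psi m (shift (rho b) a m (\<Theta> a (cls a f)) \<otimes>\<^bsub>Gam m\<^esub> shift (lam a) b m (\<Theta> b (cls b g))) =
          cls m (ar (U a b) (f, g))"
        using \<Theta>_closed[OF less(1,2) f] \<Theta>_closed[OF less(3,4) g]
        by (simp add: hom_mult[OF Psi_hom[OF less(5)] cl] Psi_shift[OF ab] cls_U(1)[OF ab f g]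
            Psi_\<Theta>[OF less(1,2) cls_closed[OF less(1) f]] Psi_\<Theta>[OF less(3,4) cls_closed[OF less(3) g]])
      then show ?thesis
        using \<Theta>_Psi[OF less(5) m presented.m_closed[OF cl]] by simp
    qed
    define F where "F a b f = shift (rho b) a n (\<Theta> a (cls a f))" for a b f
    define G where "G a b g = shift (lam a) b n (\<Theta> b (cls b g))" for a b g
    have less: "1 \<le> a" "a < n" "1 \<le> b" "b < n" if "(a, b) \<in> pairs n" for a b
      using that by auto
    have F: "group_functor (A a) (Gam n) (F a b)" and G: "group_functor (A b) (Gam n) (G a b)"
      if ab: "(a, b) \<in> pairs n" for a b
      unfolding F_def G_def
      using group_functor_comp_hom[OF group_functor_comp_hom[OF group_functor_cls \<Theta>_hom] shift_rho_hom[OF ab]]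
        group_functor_comp_hom[OF group_functor_comp_hom[OF group_functor_cls \<Theta>_hom] shift_lam_hom[OF ab]]
        less[OF ab] by blast+
    obtain e :: "gen word set set \<Rightarrow> 'u" where e: "inj_on e (carrier (Gam n))"
      using exists_inj_countable[OF inf presented.countable_carrier] by blast
    have natural: "(F i (j + k) f \<otimes>\<^bsub>Gam n\<^esub> G i (j + k) (ar (U j k) (g, h))) \<otimes>\<^bsub>Gam n\<^esub> pgen n (Gen [] i j k) =
        pgen n (Gen [] i j k) \<otimes>\<^bsub>Gam n\<^esub> (F (i + j) k (ar (U i j) (f, g)) \<otimes>\<^bsub>Gam n\<^esub> G (i + j) k h)"
      if J: "(i, j, k) \<in> triples n" and f: "f \<in> Arr (A i)" and g: "g \<in> Arr (A j)" and h: "h \<in> Arr (A k)"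
      for i j k f g h
    proof -
      note t = triples_pairs[OF J]
      have b: "1 \<le> i" "1 \<le> j" "1 \<le> k" "i < n" "j < n" "k < n" "i + j < n" "j + k < n"
        using J by auto
      define x where "x = \<Theta> i (cls i f)"
      define y where "y = \<Theta> j (cls j g)"
      define z where "z = \<Theta> k (cls k h)"
      have x: "x \<in> carrier (Gam i)" and y: "y \<in> carrier (Gam j)" and z: "z \<in> carrier (Gam k)"
        unfolding x_def y_def z_def using \<Theta>_closed b f g h by blast+
      define c where "c = pgen n (Gen [] i j k)"
      define x1 where "x1 = shift (rho (j + k)) i n x"
      define y1 where "y1 = shift (lam i) (j + k) n (shift (rho k) j (j + k) y)"
      define z1 where "z1 = shift (lam i) (j + k) n (shift (lam j) k (j + k) z)"
      define x2 where "x2 = shift (rho k) (i + j) n (shift (rho j) i (i + j) x)"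
      define y2 where "y2 = shift (rho k) (i + j) n (shift (lam i) j (i + j) y)"
      define z2 where "z2 = shift (lam (i + j)) k n z"
      have sy: "shift (rho k) j (j + k) y \<in> carrier (Gam (j + k))" "shift (lam j) k (j + k) z \<in> carrier (Gam (j + k))"
        "shift (rho j) i (i + j) x \<in> carrier (Gam (i + j))" "shift (lam i) j (i + j) y \<in> carrier (Gam (i + j))"
        using x y z hom_in_carrier[OF shift_rho_hom[OF t(2)]] hom_in_carrier[OF shift_lam_hom[OF t(2)]]
          hom_in_carrier[OF shift_rho_hom[OF t(4)]] hom_in_carrier[OF shift_lam_hom[OF t(4)]] by blast+
      have cl: "c \<in> carrier (Gam n)" "x1 \<in> carrier (Gam n)" "y1 \<in> carrier (Gam n)" "z1 \<in> carrier (Gam n)"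
        "x2 \<in> carrier (Gam n)" "y2 \<in> carrier (Gam n)" "z2 \<in> carrier (Gam n)"
        unfolding c_def x1_def y1_def z1_def x2_def y2_def z2_def
        using presented.gen_closed[OF conj_gens(1)[OF J]] x z sy
          hom_in_carrier[OF shift_rho_hom[OF t(1)]] hom_in_carrier[OF shift_lam_hom[OF t(1)]]
          hom_in_carrier[OF shift_rho_hom[OF t(3)]] hom_in_carrier[OF shift_lam_hom[OF t(3)]] by blast+
      have G1: "G i (j + k) (ar (U j k) (g, h)) = y1 \<otimes>\<^bsub>Gam n\<^esub> z1"
        unfolding G_def \<Theta>_U[OF t(2) b(8) g h] y1_def z1_def y_def[symmetric] z_def[symmetric]
        by (rule hom_mult[OF shift_lam_hom[OF t(1)] sy(1,2)])
      have F2: "F (i + j) k (ar (U i j) (f, g)) = x2 \<otimes>\<^bsub>Gam n\<^esub> y2"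
        unfolding F_def \<Theta>_U[OF t(4) b(7) f g] x2_def y2_def x_def[symmetric] y_def[symmetric]
        by (rule hom_mult[OF shift_rho_hom[OF t(3)] sy(3,4)])
      have conj: "c \<otimes>\<^bsub>Gam n\<^esub> x2 = x1 \<otimes>\<^bsub>Gam n\<^esub> c" "c \<otimes>\<^bsub>Gam n\<^esub> y2 = y1 \<otimes>\<^bsub>Gam n\<^esub> c" "c \<otimes>\<^bsub>Gam n\<^esub> z2 = z1 \<otimes>\<^bsub>Gam n\<^esub> c"
        unfolding c_def x1_def y1_def z1_def x2_def y2_def z2_def using shift_conj[OF J] x y z by blast+
      \<comment> \<open>Both sides are products of three factors; \<open>c\<close> passes to the
        left over the third, the second and the first by relations 1(c), 1(b) and 1(a).\<close>
      have "x1 \<otimes>\<^bsub>Gam n\<^esub> (y1 \<otimes>\<^bsub>Gam n\<^esub> z1) \<otimes>\<^bsub>Gam n\<^esub> c = x1 \<otimes>\<^bsub>Gam n\<^esub> (y1 \<otimes>\<^bsub>Gam n\<^esub> (c \<otimes>\<^bsub>Gam n\<^esub> z2))"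
        using cl by (simp add: presented.m_assoc conj)
      also have "\<dots> = x1 \<otimes>\<^bsub>Gam n\<^esub> (c \<otimes>\<^bsub>Gam n\<^esub> y2) \<otimes>\<^bsub>Gam n\<^esub> z2"
        unfolding conj(2) using cl by (simp add: presented.m_assoc)
      also have "\<dots> = c \<otimes>\<^bsub>Gam n\<^esub> x2 \<otimes>\<^bsub>Gam n\<^esub> y2 \<otimes>\<^bsub>Gam n\<^esub> z2"
        unfolding conj(1) using cl by (simp add: presented.m_assoc)
      also have "\<dots> = c \<otimes>\<^bsub>Gam n\<^esub> ((x2 \<otimes>\<^bsub>Gam n\<^esub> y2) \<otimes>\<^bsub>Gam n\<^esub> z2)"
        using cl by (simp add: presented.m_assoc)
      finally show ?thesis
        unfolding G1 F2 c_def[symmetric]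
        by (simp only: F_def[of i "j + k" f] G_def[of "i + j" k h] x_def[symmetric] z_def[symmetric] x1_def[symmetric] z2_def[symmetric])
    qed
    obtain \<Phi> where \<Phi>: "group_functor (A n) (Gam n) \<Phi>"
      "\<And>a b f g. (a, b) \<in> pairs n \<Longrightarrow> f \<in> Arr (A a) \<Longrightarrow> g \<in> Arr (A b) \<Longrightarrow>
        \<Phi> (ar (U a b) (f, g)) = F a b f \<otimes>\<^bsub>Gam n\<^esub> G a b g"
      "\<And>i j k x y z. (i, j, k) \<in> triples n \<Longrightarrow> x \<in> Obj (A i) \<Longrightarrow> y \<in> Obj (A j) \<Longrightarrow> z \<in> Obj (A k) \<Longrightarrow>
        \<Phi> (iota_arrow i j k x y z) = pgen n (Gen [] i j k)"
    proof (rule A.to_group[OF n2 presented.group_axioms e F G _ _ natural])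
      show "F a b f \<otimes>\<^bsub>Gam n\<^esub> G a b g = G a b g \<otimes>\<^bsub>Gam n\<^esub> F a b f"
        if "(a, b) \<in> pairs n" "f \<in> Arr (A a)" "g \<in> Arr (A b)" for a b f g
        unfolding F_def G_def using that less[OF that(1)] by (intro shift_commute \<Theta>_closed)
      show "pgen n (Gen [] i j k) \<in> carrier (Gam n)" if "(i, j, k) \<in> triples n" for i j k
        by (rule presented.gen_closed[OF conj_gens(1)[OF that]])
    qed blast+
    have F_one: "F a b f = \<one>\<^bsub>Gam n\<^esub>" if "(a, b) \<in> pairs n" "cls a f = \<one>\<^bsub>M a\<^esub>" for a b f
      unfolding F_def that(2)
      using hom_one[OF \<Theta>_hom[OF less(1,2)[OF that(1)]] group_M[OF less(1)[OF that(1)]] presented.group_axioms]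
        hom_one[OF shift_rho_hom[OF that(1)] presented.group_axioms presented.group_axioms] by simp
    have G_one: "G a b f = \<one>\<^bsub>Gam n\<^esub>" if "(a, b) \<in> pairs n" "cls b f = \<one>\<^bsub>M b\<^esub>" for a b f
      unfolding G_def that(2)
      using hom_one[OF \<Theta>_hom[OF less(3,4)[OF that(1)]] group_M[OF less(3)[OF that(1)]] presented.group_axioms]
        hom_one[OF shift_lam_hom[OF that(1)] presented.group_axioms presented.group_axioms] by simp
    have L: "ar (L m) t \<in> Arr (A m)" if "1 \<le> m" "t \<in> Arr (T m)" for t m
      using that by (simp add: is_functorD[OF L_functor])
    show ?thesis
    proof (rule Psi_bij_if[OF inf n \<Phi>(1)])
      \<comment> \<open>Comparison with the constant functor on the generating arrows of
        \<open>T n\<close>: \<open>U\<close> contributes trivial classes, and \<iota> has middle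
        index 1, where relation 2 applies.\<close>
      show "\<Phi> (ar (L n) t) = \<one>\<^bsub>Gam n\<^esub>" if "t \<in> Arr (T n)" for t
        using n2 presented.group_axioms group_functor_comp_functor[OF \<Phi>(1) L_functor[OF n]] _ _ _ that
      proof (rule T.group_functor_eqI)
        show "group_functor (T n) (Gam n) (\<lambda>_. \<one>\<^bsub>Gam n\<^esub>)"
          by (rule group_functorI) auto
        fix a b s t assume ab: "(a, b) \<in> pairs n" and st: "s \<in> Arr (T a)" "t \<in> Arr (T b)"
        note l = less[OF ab]
        show "\<Phi> (ar (L n) (ar (UT a b) (s, t))) = \<one>\<^bsub>Gam n\<^esub>"
          unfolding L_U(2)[OF ab st] \<Phi>(2)[OF ab L[OF l(1) st(1)] L[OF l(3) st(2)]]
          using F_one[OF ab cls_L[OF l(1) st(1)]] G_one[OF ab cls_L[OF l(3) st(2)]] by simp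
      next
        fix i j k x y z
        assume J: "(i, j, k) \<in> triples1 n" and o: "x \<in> Obj (T i)" "y \<in> Obj (T j)" "z \<in> Obj (T k)"
        have J': "(i, 1, k) \<in> triples n" "j = 1" and m: "1 \<le> i" "1 \<le> j" "1 \<le> k"
          using J by auto
        note cat = T.category_A[OF m(1)] T.category_A[OF m(2)] T.category_A[OF m(3)]
        note id = category.Ident_Arr[OF cat(1) o(1)] category.Ident_Arr[OF cat(2) o(2)] category.Ident_Arr[OF cat(3) o(3)]
        have "\<Phi> (iota_arrow i j k (ob (L i) x) (ob (L j) y) (ob (L k) z)) = \<one>\<^bsub>Gam n\<^esub>"
          using \<Phi>(3)[OF J'(1)] pgen_one[OF J'(1)] o is_functorD(1)[OF L_functor] m unfolding J'(2) by metis
        then show "\<Phi> (ar (L n) (ar (VT i j k) (Ident (T i) x, Ident (T j) y, Ident (T k) z, \<iota>))) = \<one>\<^bsub>Gam n\<^esub>"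
          unfolding L_V[OF J id] is_functorD(5)[OF L_functor[OF m(1)] o(1)] is_functorD(5)[OF L_functor[OF m(2)] o(2)]
            is_functorD(5)[OF L_functor[OF m(3)] o(3)] .
      qed
      \<comment> \<open>Checked on generating arrows: on \<open>U\<close>, \<open>Psi n\<close>
        carries the prefix maps to \<open>rh\<close> and \<open>la\<close>, and the inverses at
        lower levels cancel.\<close>
      show "Psi n (\<Phi> f) = cls n f" if "f \<in> Arr (A n)" for f
        using n2 group_M[OF n] group_functor_comp_hom[OF \<Phi>(1) Psi_hom[OF n]] group_functor_cls[OF n] _ _ that
      proof (rule A.group_functor_eqI)
        fix a b f g assume ab: "(a, b) \<in> pairs n" and fg: "f \<in> Arr (A a)" "g \<in> Arr (A b)"
        note l = less[OF ab]
        show "Psi n (\<Phi> (ar (U a b) (f, g))) = cls n (ar (U a b) (f, g))"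
          unfolding \<Phi>(2)[OF ab fg] cls_U(1)[OF ab fg]
          using group_functorD(1)[OF F[OF ab] fg(1)] group_functorD(1)[OF G[OF ab] fg(2)]
            \<Theta>_closed[OF l(1,2) fg(1)] \<Theta>_closed[OF l(3,4) fg(2)]
          by (simp add: hom_mult[OF Psi_hom[OF n]])
            (simp add: F_def G_def Psi_shift[OF ab] Psi_\<Theta>[OF l(1,2) cls_closed[OF l(1) fg(1)]]
              Psi_\<Theta>[OF l(3,4) cls_closed[OF l(3) fg(2)]])
      next
        fix i j k x y z
        assume J: "(i, j, k) \<in> triples n" and o: "x \<in> Obj (A i)" "y \<in> Obj (A j)" "z \<in> Obj (A k)"
        show "Psi n (\<Phi> (iota_arrow i j k x y z)) = cls n (iota_arrow i j k x y z)"
          unfolding \<Phi>(3)[OF J o] cls_iota_arrow[OF J o] Psi_gen[OF n conj_gens(1)[OF J]] by simp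
      qed
      \<comment> \<open>Blocks of one letter suffice for the generators. The identity in the factor
        \<open>A 1\<close> contributes one, so \<open>\<Phi>\<close> yields exactly the prefixed
        generator.\<close>
      show "\<exists>f\<in>Arr (A n). gamma y = cls n f \<and> \<Phi> f = pgen n y" if "y \<in> gens n" for y
        using that
      proof (cases rule: gen_cases)
        case (base i j k)
        then have "1 \<le> i" "1 \<le> j" "1 \<le> k"
          by simp_all
        then obtain f g h where o: "f \<in> Obj (A i)" "g \<in> Obj (A j)" "h \<in> Obj (A k)"
          using A.nonempty by (metis ex_in_conv)
        show ?thesis
          using iota_arrow_Arr[OF base(1) o] cls_iota_arrow[OF base(1) o] \<Phi>(3)[OF base(1) o] base(2)
          by (intro bexI[of _ "iota_arrow i j k f g h"]) simp_all
      next
        case (lam y')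
        note ab = lam(1) and l = less[OF lam(1)]
        obtain \<phi> where \<phi>: "\<phi> \<in> Arr (A (n - 1))" "gamma y' = cls (n - 1) \<phi>"
          using corresponds_arrow[OF lam(2)] by blast
        obtain f where f: "f \<in> Obj (A 1)"
          using A.nonempty[OF l(1)] by blast
        note id = category.Ident_Arr[OF A.category_A[OF l(1)] f]
        have "\<Theta> (n - 1) (cls (n - 1) \<phi>) = pgen (n - 1) y'"
          using \<Theta>_Psi[OF l(3,4) presented.gen_closed[OF lam(2)]] Psi_gen[OF l(3) lam(2)] \<phi>(2) by simp
        then have "G 1 (n - 1) \<phi> = pgen n y"
          using shift_lam_gen[OF ab lam(2)] lam(3) by (simp add: G_def)
        moreover have "pgen n y \<in> carrier (Gam n)"
          by (rule presented.gen_closed) fact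
        ultimately have "\<Phi> (ar (U 1 (n - 1)) (Ident (A 1) f, \<phi>)) = pgen n y"
          using \<Phi>(2)[OF ab id \<phi>(1)] F_one[OF ab cls_Ident[OF l(1) f]] by simp
        moreover have "gamma y = cls n (ar (U 1 (n - 1)) (Ident (A 1) f, \<phi>))"
          unfolding lam(3) gamma_pairs(1)[OF ab lam(2)] \<phi>(2) by (rule la_cls[OF ab f \<phi>(1)])
        ultimately show ?thesis
          using A.U_simps(2)[OF ab id \<phi>(1)] by blast
      next
        case (rho y')
        note ab = rho(1) and l = less[OF rho(1)]
        obtain \<phi> where \<phi>: "\<phi> \<in> Arr (A (n - 1))" "gamma y' = cls (n - 1) \<phi>"
          using corresponds_arrow[OF rho(2)] by blast
        obtain f where f: "f \<in> Obj (A 1)"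
          using A.nonempty[OF l(3)] by blast
        note id = category.Ident_Arr[OF A.category_A[OF l(3)] f]
        have "\<Theta> (n - 1) (cls (n - 1) \<phi>) = pgen (n - 1) y'"
          using \<Theta>_Psi[OF l(1,2) presented.gen_closed[OF rho(2)]] Psi_gen[OF l(1) rho(2)] \<phi>(2) by simp
        then have "F (n - 1) 1 \<phi> = pgen n y"
          using shift_rho_gen[OF ab rho(2)] rho(3) by (simp add: F_def)
        moreover have "pgen n y \<in> carrier (Gam n)"
          by (rule presented.gen_closed) fact
        ultimately have "\<Phi> (ar (U (n - 1) 1) (\<phi>, Ident (A 1) f)) = pgen n y"
          using \<Phi>(2)[OF ab \<phi>(1) id] G_one[OF ab cls_Ident[OF l(3) f]] by simp
        moreover have "gamma y = cls n (ar (U (n - 1) 1) (\<phi>, Ident (A 1) f))"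
          unfolding rho(3) gamma_pairs(2)[OF ab rho(2)] \<phi>(2) by (rule rh_cls[OF ab f \<phi>(1)])
        ultimately show ?thesis
          using A.U_simps(2)[OF ab \<phi>(1) id] by blast
      qed
    qed
  qed
qed

end

text \<open>The witness is \<open>Psi n\<close>. An infinite \<open>'u\<close> has room for copies
  of the countable presented groups, which is how infinitude enters \<open>Psi_iso\<close>.\<close>

theorem mainTheorem5:
  fixes A T P :: "nat \<Rightarrow> ('u, 'u) cat"
    and U UT :: "'u U_family"
    and V VT :: "'u V_family"
    and L q :: "nat \<Rightarrow> ('u, 'u, 'u, 'u) func"
    and p :: "nat \<Rightarrow> (unit, unit \<times> unit, 'u, 'u) func"
    and n :: nat
  assumes "infinite (UNIV :: 'u set)"
    and "catalan_groupoids A U V"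
    and "maximal_indiscrete_subgroupoids T UT VT"
    and "induced_inclusion T UT VT A U V L"
    and "\<And>m. 1 \<le> m \<Longrightarrow> is_collapse (T m) (A m) (L m) (P m) (p m) (q m)"
    and "1 \<le> n"
  shows "one_object_groupoid (P n) \<and>
    (\<exists>h \<in> iso (presented_group (gens n) (rels n)) (arrow_monoid (P n)).
      \<forall>y\<in>gens n. \<forall>c. corresponds A U V q n y c \<longleftrightarrow> c = h (presented_gen (gens n) (rels n) y))"
proof -
  interpret catalan_collapse A T P U UT V VT L q p
    by unfold_locales (use assms in auto)
  have "Psi n \<in> iso (presented_group (gens n) (rels n)) (arrow_monoid (P n))"
    using Psi_iso[OF assms(1,6)] by (simp add: M_def)
  moreover have "corresponds A U V q n y c \<longleftrightarrow> c = Psi n (presented_gen (gens n) (rels n) y)"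
    if "y \<in> gens n" for y c
    using corresponds_iff[OF that] Psi_gen[OF assms(6) that] by simp
  ultimately show ?thesis
    using one_object_groupoid_P[OF assms(6)] by blast
qed

end
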